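(* Let $D>1$ be a squarefree integer that is the discriminant of an integral binary quadratic form (so $D\equiv 1 \bmod 4$). For every wide ideal class $\alpha$ of $\mathbb{Q}(\sqrt D)$ and every $s\in\mathbb{C}$ with $\operatorname{Re} s>1$, $$ \sum_{\beta \in \alpha^{-1}} \Phi_{\beta}(s) = 4\, c(s)\,(i \sqrt D)^s\, \frac{\zeta(\alpha,s)}{\zeta(2 s)}, $$ where the sum is taken over the (one or two) narrow ideal classes $\beta$ contained in the wide class $\alpha^{-1}$.
   Context: Notation. $\mathbb{H}$ is the upper half plane. A quadratic form $Q=[A,B,C]$ is $Q(x,y)=Ax^2+Bxy+Cy^2$; write $Q(z)=Q(z,1)=Az^2+Bz+C$, $Q'(z)=2Az+B$, and $D=B^2-4AC$. For $g=\begin{pmatrix}a&b\\c&d\end{pmatrix}$ put $Q|g(x,y)=Q(ax+by,cx+dy)$ and $gQ=Q|g^{-1}$ (a left action of $SL(2,\mathbb{Z})$, factoring through $\Gamma=PSL(2,\mathbb{Z})$). $\Gamma$ acts on $\mathbb{H}$ by Möbius transformations, and $T=\begin{pmatrix}1&1\\0&1\end{pmatrix}$. For $w\in\mathbb{C}\setminus(-\infty,0]$, $w^s=e^{s\log w}$ with the principal branch of $\log$; in particular $(i\sqrt D)^s=e^{\pi i s/2}D^{s/2}$. For a real form $Q$ with $B^2-4AC>0$ put $\phi(z,Q)=Q(z)/Q'(z)$; it satisfies $\phi(Tz,TQ)=\phi(z,Q)$ and maps $\mathbb{H}$ to $\mathbb{H}$. For $\operatorname{Re}s>1$ and $z\in\mathbb{H}$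 define $$F_Q(s,z)=\sum_{g\in\langle T\rangle\backslash SL(2,\mathbb{Z})}\phi(gz,gQ)^s,$$ an absolutely convergent series, analytic in $z$. The cosets correspond bijectively to the bottom rows $(c,d)$ of $g$, i.e. to all coprime pairs of integers, $(c,d)$ and $(-c,-d)$ being counted separately. For an integral form $Q=[A,B,C]$ of discriminant $D$ (with $D>1$ a squarefree integer, $D\equiv 1\bmod 4$; $Q$ is then automatically primitive), let $(v,u)$ be the smallest positive integer solution of $v^2-Du^2=4$ and $$\gamma_Q=\frac v2 I+\frac u2\begin{pmatrix}-B&-2C\\2A&B\end{pmatrix},$$ which generates the stabilizer of $Q$ in $\Gamma$. The quantity $$-\int_{z_0}^{\gamma_Q z_0}F_Q(s,z)\,\frac{\sqrt D\,dz}{Q(z)}\qquad(z_0\in\mathbb{H},\ \text{path in }\mathbb{H})$$ is independent of $z_0$ and depends only on the orbit $\Gamma Q$. The orbit $\Gamma Q$ corresponds to the narrow ideal class $\beta$ of $\mathbb{Q}(\sqrt D)$ containing the ideal $(2A\mathbb{Z}+(-B+\sqrt D)\mathbb{Z})\,y$, where $y\in\mathbb{Q}(\sqrt D)^\times$ is any element with $\operatorname{sign}(N y)=\operatorname{sign}(A)$; this is a bijection between $\Gamma$-orbits of integral forms of discriminant $D$ and narrow ideal classes. For a narrow class $\beta$, define $$\Phi_\beta(s)=-\int_{z_0}^{\gamma_Q z_0}F_Q(s,z)\,\frac{\sqrt D\,dz}{Q(z)}$$ for any $Q$ in the orbit corresponding to $\beta$ and any $z_0\in\mathbb{H}$. Wide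 ideal classes are classes of nonzero fractional ideals of the ring of integers of $\mathbb{Q}(\sqrt D)$ modulo all principal ideals; narrow classes are classes modulo principal ideals generated by elements of positive norm. For a wide class $\alpha$, $\zeta(\alpha,s)=\sum_{\mathfrak a\in\alpha}(N\mathfrak a)^{-s}$, the sum over nonzero integral ideals in $\alpha$; $\zeta(s)$ is the Riemann zeta function; and $c(s)=\int_{-\infty}^{\infty}\frac{dt}{(e^t+e^{-t})^s}$. *)

theory Defs
  imports
    "HOL-Complex_Analysis.Complex_Analysis"
    "HOL-Computational_Algebra.Computational_Algebra"
    "HOL-Algebra.Coset"
    "HOL-Algebra.Generated_Groups"
begin

section \<open>Binary quadratic forms and the modular group\<close>

datatype 'a bqf = BQF (qA: 'a) (qB: 'a) (qC: 'a)

definition bqf_eval :: "'a::comm_ring_1 bqf \<Rightarrow> 'a \<Rightarrow> 'a \<Rightarrow> 'a" where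
  "bqf_eval Q x y = qA Q * x\<^sup>2 + qB Q * x * y + qC Q * y\<^sup>2"

definition bqf_disc :: "'a::comm_ring_1 bqf \<Rightarrow> 'a" where
  "bqf_disc Q = (qB Q)\<^sup>2 - 4 * qA Q * qC Q"

definition mat2 :: "'a::zero \<Rightarrow> 'a \<Rightarrow> 'a \<Rightarrow> 'a \<Rightarrow> 'a ^ 2 ^ 2" where
  "mat2 a b c d = vector [vector [a, b], vector [c, d]]"

lemma mat2_nth [simp]:
  "mat2 a b c d $ 1 $ 1 = a" "mat2 a b c d $ 1 $ 2 = b"
  "mat2 a b c d $ 2 $ 1 = c" "mat2 a b c d $ 2 $ 2 = d"
  by (simp_all add: mat2_def)

definition SL2Z :: "(int ^ 2 ^ 2) monoid" where
  "SL2Z = \<lparr>carrier = {g. det g = 1}, monoid.mult = (**), one = mat 1\<rparr>"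

definition T_mat :: "int ^ 2 ^ 2" where
  "T_mat = mat2 1 1 0 1"

text \<open>The coefficients of \<open>Q|g\<close>; see \<open>bqf_eval_subst\<close>.\<close>

definition bqf_subst :: "'a::comm_ring_1 bqf \<Rightarrow> int ^ 2 ^ 2 \<Rightarrow> 'a bqf" where
  "bqf_subst Q g =
    (let a = of_int (g $ 1 $ 1); b = of_int (g $ 1 $ 2);
         c = of_int (g $ 2 $ 1); d = of_int (g $ 2 $ 2)
     in BQF (qA Q * a\<^sup>2 + qB Q * a * c + qC Q * c\<^sup>2)
            (2 * qA Q * a * b + qB Q * (a * d + b * c) + 2 * qC Q * c * d)
            (qA Q * b\<^sup>2 + qB Q * b * d + qC Q * d\<^sup>2))"

lemma bqf_eval_subst:
  "bqf_eval (bqf_subst Q g) x y =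
     bqf_eval Q (of_int (g $ 1 $ 1) * x + of_int (g $ 1 $ 2) * y)
                (of_int (g $ 2 $ 1) * x + of_int (g $ 2 $ 2) * y)"
  by (simp add: bqf_eval_def bqf_subst_def Let_def power2_eq_square algebra_simps)

definition bqf_act :: "int ^ 2 ^ 2 \<Rightarrow> 'a::comm_ring_1 bqf \<Rightarrow> 'a bqf" where
  "bqf_act g Q = bqf_subst Q (matrix_inv g)"

lemma mat2_expand: "mat2 (g $ 1 $ 1) (g $ 1 $ 2) (g $ 2 $ 1) (g $ 2 $ 2) = g"
  by (simp add: vec_eq_iff forall_2)

lemma matrix_inv_SL2:
  fixes g :: "int ^ 2 ^ 2"
  assumes "det g = 1"
  shows "matrix_inv g = mat2 (g $ 2 $ 2) (- (g $ 1 $ 2)) (- (g $ 2 $ 1)) (g $ 1 $ 1)"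
    (is "_ = ?h")
proof -
  have d: "g $ 1 $ 1 * g $ 2 $ 2 - g $ 1 $ 2 * g $ 2 $ 1 = 1"
    using assms by (simp add: det_2)
  have "g ** ?h = mat 1 \<and> ?h ** g = mat 1"
    using d by (simp add: vec_eq_iff forall_2 matrix_matrix_mult_def sum_2 mat_def algebra_simps)
  moreover from this have "g ** matrix_inv g = mat 1 \<and> matrix_inv g ** g = mat 1"
    unfolding matrix_inv_def by (rule someI[where x = ?h])
  ultimately show ?thesis
    by (metis matrix_mul_assoc matrix_mul_lid matrix_mul_rid)
qed

lemma group_SL2Z: "group SL2Z"
proof (rule groupI)
  fix g assume "g \<in> carrier SL2Z"
  hence g: "det g = 1" by (simp add: SL2Z_def)
  let ?h = "mat2 (g $ 2 $ 2) (- (g $ 1 $ 2)) (- (g $ 2 $ 1)) (g $ 1 $ 1)"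
  have "?h ** g = mat 1" "det ?h = 1"
    using g by (simp_all add: det_2 vec_eq_iff forall_2 matrix_matrix_mult_def sum_2 mat_def
                  algebra_simps)
  thus "\<exists>h\<in>carrier SL2Z. h \<otimes>\<^bsub>SL2Z\<^esub> g = \<one>\<^bsub>SL2Z\<^esub>"
    by (auto simp: SL2Z_def)
qed (auto simp: SL2Z_def det_mul matrix_mul_assoc)

definition moebius :: "int ^ 2 ^ 2 \<Rightarrow> complex \<Rightarrow> complex" where
  "moebius g z = (of_int (g $ 1 $ 1) * z + of_int (g $ 1 $ 2)) /
                 (of_int (g $ 2 $ 1) * z + of_int (g $ 2 $ 2))"

definition upper_half_plane :: "complex set" where
  "upper_half_plane = {z. Im z > 0}"

section \<open>The functions \<open>\<phi>\<close> and \<open>F\<close>\<close>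

definition bqf_at :: "real bqf \<Rightarrow> complex \<Rightarrow> complex" where
  "bqf_at Q z = bqf_eval (map_bqf of_real Q) z 1"

definition bqf_deriv_at :: "real bqf \<Rightarrow> complex \<Rightarrow> complex" where
  "bqf_deriv_at Q z = 2 * of_real (qA Q) * z + of_real (qB Q)"

definition phi :: "complex \<Rightarrow> real bqf \<Rightarrow> complex" where
  "phi z Q = bqf_at Q z / bqf_deriv_at Q z"

lemma generate_T_mat:
  assumes "h \<in> generate SL2Z {T_mat}"
  shows "\<exists>n. h = mat2 1 n 0 1"
  using assms
proof induction
  case one
  show ?case by (rule exI[of _ 0]) (simp add: SL2Z_def vec_eq_iff forall_2 mat_def)
next
  case (incl h)
  thus ?case by (auto simp: T_mat_def)
next
  case (inv h)
  have T: "mat2 1 (-1) 0 1 \<otimes>\<^bsub>SL2Z\<^esub> T_mat = \<one>\<^bsub>SL2Z\<^esub>"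
    by (simp add: SL2Z_def T_mat_def vec_eq_iff forall_2 matrix_matrix_mult_def sum_2 mat_def)
  have "inv\<^bsub>SL2Z\<^esub> T_mat = mat2 1 (-1) 0 1"
    by (rule group.inv_equality[OF group_SL2Z T]) (simp_all add: SL2Z_def T_mat_def det_2)
  thus ?case using inv by auto
next
  case (eng h1 h2)
  then obtain m n where "h1 = mat2 1 m 0 1" "h2 = mat2 1 n 0 1" by auto
  hence "h1 \<otimes>\<^bsub>SL2Z\<^esub> h2 = mat2 1 (m + n) 0 1"
    by (simp add: SL2Z_def vec_eq_iff forall_2 matrix_matrix_mult_def sum_2)
  thus ?case by auto
qed

lemma phi_translate_invariant:
  assumes "det g = 1" "z \<in> upper_half_plane"
  shows "phi (moebius (mat2 1 n 0 1 ** g) z) (bqf_act (mat2 1 n 0 1 ** g) Q) =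
         phi (moebius g z) (bqf_act g Q)"
proof -
  let ?h = "mat2 1 n 0 1"
  have nz: "of_int (g $ 2 $ 1) * z + of_int (g $ 2 $ 2) \<noteq> 0"
  proof
    assume *: "of_int (g $ 2 $ 1) * z + of_int (g $ 2 $ 2) = 0"
    hence "Im (of_int (g $ 2 $ 1) * z + of_int (g $ 2 $ 2)) = 0" by simp
    hence "g $ 2 $ 1 = 0" using assms(2) by (simp add: upper_half_plane_def)
    moreover from this have "g $ 2 $ 2 = 0" using * by simp
    ultimately show False using assms(1) by (simp add: det_2)
  qed
  have m: "moebius (?h ** g) z = moebius g z + of_int n"
    using nz by (simp add: moebius_def matrix_matrix_mult_def sum_2 divide_simps)
      (simp add: algebra_simps)
  have "det ?h = 1" by (simp add: det_2)
  hence "det (?h ** g) = 1" using assms(1) by (simp only: det_mul mult_1)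
  hence "bqf_act (?h ** g) Q =
      BQF (qA (bqf_act g Q)) (qB (bqf_act g Q) - 2 * of_int n * qA (bqf_act g Q))
        (qC (bqf_act g Q) - of_int n * qB (bqf_act g Q) + (of_int n)\<^sup>2 * qA (bqf_act g Q))"
    using assms(1)
    by (simp add: bqf_act_def matrix_inv_SL2 bqf_subst_def Let_def matrix_matrix_mult_def sum_2
          power2_eq_square algebra_simps)
  thus ?thesis
    unfolding m phi_def
    by (cases "bqf_act g Q")
       (simp add: bqf_at_def bqf_eval_def bqf_deriv_at_def power2_eq_square algebra_simps)
qed

lemma coset_term_unique:
  assumes "X \<in> rcosets\<^bsub>SL2Z\<^esub> (generate SL2Z {T_mat})" "g \<in> X" "z \<in> upper_half_plane"
  shows "the_elem ((\<lambda>g. phi (moebius g z) (bqf_act g Q) powr s) ` X) =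
         phi (moebius g z) (bqf_act g Q) powr s"
proof -
  obtain a where a: "det a = 1" "X = generate SL2Z {T_mat} #>\<^bsub>SL2Z\<^esub> a"
    using assms(1) by (auto simp: RCOSETS_def SL2Z_def)
  have *: "phi (moebius g z) (bqf_act g Q) = phi (moebius a z) (bqf_act a Q)" if gX: "g \<in> X" for g
  proof -
    have mult: "h \<otimes>\<^bsub>SL2Z\<^esub> a = h ** a" for h by (simp add: SL2Z_def)
    obtain h where h: "h \<in> generate SL2Z {T_mat}" "g = h ** a"
      using gX unfolding a(2) r_coset_def mult by blast
    show ?thesis
      using generate_T_mat[OF h(1)] h(2) phi_translate_invariant[OF a(1) assms(3)] by auto
  qed
  have "(\<lambda>g. phi (moebius g z) (bqf_act g Q) powr s) ` X =
        {phi (moebius g z) (bqf_act g Q) powr s}"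
    using * assms(2) by auto
  thus ?thesis by simp
qed

text \<open>
  The sum runs over the right cosets \<open>\<langle>T\<rangle>g\<close>. The summand is constant on each of them
  (\<open>coset_term_unique\<close>), so \<open>the_elem\<close> extracts its common value.
\<close>

definition F :: "real bqf \<Rightarrow> complex \<Rightarrow> complex \<Rightarrow> complex" where
  "F Q s z = (\<Sum>\<^sub>\<infinity>X \<in> rcosets\<^bsub>SL2Z\<^esub> (generate SL2Z {T_mat}).
     the_elem ((\<lambda>g. phi (moebius g z) (bqf_act g Q) powr s) ` X))"

section \<open>The real quadratic field \<open>\<rat>(\<surd>D)\<close> as a subfield of the reals\<close>

definition quad_field :: "int \<Rightarrow> real set" where
  "quad_field D = {of_rat a + of_rat b * sqrt (of_int D) | a b. True}"

text \<open>The description is unique as soon as \<open>D\<close> is not a square.\<close>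

definition quad_norm :: "int \<Rightarrow> real \<Rightarrow> rat" where
  "quad_norm D x =
     (THE n. \<exists>a b. x = of_rat a + of_rat b * sqrt (of_int D) \<and> n = a\<^sup>2 - of_int D * b\<^sup>2)"

definition quad_integers :: "int \<Rightarrow> real set" where
  "quad_integers D = {x \<in> quad_field D. algebraic_int x}"

definition frac_ideals :: "int \<Rightarrow> real set set" where
  "frac_ideals D = {I. I \<subseteq> quad_field D \<and> I \<noteq> {} \<and> I \<noteq> {0} \<and>
     (\<forall>x\<in>I. \<forall>y\<in>I. x + y \<in> I) \<and>
     (\<forall>r\<in>quad_integers D. \<forall>x\<in>I. r * x \<in> I) \<and>
     (\<exists>d\<in>quad_integers D. d \<noteq> 0 \<and> (\<forall>x\<in>I. d * x \<in> quad_integers D))}"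

definition ideal_mult :: "real set \<Rightarrow> real set \<Rightarrow> real set" where
  "ideal_mult I J =
     {(\<Sum>k<n. f k * g k) | (n::nat) f g. \<forall>k<n. f k \<in> I \<and> g k \<in> J}"

definition ideal_group :: "int \<Rightarrow> real set monoid" where
  "ideal_group D = \<lparr>carrier = frac_ideals D, monoid.mult = ideal_mult, one = quad_integers D\<rparr>"

definition principal_ideal :: "int \<Rightarrow> real \<Rightarrow> real set" where
  "principal_ideal D x = (\<lambda>r. x * r) ` quad_integers D"

definition principal_ideals :: "int \<Rightarrow> real set set" where
  "principal_ideals D = {principal_ideal D x | x. x \<in> quad_field D \<and> x \<noteq> 0}"

definition pos_principal_ideals :: "int \<Rightarrow> real set set" where
  "pos_principal_ideals D = {principal_ideal D x | x. x \<in> quad_field D \<and> quad_norm D x > 0}"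

definition wide_class_group :: "int \<Rightarrow> real set set monoid" where
  "wide_class_group D = ideal_group D Mod principal_ideals D"

definition narrow_class_group :: "int \<Rightarrow> real set set monoid" where
  "narrow_class_group D = ideal_group D Mod pos_principal_ideals D"

text \<open>The absolute norm of an integral ideal, as the index of the ideal.\<close>

definition ideal_norm :: "int \<Rightarrow> real set \<Rightarrow> nat" where
  "ideal_norm D I =
     card (quad_integers D //
       {(x, y). x \<in> quad_integers D \<and> y \<in> quad_integers D \<and> x - y \<in> I})"

definition class_zeta :: "int \<Rightarrow> real set set \<Rightarrow> complex \<Rightarrow> complex" where
  "class_zeta D \<alpha> s =
     (\<Sum>\<^sub>\<infinity>I \<in> {I \<in> \<alpha>. I \<subseteq> quad_integers D}. of_nat (ideal_norm D I) powr (- s))"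

text \<open>The Riemann zeta function, in the half plane \<open>Re s > 1\<close> only.\<close>

definition riemann_zeta :: "complex \<Rightarrow> complex" where
  "riemann_zeta s = (\<Sum>n. 1 / of_nat (Suc n) powr s)"

definition c_fun :: "complex \<Rightarrow> complex" where
  "c_fun s = (LINT t|lborel. 1 / of_real (exp t + exp (- t)) powr s)"

section \<open>The cycle integral attached to a narrow ideal class\<close>

definition min_pell :: "int \<Rightarrow> int \<times> int" where
  "min_pell D = (THE (v, u). v > 0 \<and> u > 0 \<and> v\<^sup>2 - D * u\<^sup>2 = 4 \<and>
     (\<forall>v' u'. v' > 0 \<and> u' > 0 \<and> v'\<^sup>2 - D * u'\<^sup>2 = 4 \<longrightarrow> v \<le> v' \<and> u \<le> u'))"

text \<open>
  The divisions are exact: \<open>v\<^sup>2 - D u\<^sup>2 = 4\<close> and \<open>D = B\<^sup>2 - 4AC\<close> force \<open>v\<close> and \<open>u B\<close> to have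
  the same parity (\<open>pell_parity\<close>).
\<close>

definition gamma_mat :: "int bqf \<Rightarrow> int ^ 2 ^ 2" where
  "gamma_mat Q = (let (v, u) = min_pell (bqf_disc Q) in
     mat2 ((v - u * qB Q) div 2) (- u * qC Q) (u * qA Q) ((v + u * qB Q) div 2))"

lemma pell_parity:
  fixes Q :: "int bqf"
  assumes "v\<^sup>2 - bqf_disc Q * u\<^sup>2 = 4"
  shows "even (v - u * qB Q)" "even (v + u * qB Q)"
proof -
  have "v\<^sup>2 = 4 + ((qB Q)\<^sup>2 - 4 * qA Q * qC Q) * u\<^sup>2"
    using assms by (simp add: bqf_disc_def)
  hence "even (v\<^sup>2) = even (4 + ((qB Q)\<^sup>2 - 4 * qA Q * qC Q) * u\<^sup>2)"
    by (rule arg_cong)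
  hence "even v \<longleftrightarrow> even (u * qB Q)"
    by auto
  thus "even (v - u * qB Q)" "even (v + u * qB Q)"
    by (simp_all add: even_diff)
qed

text \<open>The ideal \<open>(2A\<int> + (-B + \<surd>D)\<int>) y\<close>.\<close>

definition form_ideal :: "int \<Rightarrow> int bqf \<Rightarrow> real \<Rightarrow> real set" where
  "form_ideal D Q y =
     {(of_int m * (2 * of_int (qA Q)) + of_int n * (- of_int (qB Q) + sqrt (of_int D))) * y
      | m n. True}"

definition form_in_class :: "int \<Rightarrow> int bqf \<Rightarrow> real set set \<Rightarrow> bool" where
  "form_in_class D Q \<beta> \<longleftrightarrow> bqf_disc Q = D \<and>
     (\<exists>y\<in>quad_field D. y \<noteq> 0 \<and> sgn (quad_norm D y) = of_int (sgn (qA Q)) \<and>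
        form_ideal D Q y \<in> \<beta>)"

text \<open>The common value of the integral for all forms of the class, all base points and all paths.\<close>

definition Phi :: "int \<Rightarrow> real set set \<Rightarrow> complex \<Rightarrow> complex" where
  "Phi D \<beta> s = (THE w. \<forall>Q z\<^sub>0 p.
     form_in_class D Q \<beta> \<and> z\<^sub>0 \<in> upper_half_plane \<and>
     valid_path p \<and> path_image p \<subseteq> upper_half_plane \<and>
     pathstart p = z\<^sub>0 \<and> pathfinish p = moebius (gamma_mat Q) z\<^sub>0 \<longrightarrow>
     w = - contour_integral p (\<lambda>z.
           F (map_bqf of_int Q) s z * of_real (sqrt (of_int D)) / bqf_at (map_bqf of_int Q) z))"

end

theory Submission
  imports Defs
begin

text \<open>
  Let \<open>w, w'\<close> be the roots of \<open>Q = [A, B, C]\<close>, \<open>\<Lambda> = \<int> + \<int> w\<close>, and \<open>\<epsilon> = (v + u \<surd>D)/2\<close>. The cycle integral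
  is a sum over the points of \<open>\<Lambda>\<close> modulo powers of \<open>\<epsilon>\<close>, and such a sum is a class zeta function.

  \<^emph>\<open>Unfolding.\<close> The coordinate \<open>t = log (\<plusminus> (z - w)/(z - w'))\<close> maps the upper half plane to the strip
  \<open>0 < Im t < \<pi>\<close>, turns \<open>\<surd>D dz / Q(z)\<close> into \<open>dt\<close>, and turns \<open>\<gamma>\<^sub>Q\<close> into the translation by
  \<open>- 2 log \<epsilon>\<close> (\<open>strip_coord_deriv\<close>, \<open>strip_coord_gamma\<close>). A coset with bottom row \<open>(c, d)\<close> is recorded
  by the primitive point \<open>x = c w + d\<close> of \<open>\<Lambda>\<close>. Its term in \<open>F\<close> is \<open>(\<surd>D / \<bar>A x x'\<bar>)\<^sup>s h (t + log \<bar>x'/x\<bar>)\<close>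
  with \<open>h t = (1/(exp (-t) - exp t))\<^sup>s\<close> (\<open>phi_eq_kernel_base\<close>). Multiplication of \<open>x\<close> by \<open>\<epsilon>\<close> leaves
  \<open>x x'\<close> alone and shifts \<open>log \<bar>x'/x\<bar>\<close> by one period. The integral of \<open>F\<close> over one period
  is therefore a sum over the primitive points modulo powers of \<open>\<epsilon>\<close>, each of them contributing the
  integral of \<open>h\<close> over a full horizontal line (\<open>primitive_over_period\<close>). On the line \<open>Im t = \<pi>/2\<close>
  that integral is visibly \<open>i\<^sup>s c(s)\<close>, so the cycle integral is \<open>c(s) (i \<surd>D)\<^sup>s\<close> times the sum of
  \<open>\<bar>A x x'\<bar>\<close> to the power \<open>-s\<close>. Passing from primitive points to all nonzero points multiplies this
  sum by \<open>\<zeta>(2s)\<close> (\<open>lattice_zeta_factor\<close>).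

  \<^emph>\<open>Ideals.\<close> Every fractional ideal is a multiple of some \<open>\<Lambda>\<close> (\<open>frac_ideal_eq_form_ideal\<close>), and
  \<open>\<Lambda> \<Lambda>'\<close> is the principal ideal of \<open>1/A\<close> (\<open>lat_times_conjugate\<close>). Hence \<open>x \<mapsto> A x \<Lambda>'\<close> maps the nonzero
  points of \<open>\<Lambda>\<close> onto the integral ideals in the class inverse to that of \<open>\<Lambda>\<close>, the norm of the image
  is \<open>\<bar>A x x'\<bar>\<close>, and two points have the same image exactly if their quotient is a unit. So the
  sum over all nonzero points modulo powers of \<open>\<epsilon>\<close> is \<open>\<zeta>(\<alpha>, s)\<close> times the number of units modulo
  powers of \<open>\<epsilon>\<close> (\<open>lattice_sum_eq_class_zeta\<close>). All units of norm one are of the form \<open>\<plusminus> \<epsilon>\<^sup>k\<close>.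

  \<^emph>\<open>The factor 4.\<close> If some unit has norm \<open>-1\<close>, there are four units modulo powers of \<open>\<epsilon>\<close> and the
  wide class is a single narrow class. Otherwise there are two such units and the wide class splits
  into two narrow classes, with equal values of \<open>\<Phi>\<close>. The product is 4 in either case.
\<close>

section \<open>Unfolding a period integral on the strip\<close>

definition strip :: "complex set" where
  "strip = {t. 0 < Im t \<and> Im t < pi}"

text \<open>
  In the coordinate \<open>t\<close> of the strip, each term of \<open>F\<close> is a positive number to the power \<open>s\<close> times a
  real translate of this function.
\<close>

definition strip_kernel :: "complex \<Rightarrow> complex \<Rightarrow> complex" where
  "strip_kernel s t = (1 / (exp (- t) - exp t)) powr s"

lemma open_strip: "open strip"
proof -
  have "strip = {t. 0 < Im t} \<inter> {t. Im t < pi}" by (auto simp: strip_def)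
  thus ?thesis by (metis open_Int open_halfspace_Im_gt open_halfspace_Im_lt)
qed

lemma convex_strip: "convex strip"
proof -
  have "strip = {t. 0 < Im t} \<inter> {t. Im t < pi}" by (auto simp: strip_def)
  thus ?thesis by (metis convex_Int convex_halfspace_Im_gt convex_halfspace_Im_lt)
qed

lemma strip_add_real: "t + of_real x \<in> strip \<longleftrightarrow> t \<in> strip"
  by (simp add: strip_def)

lemma Im_kernel_denominator:
  "Im (exp (- t) - exp t) = - ((exp (Re t) + exp (- Re t)) * sin (Im t))"
  by (simp add: Im_exp algebra_simps)

text \<open>
  This keeps the base of the complex power away from the branch cut of the logarithm.
\<close>

lemma kernel_base_upper:
  assumes "t \<in> strip"
  shows "Im (1 / (exp (- t) - exp t)) > 0"
proof -
  have "Im (exp (- t) - exp t) < 0"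
    unfolding Im_kernel_denominator using assms
    by (auto simp: strip_def intro!: mult_pos_pos add_pos_pos sin_gt_zero)
  moreover have "Im (1 / w) > 0" if "Im w < 0" for w :: complex
    using that by (simp add: Im_divide sum_power2_gt_zero_iff divide_simps)
  ultimately show ?thesis by blast
qed

lemma kernel_holomorphic: "strip_kernel s holomorphic_on strip"
proof -
  have "1 / (exp (- t) - exp t) \<notin> \<real>\<^sub>\<le>\<^sub>0" "exp (- t) - exp t \<noteq> 0" if "t \<in> strip" for t
    using kernel_base_upper[OF that] by (auto simp: complex_nonpos_Reals_iff)
  thus ?thesis unfolding strip_kernel_def
    by (intro holomorphic_intros) auto
qed

text \<open>
  The denominator is at least as large as its imaginary part, and the argument of the base is bounded
  by \<open>\<pi>\<close>, so the imaginary part of \<open>s\<close> costs only a constant factor.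
\<close>

lemma norm_kernel_le:
  assumes "t \<in> strip" "Re s > 0"
  shows "norm (strip_kernel s t) \<le> exp (\<bar>Im s\<bar> * pi) *
           ((exp (Re t) + exp (- Re t)) * sin (Im t)) powr (- Re s)"
proof -
  define w where "w = exp (- t) - exp t"
  define b where "b = (exp (Re t) + exp (- Re t)) * sin (Im t)"
  have b: "b > 0" unfolding b_def using assms
    by (auto simp: strip_def intro!: mult_pos_pos add_pos_pos sin_gt_zero)
  have "b = \<bar>Im w\<bar>" using b Im_kernel_denominator[of t] by (simp add: w_def b_def)
  hence bw: "b \<le> norm w" using abs_Im_le_cmod[of w] by simp
  have "norm (strip_kernel s t) = norm (1 / w) powr Re s * exp (- Im s * Arg (1 / w))"
    by (simp add: strip_kernel_def w_def norm_powr_complex)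
  also have "\<dots> \<le> b powr (- Re s) * exp (\<bar>Im s\<bar> * pi)"
  proof (rule mult_mono)
    have "norm (1 / w) powr Re s = norm w powr (- Re s)"
      using b bw by (simp add: norm_divide powr_divide powr_minus_divide)
    also have "\<dots> \<le> b powr (- Re s)"
      using b bw assms(2) by (intro powr_mono2') auto
    finally show "norm (1 / w) powr Re s \<le> b powr (- Re s)" .
    have "- Im s * Arg (1 / w) \<le> \<bar>Im s\<bar> * \<bar>Arg (1 / w)\<bar>"
      by (metis abs_ge_self abs_minus_cancel abs_mult)
    also have "\<dots> \<le> \<bar>Im s\<bar> * pi"
      using Arg_bounded[of "1 / w"] by (intro mult_left_mono) auto
    finally show "exp (- Im s * Arg (1 / w)) \<le> exp (\<bar>Im s\<bar> * pi)" by simp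
  qed auto
  finally show ?thesis by (simp add: b_def mult.commute)
qed

text \<open>
  The bound is uniform in the translation \<open>l\<close>, which is what the locally uniform convergence of sums of
  translates rests on. On a compact set \<open>sin (Im t)\<close> is bounded away from zero, and \<open>Re t\<close> is bounded,
  so that adding it to \<open>l\<close> changes \<open>exp l + exp (- l)\<close> by a bounded factor only.
\<close>

lemma kernel_bound_on_compact:
  assumes "compact K" "K \<subseteq> strip" "Re s > 0"
  obtains C where "C > 0"
    "\<And>t l. t \<in> K \<Longrightarrow> norm (strip_kernel s (t + of_real l)) \<le> C * (exp l + exp (- l)) powr (- Re s)"
proof (cases "K = {}")
  case True
  thus ?thesis using that[of 1] by auto
next
  case False
  have "continuous_on K (\<lambda>t. sin (Im t))" by (intro continuous_intros)
  from continuous_attains_inf[OF assms(1) False this]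
  obtain t0 where t0: "t0 \<in> K" "\<And>t. t \<in> K \<Longrightarrow> sin (Im t0) \<le> sin (Im t)" by blast
  define m where "m = sin (Im t0)"
  have m: "m > 0" using t0(1) assms(2) by (auto simp: m_def strip_def intro!: sin_gt_zero)
  from compact_imp_bounded[OF assms(1)] obtain R where R: "\<And>t. t \<in> K \<Longrightarrow> norm t \<le> R"
    by (auto simp: bounded_iff)
  \<comment> \<open>Here \<open>m\<close> bounds \<open>sin (Im t)\<close> from below and \<open>R\<close> bounds \<open>\<bar>Re t\<bar>\<close>.\<close>
  define C where "C = exp (\<bar>Im s\<bar> * pi) * (m * exp (- R)) powr (- Re s)"
  show ?thesis
  proof (rule that[of C])
    show "C > 0" using m by (simp add: C_def)
    fix t and l :: real assume t: "t \<in> K"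
    have Re: "\<bar>Re t\<bar> \<le> R" using R[OF t] abs_Re_le_cmod[of t] by linarith
    have ts: "t + of_real l \<in> strip" using t assms(2) by (auto simp: strip_add_real)
    have e: "exp (- R) * exp l \<le> exp (Re t + l)" "exp (- R) * exp (- l) \<le> exp (- (Re t + l))"
      using Re by (simp_all flip: exp_add)
    have "m * exp (- R) * (exp l + exp (- l)) = (exp (- R) * exp l + exp (- R) * exp (- l)) * m"
      by (simp add: algebra_simps)
    also have "\<dots> \<le> (exp (Re t + l) + exp (- (Re t + l))) * sin (Im t)"
      using e t0(2)[OF t] m by (intro mult_mono add_mono) (auto simp: m_def)
    finally have le: "m * exp (- R) * (exp l + exp (- l)) \<le>
       (exp (Re t + l) + exp (- (Re t + l))) * sin (Im t)" .
    have pos: "exp l + exp (- l) > 0" by (intro add_pos_pos) auto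
    have "norm (strip_kernel s (t + of_real l)) \<le> exp (\<bar>Im s\<bar> * pi) *
        ((exp (Re t + l) + exp (- (Re t + l))) * sin (Im t)) powr (- Re s)"
      using norm_kernel_le[OF ts assms(3)] by simp
    also have "\<dots> \<le> exp (\<bar>Im s\<bar> * pi) * (m * exp (- R) * (exp l + exp (- l))) powr (- Re s)"
      using le m pos assms(3) by (intro mult_left_mono powr_mono2') auto
    also have "\<dots> = C * (exp l + exp (- l)) powr (- Re s)"
      using m pos by (simp add: C_def powr_mult)
    finally show "norm (strip_kernel s (t + of_real l)) \<le> C * (exp l + exp (- l)) powr (- Re s)" .
  qed
qed

text \<open>
  The line \<open>Im t = \<pi>/2\<close> is the image of the geodesic that joins the two roots of the form.
\<close>

definition mid_kernel :: "complex \<Rightarrow> real \<Rightarrow> complex" where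
  "mid_kernel s u = strip_kernel s (\<i> * of_real (pi / 2) + of_real u)"

lemma mid_point_strip: "\<i> * of_real (pi / 2) + of_real u \<in> strip"
  by (simp add: strip_def)

lemma powr_of_real_mult:
  assumes "r > 0" "z \<noteq> 0"
  shows "(of_real r * z) powr s = of_real r powr s * z powr (s::complex)"
  using assms by (simp add: powr_def Ln_times_of_real Ln_of_real distrib_left exp_add)

lemma powr_of_real_inverse:
  assumes "r > 0"
  shows "of_real (1 / r) powr (s::complex) = 1 / of_real r powr s"
proof -
  have "Ln (of_real (1 / r)) = - Ln (of_real r)"
    using assms by (simp only: Ln_of_real zero_less_divide_1_iff ln_div ln_one) simp
  thus ?thesis using assms by (simp add: powr_def exp_minus inverse_eq_divide)
qed

text \<open>
  On the middle line the base of the power is a positive multiple of \<open>i\<close>; hence the factor \<open>i\<^sup>s\<close>, and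
  hence the integrand of \<open>c(s)\<close>.
\<close>

lemma mid_kernel_eq:
  "mid_kernel s u = \<i> powr s * (1 / of_real (exp u + exp (- u)) powr s)"
proof -
  define r where "r = exp u + exp (- u)"
  define m where "m = \<i> * of_real (pi / 2) + of_real u"
  have pos: "r > 0" unfolding r_def by (intro add_pos_pos) auto
  have e: "exp m = \<i> * of_real (exp u)"
    using exp_Euler[of "of_real (pi / 2)"]
    by (simp only: m_def exp_add exp_of_real) (simp flip: cos_of_real sin_of_real)
  have eq: "exp (- m) - exp m = - \<i> * of_real r"
    unfolding exp_minus e r_def by (simp add: exp_minus algebra_simps)
  have "1 / (exp (- m) - exp m) = of_real (1 / r) * \<i>"
    unfolding eq using pos by (simp add: divide_simps)
  hence "mid_kernel s u = (of_real (1 / r) * \<i>) powr s"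
    unfolding mid_kernel_def strip_kernel_def m_def by simp
  also have "\<dots> = of_real (1 / r) powr s * \<i> powr s"
    using pos by (intro powr_of_real_mult) auto
  also have "complex_of_real (1 / r) powr s = 1 / of_real r powr s"
    by (rule powr_of_real_inverse[OF pos])
  finally show ?thesis by (simp add: r_def)
qed

lemma mid_kernel_continuous: "continuous_on A (mid_kernel s)"
proof -
  have "continuous_on strip (strip_kernel s)"
    by (intro holomorphic_on_imp_continuous_on kernel_holomorphic)
  thus ?thesis unfolding mid_kernel_def
    by (rule continuous_on_compose2) (auto intro!: continuous_intros simp: strip_def)
qed

lemma mid_kernel_bound:
  assumes "Re s > 0"
  obtains C where "C > 0" "\<And>u. norm (mid_kernel s u) \<le> C * (exp u + exp (- u)) powr (- Re s)"
proof -
  have sub: "{\<i> * of_real (pi / 2)} \<subseteq> strip" using mid_point_strip[of 0] by simp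
  obtain C where C: "C > 0" "\<And>l. norm (strip_kernel s (\<i> * of_real (pi / 2) + of_real l)) \<le>
       C * (exp l + exp (- l)) powr (- Re s)"
    by (rule kernel_bound_on_compact[OF _ sub assms]) auto
  thus ?thesis using that[of C] by (simp add: mid_kernel_def)
qed

text \<open>
  The integrand decays like \<open>exp (- Re s \<bar>u\<bar>)\<close> in both directions.
\<close>

lemma mid_kernel_integrable:
  assumes "Re s > 0"
  shows "integrable lborel (mid_kernel s)"
proof -
  define r where "r = Re s"
  have r: "r > 0" using assms by (simp add: r_def)
  define g :: "real \<Rightarrow> real" where "g = (\<lambda>u. indicator {0..} u * exp (- r * u))"
  have "(\<lambda>x. exp (- r * x)) absolutely_integrable_on {0..}"
    using integrable_on_exp_minus_to_infinity[OF r, of 0]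
    by (intro nonnegative_absolutely_integrable_1) auto
  hence "integrable lebesgue g" by (simp add: set_integrable_def g_def)
  moreover have "g \<in> borel_measurable lborel" unfolding g_def by measurable
  ultimately have g: "integrable lborel g" by (simp add: integrable_completion)
  have g': "integrable lborel (\<lambda>u. g (- u))"
    using lborel_integrable_real_affine[OF g, of "-1" 0] by simp
  obtain C where C: "C > 0" "\<And>u. norm (mid_kernel s u) \<le> C * (exp u + exp (- u)) powr (- r)"
    using mid_kernel_bound[OF assms] unfolding r_def by metis
  show ?thesis
  proof (rule Bochner_Integration.integrable_bound)
    show "integrable lborel (\<lambda>u. C * (g u + g (- u)))" using g g' by auto
    show "mid_kernel s \<in> borel_measurable lborel"
      using mid_kernel_continuous[of UNIV s] by (simp add: borel_measurable_continuous_onI)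
    show "AE u in lborel. norm (mid_kernel s u) \<le> norm (C * (g u + g (- u)))"
    proof (rule AE_I2)
      fix u :: real
      have "exp \<bar>u\<bar> \<le> exp u + exp (- u)" by (cases "u \<ge> 0") auto
      hence "(exp u + exp (- u)) powr (- r) \<le> exp \<bar>u\<bar> powr (- r)"
        using r by (intro powr_mono2') auto
      also have "\<dots> = exp (- r * \<bar>u\<bar>)" by (simp add: powr_def)
      also have "\<dots> \<le> g u + g (- u)"
        by (auto simp: g_def indicator_def abs_if)
      finally have "C * (exp u + exp (- u)) powr (- r) \<le> C * (g u + g (- u))"
        using C(1) by simp
      with C(2)[of u] show "norm (mid_kernel s u) \<le> norm (C * (g u + g (- u)))"
        by (auto intro: order.trans)
    qed
  qed
qed

lemma integral_mid_kernel: "(LINT u|lborel. mid_kernel s u) = \<i> powr s * c_fun s"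
  unfolding mid_kernel_eq c_fun_def by (rule Bochner_Integration.integral_mult_right_zero)

lemma mid_kernel_integrable_on: "mid_kernel s integrable_on {a..b}"
  by (rule integrable_continuous_interval) (rule mid_kernel_continuous)

text \<open>
  The line is exhausted by whole numbers of periods around an arbitrary centre, because an orbit
  contributes one integral over a period for each integer.
\<close>

lemma mid_kernel_integral_limit:
  assumes "Re s > 0" and p: "p > 0"
  shows "(\<lambda>N::nat. integral {c - p * real N .. c + p * real N} (mid_kernel s)) \<longlonglongrightarrow>
           (LINT u|lborel. mid_kernel s u)"
proof -
  have int: "integrable lborel (mid_kernel s)" by (rule mid_kernel_integrable[OF assms(1)])
  have eq: "integral {a..b} (mid_kernel s) =
     (LINT u|lborel. indicator {a..b} u *\<^sub>R mid_kernel s u)" for a b :: real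
  proof -
    have "set_integrable lborel {a..b} (mid_kernel s)"
      unfolding set_integrable_def using int by (intro integrable_mult_indicator) auto
    from set_borel_integral_eq_integral(2)[OF this] show ?thesis
      by (simp add: set_lebesgue_integral_def)
  qed
  show ?thesis unfolding eq
  proof (rule integral_dominated_convergence[where w = "\<lambda>u. norm (mid_kernel s u)"])
    show "AE u in lborel. (\<lambda>N. indicator {c - p * real N .. c + p * real N} u *\<^sub>R mid_kernel s u)
            \<longlonglongrightarrow> mid_kernel s u"
    proof (rule AE_I2)
      fix u :: real
      have "eventually (\<lambda>N::nat. \<bar>u - c\<bar> / p \<le> real N) sequentially"
        using filterlim_real_sequentially by (auto simp: filterlim_at_top)
      hence "eventually (\<lambda>N. indicator {c - p * real N .. c + p * real N} u *\<^sub>R mid_kernel s u =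
               mid_kernel s u) sequentially"
      proof eventually_elim
        case (elim N)
        hence "\<bar>u - c\<bar> \<le> p * real N" using p by (simp add: field_simps)
        hence "u \<in> {c - p * real N .. c + p * real N}" by auto
        thus ?case by simp
      qed
      thus "(\<lambda>N. indicator {c - p * real N .. c + p * real N} u *\<^sub>R mid_kernel s u)
            \<longlonglongrightarrow> mid_kernel s u"
        by (rule tendsto_eventually)
    qed
  qed (use int in \<open>auto intro!: AE_I2 simp: indicator_def\<close>)
qed

lemma sum_int_interval_integral:
  fixes f :: "real \<Rightarrow> complex"
  assumes f: "\<And>a b. f integrable_on {a..b}" and p: "p > 0"
  shows "(\<Sum>n\<in>{- int N..<int N}. integral {c + p * of_int n .. c + p * of_int n + p} f) =
           integral {c - p * real N .. c + p * real N} f"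
proof (induction N)
  case 0
  show ?case by simp
next
  case (Suc N)
  have set: "{- int (Suc N)..<int (Suc N)} = insert (- int (Suc N)) (insert (int N) {- int N..<int N})"
    by auto
  have "(\<Sum>n\<in>{- int (Suc N)..<int (Suc N)}. integral {c + p * of_int n .. c + p * of_int n + p} f) =
     integral {c - p * real (Suc N) .. c - p * real N} f +
     (integral {c - p * real N .. c + p * real N} f +
      integral {c + p * real N .. c + p * real (Suc N)} f)"
    unfolding set using Suc by (subst sum.insert; simp add: algebra_simps)+
  also have "integral {c - p * real N .. c + p * real N} f +
      integral {c + p * real N .. c + p * real (Suc N)} f =
      integral {c - p * real N .. c + p * real (Suc N)} f"
  proof (rule Henstock_Kurzweil_Integration.integral_combine)
    have "p * real N \<ge> 0" "p * real N \<le> p * real (Suc N)" using p by auto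
    thus "c - p * real N \<le> c + p * real N" "c + p * real N \<le> c + p * real (Suc N)"
      by linarith+
  qed (rule f)
  also have "integral {c - p * real (Suc N) .. c - p * real N} f + \<dots> =
      integral {c - p * real (Suc N) .. c + p * real (Suc N)} f"
  proof (rule Henstock_Kurzweil_Integration.integral_combine)
    have "p * real N \<ge> 0" "p * real N \<le> p * real (Suc N)" using p by auto
    thus "c - p * real (Suc N) \<le> c - p * real N" "c - p * real N \<le> c + p * real (Suc N)"
      by linarith+
  qed (rule f)
  finally show ?case .
qed

text \<open>
  The unfolding argument in abstract form. Each point \<open>x\<close> has a weight \<open>a x\<close> and a position \<open>l x\<close> on the
  real line, and the integers act on the points by translating the position by multiples of the period
  \<open>p\<close> without changing the weight. Below, the points are the primitive points of a lattice and the
  action is multiplication by powers of a unit.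
\<close>

locale period_sum =
  fixes X :: "'x set" and a :: "'x \<Rightarrow> complex" and l :: "'x \<Rightarrow> real"
    and act :: "int \<Rightarrow> 'x \<Rightarrow> 'x" and p :: real and s :: complex
  assumes p: "p > 0" and s: "Re s > 0"
    and summable: "(\<lambda>x. norm (a x) * (exp (l x) + exp (- l x)) powr (- Re s)) summable_on X"
    and act_in: "\<And>n x. x \<in> X \<Longrightarrow> act n x \<in> X"
    and act_add: "\<And>m n x. x \<in> X \<Longrightarrow> act m (act n x) = act (m + n) x"
    and act_0: "\<And>x. x \<in> X \<Longrightarrow> act 0 x = x"
    and a_act: "\<And>n x. x \<in> X \<Longrightarrow> a (act n x) = a x"
    and l_act: "\<And>n x. x \<in> X \<Longrightarrow> l (act n x) = l x + p * of_int n"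
begin

definition G :: "complex \<Rightarrow> complex" where
  "G t = (\<Sum>\<^sub>\<infinity>x\<in>X. a x * strip_kernel s (t + of_real (l x)))"

text \<open>
  Every orbit of the action has exactly one point in this set (\<open>bij_orbits\<close>).
\<close>

definition Y :: "'x set" where
  "Y = {x \<in> X. 0 \<le> l x \<and> l x < p}"

text \<open>
  The M-test, with the bound on the kernel that is uniform in the translation.
\<close>

lemma G_uniform:
  assumes "compact K" "K \<subseteq> strip"
  shows "uniform_limit K (\<lambda>F t. \<Sum>x\<in>F. a x * strip_kernel s (t + of_real (l x))) G
           (finite_subsets_at_top X)"
proof -
  obtain C where C: "C > 0" "\<And>t l. t \<in> K \<Longrightarrow>
      norm (strip_kernel s (t + of_real l)) \<le> C * (exp l + exp (- l)) powr (- Re s)"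
    using kernel_bound_on_compact[OF assms s] by metis
  have "uniform_limit K (\<lambda>F t. \<Sum>x\<in>F. a x * strip_kernel s (t + of_real (l x)))
      (\<lambda>t. \<Sum>\<^sub>\<infinity>x\<in>X. a x * strip_kernel s (t + of_real (l x))) (finite_subsets_at_top X)"
  proof (rule Weierstrass_m_test_general)
    fix x t assume "t \<in> K"
    thus "norm (a x * strip_kernel s (t + of_real (l x))) \<le>
        C * (norm (a x) * (exp (l x) + exp (- l x)) powr (- Re s))"
      using mult_left_mono[OF C(2)[of t "l x"], of "norm (a x)"]
      by (simp add: norm_mult algebra_simps)
  next
    show "(\<lambda>x. C * (norm (a x) * (exp (l x) + exp (- l x)) powr (- Re s))) summable_on X"
      by (intro summable_on_cmult_right summable)
  qed
  thus ?thesis by (simp add: G_def[abs_def])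
qed

lemma term_holomorphic: "(\<lambda>t. a x * strip_kernel s (t + of_real (l x))) holomorphic_on strip"
proof -
  have "(strip_kernel s \<circ> (\<lambda>t. t + of_real (l x))) holomorphic_on strip"
    by (rule holomorphic_on_compose_gen[OF _ kernel_holomorphic])
       (auto intro!: holomorphic_intros simp: strip_add_real)
  thus ?thesis by (intro holomorphic_intros) (simp add: o_def)
qed

lemma G_holomorphic: "G holomorphic_on strip"
  unfolding holomorphic_on_open[OF open_strip]
proof
  fix z assume z: "z \<in> strip"
  then obtain r where r: "r > 0" "cball z r \<subseteq> strip"
    using open_strip open_contains_cball by blast
  have "G holomorphic_on ball z r"
  proof (rule holomorphic_uniform_limit)
    show "uniform_limit (cball z r) (\<lambda>F t. \<Sum>x\<in>F. a x * strip_kernel s (t + of_real (l x))) G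
           (finite_subsets_at_top X)"
      by (rule G_uniform) (use r in auto)
    have h: "(\<lambda>t. \<Sum>x\<in>F. a x * strip_kernel s (t + of_real (l x))) holomorphic_on strip" for F
      by (intro holomorphic_on_sum term_holomorphic)
    have "ball z r \<subseteq> strip" using r(2) ball_subset_cball by blast
    thus "\<forall>\<^sub>F F in finite_subsets_at_top X.
        continuous_on (cball z r) (\<lambda>t. \<Sum>x\<in>F. a x * strip_kernel s (t + of_real (l x))) \<and>
        (\<lambda>t. \<Sum>x\<in>F. a x * strip_kernel s (t + of_real (l x))) holomorphic_on ball z r"
      using h r(2) by (intro always_eventually allI conjI holomorphic_on_imp_continuous_on)
        (auto intro: holomorphic_on_subset)
  qed auto
  thus "\<exists>f'. (G has_field_derivative f') (at z)"
    using r(1) by (meson centre_in_ball holomorphic_on_open open_ball)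
qed

lemma bij_orbits: "bij_betw (\<lambda>(x, n). act n x) (Y \<times> UNIV) X"
proof (rule bij_betwI)
  let ?f = "\<lambda>(x, n). act n x" and ?g = "\<lambda>x. (act (- \<lfloor>l x / p\<rfloor>) x, \<lfloor>l x / p\<rfloor>)"
  show "?g (?f z) = z" if zY: "z \<in> Y \<times> UNIV" for z
  proof -
    obtain x n where z: "z = (x, n)" and x: "x \<in> Y" using zY by (cases z) auto
    hence xX: "x \<in> X" by (simp add: Y_def)
    have "\<lfloor>l (act n x) / p\<rfloor> = n"
      using x p by (simp add: floor_eq_iff Y_def l_act field_simps)
    thus ?thesis using xX by (simp add: z act_add act_0)
  qed
  show "?f (?g x) = x" if "x \<in> X" for x
    using that by (simp add: act_add act_0)
  show "?f \<in> Y \<times> UNIV \<rightarrow> X"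
    by (auto simp: Y_def act_in)
  show "?g \<in> X \<rightarrow> Y \<times> UNIV"
  proof
    fix x assume x: "x \<in> X"
    have "of_int \<lfloor>l x / p\<rfloor> * p \<le> l x" "l x < (of_int \<lfloor>l x / p\<rfloor> + 1) * p"
      using floor_divide_lower[OF p, of "l x"] floor_divide_upper[OF p, of "l x"] by auto
    thus "?g x \<in> Y \<times> UNIV"
      using x by (auto simp: Y_def act_in l_act algebra_simps)
  qed
qed

text \<open>
  Sum and integral are exchanged over one period. The sum is then arranged by orbits, and the
  integrals belonging to one orbit are those over consecutive intervals of length \<open>p\<close>, which fill the
  line.
\<close>

lemma period_integral_G:
  "integral {0..p} (\<lambda>u. G (\<i> * of_real (pi / 2) + of_real u)) =
     (\<Sum>\<^sub>\<infinity>x\<in>Y. a x) * (\<i> powr s * c_fun s)"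
proof -
  define J where "J x = integral {0..p} (\<lambda>u. mid_kernel s (u + x))" for x
  define m where "m = (\<lambda>u::real. \<i> * of_real (pi / 2) + of_real u)"
  have mk: "strip_kernel s (m u + of_real y) = mid_kernel s (u + y)" for u y
    by (simp add: mid_kernel_def m_def add.assoc)
  have J_eq: "J x = integral {x..x + p} (mid_kernel s)" for x
  proof -
    have "(mid_kernel s has_integral integral {x..x + p} (mid_kernel s)) {x..x + p}"
      by (intro integrable_integral mid_kernel_integrable_on)
    from has_integral_affinity[of _ _ x "x + p" 1 x, OF this[unfolded interval_cbox]]
    show ?thesis unfolding J_def by (auto intro!: integral_unique simp: add.commute)
  qed
  have comp: "compact (m ` {0..p})"
    unfolding m_def by (intro compact_continuous_image continuous_intros) auto
  have sub: "m ` {0..p} \<subseteq> strip" by (auto simp: m_def strip_def)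
  have ul: "uniform_limit {0..p} (\<lambda>F u. \<Sum>x\<in>F. a x * mid_kernel s (u + l x)) (\<lambda>u. G (m u))
              (finite_subsets_at_top X)"
  proof -
    have "uniform_limit {0..p} (\<lambda>F u. \<Sum>x\<in>F. a x * strip_kernel s (m u + of_real (l x))) (\<lambda>u. G (m u))
              (finite_subsets_at_top X)"
      using uniform_limit_compose'[OF G_uniform[OF comp sub], of m "{0..p}"] by auto
    thus ?thesis by (simp add: mk)
  qed
  have contk: "continuous_on {0..p} (\<lambda>u. mid_kernel s (u + y))" for y
    by (rule continuous_on_compose2[OF mid_kernel_continuous[of UNIV]]) (auto intro!: continuous_intros)
  obtain I1 J1 where IJ: "\<And>F. ((\<lambda>u. \<Sum>x\<in>F. a x * mid_kernel s (u + l x)) has_integral I1 F) {0..p}"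
      "((\<lambda>u. G (m u)) has_integral J1) {0..p}" "(I1 \<longlongrightarrow> J1) (finite_subsets_at_top X)"
    by (rule uniform_limit_integral[OF ul]) (auto intro!: continuous_intros contk)
  have "I1 F = (\<Sum>x\<in>F. a x * J (l x))" for F
  proof -
    have "((\<lambda>u. \<Sum>x\<in>F. a x * mid_kernel s (u + l x)) has_integral (\<Sum>x\<in>F. a x * J (l x))) {0..p}"
    proof (cases "finite F")
      case True
      thus ?thesis unfolding J_def
        by (intro has_integral_sum has_integral_mult_right integrable_integral
               integrable_continuous_interval contk)
    qed auto
    thus ?thesis using IJ(1)[of F] has_integral_unique by blast
  qed
  hence "I1 = sum (\<lambda>x. a x * J (l x))" by (simp add: fun_eq_iff)
  hence "((\<lambda>x. a x * J (l x)) has_sum J1) X"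
    using IJ(3) by (simp add: has_sum_def)
  hence eq1: "integral {0..p} (\<lambda>u. G (m u)) = (\<Sum>\<^sub>\<infinity>x\<in>X. a x * J (l x))"
    using IJ(2) by (metis infsumI integral_unique)

  obtain C where C: "C > 0" "\<And>t l. t \<in> m ` {0..p} \<Longrightarrow>
      norm (strip_kernel s (t + of_real l)) \<le> C * (exp l + exp (- l)) powr (- Re s)"
    using kernel_bound_on_compact[OF comp sub s] by metis
  have J_bound: "norm (J x) \<le> C * (exp x + exp (- x)) powr (- Re s) * p" for x
  proof -
    have "norm (integral {0..p} (\<lambda>u. mid_kernel s (u + x))) \<le>
        C * (exp x + exp (- x)) powr (- Re s) * (p - 0)"
      using p C(2)[of _ x] by (intro integral_bound contk) (auto simp flip: mk)
    thus ?thesis by (simp add: J_def)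
  qed
  have abs: "(\<lambda>x. norm (a x * J (l x))) summable_on X"
  proof (rule summable_on_comparison_test)
    show "(\<lambda>x. C * p * (norm (a x) * (exp (l x) + exp (- l x)) powr (- Re s))) summable_on X"
      by (intro summable_on_cmult_right summable)
    fix x assume "x \<in> X"
    show "norm (a x * J (l x)) \<le> C * p * (norm (a x) * (exp (l x) + exp (- l x)) powr (- Re s))"
      using mult_left_mono[OF J_bound[of "l x"], of "norm (a x)"]
        by (simp add: norm_mult algebra_simps)
  qed auto
  have "(\<lambda>z. a ((\<lambda>(x, n). act n x) z) * J (l ((\<lambda>(x, n). act n x) z))) summable_on Y \<times> UNIV"
    using summable_on_reindex_bij_betw[OF bij_orbits, of "\<lambda>x. a x * J (l x)"]
      abs_summable_summable[OF abs] by simp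
  hence sm: "(\<lambda>(x, n). a x * J (l x + p * of_int n)) summable_on Y \<times> UNIV"
    by (rule summable_on_cong[THEN iffD1, rotated]) (auto simp: Y_def a_act l_act)
  have "(\<Sum>\<^sub>\<infinity>x\<in>X. a x * J (l x)) =
      (\<Sum>\<^sub>\<infinity>z\<in>Y \<times> UNIV. a ((\<lambda>(x, n). act n x) z) * J (l ((\<lambda>(x, n). act n x) z)))"
    by (rule infsum_reindex_bij_betw[OF bij_orbits, symmetric])
  also have "\<dots> = (\<Sum>\<^sub>\<infinity>(x, n)\<in>Y \<times> UNIV. a x * J (l x + p * of_int n))"
    by (rule infsum_cong) (auto simp: Y_def a_act l_act)
  also have "\<dots> = (\<Sum>\<^sub>\<infinity>x\<in>Y. \<Sum>\<^sub>\<infinity>n\<in>UNIV. a x * J (l x + p * of_int n))"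
    by (rule infsum_Sigma'_banach[OF sm, symmetric])
  also have "\<dots> = (\<Sum>\<^sub>\<infinity>x\<in>Y. a x * (LINT u|lborel. mid_kernel s u))"
  proof (rule infsum_cong)
    fix x assume x: "x \<in> Y"
    show "(\<Sum>\<^sub>\<infinity>n\<in>UNIV. a x * J (l x + p * of_int n)) = a x * (LINT u|lborel. mid_kernel s u)"
    proof (cases "a x = 0")
      case False
      have "(\<lambda>n. a x * J (l x + p * of_int n)) summable_on UNIV"
        using summable_on_SigmaD1[OF sm x] by simp
      hence "(\<lambda>n. J (l x + p * of_int n)) summable_on UNIV"
        using False by (subst (asm) summable_on_cmult_right') auto
      hence "((\<lambda>n. J (l x + p * of_int n)) has_sum (\<Sum>\<^sub>\<infinity>n. J (l x + p * of_int n))) UNIV"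
        by (rule has_sum_infsum)
      hence "((\<lambda>F. \<Sum>n\<in>F. J (l x + p * of_int n)) \<longlongrightarrow> (\<Sum>\<^sub>\<infinity>n. J (l x + p * of_int n)))
                (finite_subsets_at_top UNIV)"
        by (simp add: has_sum_def)
      \<comment> \<open>The unordered sum over the integers is also the limit of the sums over symmetric intervals, in which
        the integrals combine to one.\<close>
      moreover have "filterlim (\<lambda>N::nat. {- int N..<int N}) (finite_subsets_at_top UNIV) sequentially"
        unfolding filterlim_finite_subsets_at_top
      proof safe
        fix B :: "int set" assume B: "finite B"
        define M where "M = Max (abs ` B)"
        have M: "\<bar>b\<bar> \<le> M" if "b \<in> B" for b
          unfolding M_def using B that by (intro Max_ge) auto
        have "eventually (\<lambda>N::nat. N > nat M) sequentially" by (rule eventually_gt_at_top)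
        thus "\<forall>\<^sub>F N in sequentially. finite {- int N..<int N} \<and> B \<subseteq> {- int N..<int N} \<and>
                 {- int N..<int N} \<subseteq> UNIV"
        proof eventually_elim
          case (elim N)
          have "b \<in> {- int N..<int N}" if "b \<in> B" for b
            using M[OF that] elim by auto
          thus ?case by auto
        qed
      qed
      ultimately have "(\<lambda>N. \<Sum>n\<in>{- int N..<int N}. J (l x + p * of_int n)) \<longlonglongrightarrow>
                (\<Sum>\<^sub>\<infinity>n. J (l x + p * of_int n))"
        by (rule filterlim_compose)
      hence "(\<lambda>N. integral {l x - p * real N .. l x + p * real N} (mid_kernel s)) \<longlonglongrightarrow>
                (\<Sum>\<^sub>\<infinity>n. J (l x + p * of_int n))"
        unfolding J_eq sum_int_interval_integral[OF mid_kernel_integrable_on p] .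
      with mid_kernel_integral_limit[OF s p, of "l x"]
      have "(\<Sum>\<^sub>\<infinity>n. J (l x + p * of_int n)) = (LINT u|lborel. mid_kernel s u)"
        using LIMSEQ_unique by blast
      thus ?thesis by (simp add: infsum_cmult_right')
    qed auto
  qed
  finally show ?thesis
    using eq1 by (simp add: m_def integral_mid_kernel infsum_cmult_left')
qed

text \<open>
  The sum \<open>G\<close> is periodic, so the increment of a primitive over one period is the same at every
  point, and it may be computed on the middle line.
\<close>

lemma primitive_over_period:
  assumes P: "\<And>t. t \<in> strip \<Longrightarrow> (P has_field_derivative G t) (at t)" and t: "t \<in> strip"
  shows "P t - P (t - of_real p) = (\<Sum>\<^sub>\<infinity>x\<in>Y. a x) * (\<i> powr s * c_fun s)"
proof -
  have shift: "u - of_real p \<in> strip \<longleftrightarrow> u \<in> strip" for u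
    by (simp add: strip_def)
  have bij: "bij_betw (act 1) X X"
    by (rule bij_betw_byWitness[where f' = "act (- 1)"]) (auto simp: act_in act_add act_0)
  have G_per: "G (u - of_real p) = G u" for u
  proof -
    have "G (u - of_real p) = (\<Sum>\<^sub>\<infinity>x\<in>X. a (act 1 x) * strip_kernel s (u - of_real p + of_real (l (act 1 x))))"
      unfolding G_def by (rule infsum_reindex_bij_betw[OF bij, symmetric])
    also have "\<dots> = G u"
      unfolding G_def by (rule infsum_cong) (simp add: a_act l_act algebra_simps)
    finally show ?thesis .
  qed
  have "\<exists>c. \<forall>u\<in>strip. P u - P (u - of_real p) = c"
  proof (rule has_field_derivative_zero_constant[OF convex_strip])
    fix u assume u: "u \<in> strip"
    have "((\<lambda>u. P u - P (u - of_real p)) has_field_derivative (G u - G (u - of_real p) * 1)) (at u)"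
      using u shift by (intro DERIV_diff P DERIV_chain2[where f = P]) (auto intro!: derivative_eq_intros)
    thus "((\<lambda>u. P u - P (u - of_real p)) has_field_derivative 0) (at u within strip)"
      by (simp add: G_per has_field_derivative_at_within)
  qed
  then obtain c where c: "\<And>u. u \<in> strip \<Longrightarrow> P u - P (u - of_real p) = c"
    by blast
  have "((\<lambda>u. G (\<i> * of_real (pi / 2) + of_real u)) has_integral
      P (\<i> * of_real (pi / 2) + of_real p) - P (\<i> * of_real (pi / 2) + of_real 0)) {0..p}"
  proof (rule fundamental_theorem_of_calculus)
    fix u assume "u \<in> {0..p}"
    have 1: "((\<lambda>u. \<i> * of_real (pi / 2) + of_real u) has_vector_derivative 1) (at u)"
      by (auto intro!: derivative_eq_intros)
    have 2: "(P has_field_derivative G (\<i> * of_real (pi / 2) + of_real u)) (at (\<i> * of_real (pi / 2) + of_real u))"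
      by (rule P[OF mid_point_strip])
    from field_vector_diff_chain_at[OF 1 2]
    have "((\<lambda>u. P (\<i> * of_real (pi / 2) + of_real u)) has_vector_derivative
             G (\<i> * of_real (pi / 2) + of_real u)) (at u)" by (simp only: o_def mult_1_left)
    thus "((\<lambda>u. P (\<i> * of_real (pi / 2) + of_real u)) has_vector_derivative
             G (\<i> * of_real (pi / 2) + of_real u)) (at u within {0..p})"
      by (rule has_vector_derivative_at_within)
  qed (use p in auto)
  hence "P (\<i> * of_real (pi / 2) + of_real p) - P (\<i> * of_real (pi / 2)) =
      (\<Sum>\<^sub>\<infinity>x\<in>Y. a x) * (\<i> powr s * c_fun s)"
    using period_integral_G by (simp add: integral_unique)
  moreover have "P (\<i> * of_real (pi / 2) + of_real p) - P (\<i> * of_real (pi / 2)) = c"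
    using c[of "\<i> * of_real (pi / 2) + of_real p"] mid_point_strip[of p] by simp
  ultimately show ?thesis using c[OF t] by simp
qed

end

section \<open>Arithmetic of the real quadratic field\<close>

text \<open>
  In lowest terms \<open>r = p/q\<close>, every power of \<open>q\<close> divides \<open>d\<close>.
\<close>

lemma rat_with_bounded_denominator:
  fixes r :: rat and d :: int
  assumes d: "d \<noteq> 0" and bd: "\<And>k. \<exists>m::int. of_int d * r ^ k = of_int m"
  shows "r \<in> \<int>"
proof -
  obtain p q where r: "r = of_int p / of_int q" and q: "q > 0" and cop: "coprime p q"
    by (cases r) (auto simp: Fract_of_int_quotient)
  have dvd: "q ^ k dvd d" for k
  proof -
    obtain m where m: "of_int d * r ^ k = of_int m" using bd by blast
    have "of_int d * (of_int p ^ k :: rat) = of_int m * of_int q ^ k"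
      using m q by (simp add: r power_divide field_simps)
    hence "d * p ^ k = m * q ^ k" by (metis of_int_eq_iff of_int_mult of_int_power)
    hence "q ^ k dvd d * p ^ k" by simp
    moreover have "coprime (q ^ k) (p ^ k)" using cop by (simp add: coprime_commute)
    ultimately show ?thesis by (simp add: coprime_dvd_mult_left_iff)
  qed
  have "q = 1"
  proof (rule ccontr)
    assume "q \<noteq> 1"
    hence q2: "q \<ge> 2" using q by simp
    define k where "k = nat \<bar>d\<bar>"
    have "\<bar>d\<bar> < 2 ^ k" unfolding k_def
      using of_nat_less_two_power[of "nat \<bar>d\<bar>", where 'a = int] by simp
    also have "(2::int) ^ k \<le> q ^ k" using q2 by (intro power_mono) auto
    also have "q ^ k \<le> \<bar>d\<bar>" using dvd_imp_le_int[OF d dvd[of k]] q by simp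
    finally show False by simp
  qed
  thus ?thesis by (simp add: r)
qed

text \<open>
  In lowest terms \<open>r = p/q\<close>, the square of \<open>q\<close> divides \<open>D\<close>.
\<close>

lemma squarefree_rat_square:
  fixes r :: rat and D :: int
  assumes "squarefree D" and m: "of_int D * r\<^sup>2 = of_int m"
  shows "r \<in> \<int>"
proof -
  obtain p q where r: "r = of_int p / of_int q" and q: "q > 0" and cop: "coprime p q"
    by (cases r) (auto simp: Fract_of_int_quotient)
  have "of_int D * (of_int p ^ 2 :: rat) = of_int m * of_int q ^ 2"
    using m q by (simp add: r power_divide field_simps)
  hence "D * p ^ 2 = m * q ^ 2" by (metis of_int_eq_iff of_int_mult of_int_power)
  hence "q ^ 2 dvd D * p ^ 2" by simp
  moreover have "coprime (q ^ 2) (p ^ 2)" using cop by (simp add: coprime_commute)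
  ultimately have "q ^ 2 dvd D" by (simp add: coprime_dvd_mult_left_iff)
  hence "is_unit q" using assms(1) by (auto simp: squarefree_def)
  hence "q = 1" using q by simp
  thus ?thesis by (simp add: r)
qed

lemma int_subgroup_generator:
  fixes S :: "int set"
  assumes add: "\<And>x y. x \<in> S \<Longrightarrow> y \<in> S \<Longrightarrow> x + y \<in> S" and neg: "\<And>x. x \<in> S \<Longrightarrow> - x \<in> S"
    and nz: "\<exists>x\<in>S. x \<noteq> 0"
  obtains g where "g > 0" "\<And>x. x \<in> S \<longleftrightarrow> g dvd x"
proof -
  obtain x where x: "x \<in> S" "x \<noteq> 0" using nz by blast
  define P where "P = (\<lambda>n::nat. n > 0 \<and> int n \<in> S)"
  have "P (nat \<bar>x\<bar>)" using x neg[of x] by (auto simp: P_def abs_if)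
  hence PL: "P (LEAST n. P n)" by (rule LeastI)
  define g where "g = int (LEAST n. P n)"
  have g: "g > 0" "g \<in> S" using PL by (auto simp: g_def P_def)
  have mult_nat: "int n * y \<in> S" if "y \<in> S" for n y
  proof (induction n)
    case 0
    show ?case using add[OF that neg[OF that]] by simp
  next
    case (Suc n)
    thus ?case using add[OF that Suc] by (simp add: algebra_simps)
  qed
  have mult: "k * y \<in> S" if "y \<in> S" for k y :: int
    using mult_nat[OF that, of "nat \<bar>k\<bar>"] neg[of "\<bar>k\<bar> * y"]
      by (cases "k \<ge> 0") auto
  have "y \<in> S \<longleftrightarrow> g dvd y" for y
  proof
    assume "g dvd y"
    thus "y \<in> S" using mult[OF g(2)] by (auto simp: dvd_def mult.commute)
  next
    assume y: "y \<in> S"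
    have "y mod g = y + (- (y div g)) * g" by (simp add: minus_mult_div_eq_mod[symmetric])
    hence "y mod g \<in> S" using add[OF y mult[OF g(2), of "- (y div g)"]] by (simp only:)
    have "y mod g = 0"
    proof (rule ccontr)
      assume "y mod g \<noteq> 0"
      moreover have "0 \<le> y mod g" "y mod g < g" using g(1) by auto
      ultimately have "P (nat (y mod g))" "nat (y mod g) < (LEAST n. P n)"
        using \<open>y mod g \<in> S\<close> by (auto simp: P_def g_def)
      thus False using not_less_Least by blast
    qed
    thus "g dvd y" by auto
  qed
  thus ?thesis using that g(1) by blast
qed

definition zspan :: "real \<Rightarrow> real \<Rightarrow> real set" where
  "zspan x y = {of_int m * x + of_int n * y | m n. True}"

lemma zspanI: "of_int m * x + of_int n * y \<in> zspan x y"
  by (auto simp: zspan_def)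

lemma zspanI': "z = of_int m * x + of_int n * y \<Longrightarrow> z \<in> zspan x y"
  by (auto simp: zspan_def)

lemma zspanE:
  assumes "z \<in> zspan x y" obtains m n where "z = of_int m * x + of_int n * y"
  using assms by (auto simp: zspan_def)

lemma zspan_add: "a \<in> zspan x y \<Longrightarrow> b \<in> zspan x y \<Longrightarrow> a + b \<in> zspan x y"
proof (elim zspanE)
  fix m n m' n' assume "a = of_int m * x + of_int n * y" "b = of_int m' * x + of_int n' * y"
  thus "a + b \<in> zspan x y"
    by (intro zspanI'[of _ "m + m'" _ "n + n'"]) (simp add: algebra_simps)
qed

lemma zspan_of_int_mult: "a \<in> zspan x y \<Longrightarrow> of_int k * a \<in> zspan x y"
proof (elim zspanE)
  fix m n assume "a = of_int m * x + of_int n * y"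
  thus "of_int k * a \<in> zspan x y"
    by (intro zspanI'[of _ "k * m" _ "k * n"]) (simp add: algebra_simps)
qed

lemma zspan_minus: "a \<in> zspan x y \<Longrightarrow> - a \<in> zspan x y"
  using zspan_of_int_mult[of a x y "-1"] by simp

lemma zspan_0: "0 \<in> zspan x y"
  by (rule zspanI'[of _ 0 _ 0]) simp

lemma zspan_basis: "x \<in> zspan x y" "y \<in> zspan x y"
  by (rule zspanI'[of _ 1 _ 0], simp) (rule zspanI'[of _ 0 _ 1], simp)

lemma zspan_least:
  assumes "\<And>a b. a \<in> I \<Longrightarrow> b \<in> I \<Longrightarrow> a + b \<in> I" "\<And>k a. a \<in> I \<Longrightarrow> of_int k * a \<in> I"
    and "x \<in> I" "y \<in> I"
  shows "zspan x y \<subseteq> I"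
  using assms by (auto elim!: zspanE)

text \<open>
  Under these conditions \<open>D\<close> is the discriminant of the field \<open>\<rat>(\<surd>D)\<close>, and all forms of discriminant
  \<open>D\<close> are primitive.
\<close>

locale real_quadratic =
  fixes D :: int
  assumes D_gt_1: "D > 1" and D_squarefree: "squarefree D" and D_mod_4: "D mod 4 = 1"
begin

abbreviation rD :: real where "rD \<equiv> sqrt (of_int D)"
abbreviation K :: "real set" where "K \<equiv> quad_field D"
abbreviation \<O> :: "real set" where "\<O> \<equiv> quad_integers D"

lemma rD_pos: "rD > 0" using D_gt_1 by simp

lemma abs_D [simp]: "\<bar>real_of_int D\<bar> = real_of_int D" using D_gt_1 by simp

lemma rD_sq [simp]: "rD * rD = of_int D" using D_gt_1 by simp

lemma rD_sq' [simp]: "rD * (rD * x) = of_int D * x" by (metis mult.assoc rD_sq)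

lemma D_odd: "odd D" using D_mod_4 by presburger

lemma rD_irrational: "rD \<notin> \<rat>"
proof
  assume "rD \<in> \<rat>"
  then obtain r where r: "rD = of_rat r" by (auto simp: Rats_def)
  have "of_rat (r * r) = (of_rat (of_int D) :: real)" using rD_sq unfolding r of_rat_mult by simp
  hence rr: "r * r = of_int D" by (simp only: of_rat_eq_iff)
  hence "r \<noteq> 0" using D_gt_1 by auto
  hence unit: "of_int D * (1 / r)\<^sup>2 = of_int 1"
    unfolding rr[symmetric] by (simp add: power2_eq_square)
  from squarefree_rat_square[OF D_squarefree unit] have "1 / r \<in> \<int>" .
  then obtain n where n: "1 / r = of_int n" by (auto elim: Ints_cases)
  have "of_int (D * n\<^sup>2) = (of_int 1 :: rat)"
    using unit unfolding n by simp
  hence "D * n\<^sup>2 = 1" by (simp only: of_int_eq_iff)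
  hence "D dvd 1" by (metis dvd_triv_left)
  thus False using D_gt_1 by auto
qed

lemma coords_unique:
  "of_rat a + of_rat b * rD = of_rat c + of_rat d * rD \<longleftrightarrow> a = c \<and> b = d"
proof
  assume eq: "of_rat a + of_rat b * rD = of_rat c + of_rat d * rD"
  have "b = d"
  proof (rule ccontr)
    assume "b \<noteq> d"
    hence "rD = of_rat ((c - a) / (b - d))"
      using eq by (simp add: of_rat_divide of_rat_diff divide_simps) (simp add: algebra_simps)
    thus False using rD_irrational by (metis Rats_of_rat)
  qed
  thus "a = c \<and> b = d" using eq by simp
qed auto

lemma K_I: "of_rat a + of_rat b * rD \<in> K" by (auto simp: quad_field_def)

lemma K_E:
  assumes "x \<in> K" obtains a b where "x = of_rat a + of_rat b * rD"
  using assms by (auto simp: quad_field_def)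

text \<open>
  The nontrivial automorphism of the field, defined through the coordinates.
\<close>

definition cj :: "real \<Rightarrow> real" where
  "cj x = (THE y. \<exists>a b. x = of_rat a + of_rat b * rD \<and> y = of_rat a - of_rat b * rD)"

lemma cj_coords: "cj (of_rat a + of_rat b * rD) = of_rat a - of_rat b * rD"
  unfolding cj_def by (rule the_equality) (auto simp: coords_unique)

lemma quad_norm_coords: "quad_norm D (of_rat a + of_rat b * rD) = a\<^sup>2 - of_int D * b\<^sup>2"
  unfolding quad_norm_def by (rule the_equality) (auto simp: coords_unique)

lemma K_of_rat: "of_rat a \<in> K" using K_I[of a 0] by simp
lemma K_of_int: "of_int a \<in> K" using K_of_rat[of "of_int a"] by simp
lemma K_0: "0 \<in> K" using K_of_int[of 0] by simp
lemma K_1: "1 \<in> K" using K_of_int[of 1] by simp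
lemma K_rD: "rD \<in> K" using K_I[of 0 1] by simp

lemma cj_of_rat: "cj (of_rat a) = of_rat a" using cj_coords[of a 0] by simp
lemma cj_of_int [simp]: "cj (of_int a) = of_int a" using cj_of_rat[of "of_int a"] by simp
lemma cj_0 [simp]: "cj 0 = 0" using cj_of_int[of 0] by simp
lemma cj_1 [simp]: "cj 1 = 1" using cj_of_int[of 1] by simp
lemma cj_rD [simp]: "cj rD = - rD" using cj_coords[of 0 1] by simp

lemma add_coords: "(of_rat a + of_rat b * rD) + (of_rat c + of_rat d * rD) =
    of_rat (a + c) + of_rat (b + d) * rD"
  by (simp add: of_rat_add algebra_simps)

lemma mult_coords: "(of_rat a + of_rat b * rD) * (of_rat c + of_rat d * rD) =
    of_rat (a * c + of_int D * b * d) + of_rat (a * d + b * c) * rD"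
  by (simp add: of_rat_add of_rat_mult algebra_simps)

lemma K_add: "x \<in> K \<Longrightarrow> y \<in> K \<Longrightarrow> x + y \<in> K"
  by (elim K_E) (simp only: add_coords K_I)

lemma K_mult: "x \<in> K \<Longrightarrow> y \<in> K \<Longrightarrow> x * y \<in> K"
  by (elim K_E) (simp only: mult_coords K_I)

lemma K_minus: "x \<in> K \<Longrightarrow> - x \<in> K"
  using K_mult[OF K_of_int[of "-1"], of x] by simp

lemma K_diff: "x \<in> K \<Longrightarrow> y \<in> K \<Longrightarrow> x - y \<in> K"
  using K_add[of x "- y"] K_minus[of y] by simp

lemma cj_K: "x \<in> K \<Longrightarrow> cj x \<in> K"
proof (elim K_E)
  fix a b assume "x = of_rat a + of_rat b * rD"
  thus "cj x \<in> K" using K_I[of a "- b"] by (simp add: cj_coords of_rat_minus)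
qed

lemma cj_cj: "x \<in> K \<Longrightarrow> cj (cj x) = x"
proof (elim K_E)
  fix a b assume x: "x = of_rat a + of_rat b * rD"
  have "cj x = of_rat a + of_rat (- b) * rD" by (simp add: x cj_coords of_rat_minus)
  thus "cj (cj x) = x" by (simp only: cj_coords) (simp add: x of_rat_minus)
qed

lemma cj_add: "x \<in> K \<Longrightarrow> y \<in> K \<Longrightarrow> cj (x + y) = cj x + cj y"
  by (elim K_E) (simp only: add_coords cj_coords, simp add: of_rat_add algebra_simps)

lemma cj_mult: "x \<in> K \<Longrightarrow> y \<in> K \<Longrightarrow> cj (x * y) = cj x * cj y"
  by (elim K_E) (simp only: mult_coords cj_coords, simp add: of_rat_add of_rat_mult algebra_simps)

lemma cj_minus: "x \<in> K \<Longrightarrow> cj (- x) = - cj x"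
  using cj_mult[OF K_of_int[of "-1"], of x]
    by (simp del: cj_of_int add: cj_of_int[of "-1", simplified])

lemma of_rat_quad_norm: "x \<in> K \<Longrightarrow> of_rat (quad_norm D x) = x * cj x"
  by (elim K_E) (simp add: cj_coords quad_norm_coords of_rat_diff of_rat_mult of_rat_power
      power2_eq_square algebra_simps)

lemma cj_eq_0_iff: "x \<in> K \<Longrightarrow> cj x = 0 \<longleftrightarrow> x = 0"
  using cj_cj cj_0 by metis

lemma norm_eq_0_iff: "x \<in> K \<Longrightarrow> x * cj x = 0 \<longleftrightarrow> x = 0"
  by (simp add: cj_eq_0_iff)

lemma K_inverse: "x \<in> K \<Longrightarrow> inverse x \<in> K"
proof (cases "x = 0")
  case False
  assume x: "x \<in> K"
  have "cj x * of_rat (inverse (quad_norm D x)) = inverse x"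
    using False x by (simp add: of_rat_inverse of_rat_quad_norm[OF x] cj_eq_0_iff)
  thus ?thesis using K_mult[OF cj_K[OF x] K_of_rat] by metis
qed (simp add: K_0)

lemma K_divide: "x \<in> K \<Longrightarrow> y \<in> K \<Longrightarrow> x / y \<in> K"
  by (simp add: divide_inverse K_mult K_inverse)

lemma cj_inverse: "x \<in> K \<Longrightarrow> cj (inverse x) = inverse (cj x)"
proof (cases "x = 0")
  case False
  assume x: "x \<in> K"
  have "cj x * cj (inverse x) = 1"
    using False x by (simp flip: cj_mult[OF x K_inverse[OF x]])
  thus ?thesis by (metis inverse_unique)
qed simp

lemma cj_divide: "x \<in> K \<Longrightarrow> y \<in> K \<Longrightarrow> cj (x / y) = cj x / cj y"
  by (simp add: divide_inverse cj_mult K_inverse cj_inverse)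

lemma K_power: "x \<in> K \<Longrightarrow> x ^ n \<in> K"
  by (induction n) (auto simp: K_1 K_mult)

lemma cj_power: "x \<in> K \<Longrightarrow> cj (x ^ n) = cj x ^ n"
  by (induction n) (auto simp: cj_mult K_power)

lemma K_power_int: "x \<in> K \<Longrightarrow> x powi n \<in> K"
  by (auto simp: power_int_def K_power K_inverse)

lemma cj_power_int: "x \<in> K \<Longrightarrow> cj (x powi n) = cj x powi n"
  by (auto simp: power_int_def cj_power cj_inverse K_inverse)

lemmas K_intros = K_of_rat K_of_int K_0 K_1 K_rD K_add K_mult K_minus K_diff K_divide K_inverse
  K_power K_power_int cj_K

definition omega :: real where "omega = (1 + rD) / 2"

lemma omega_K: "omega \<in> K"
  using K_I[of "1/2" "1/2"] by (simp add: omega_def of_rat_divide add_divide_distrib)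

lemma cj_omega: "cj omega = 1 - omega"
proof -
  have "omega = of_rat (1/2) + of_rat (1/2) * rD" "1 - omega = of_rat (1/2) - of_rat (1/2) * rD"
    by (simp_all add: omega_def of_rat_divide field_simps)
  thus ?thesis by (simp only: cj_coords)
qed

text \<open>
  The negative of the norm of \<open>\<omega>\<close>.
\<close>

definition D4 :: int where "D4 = (D - 1) div 4"

lemma D_eq: "D = 4 * D4 + 1" unfolding D4_def using D_mod_4 by presburger

lemma omega_sq: "omega * omega = omega + of_int D4"
proof -
  have D: "of_int D = 4 * of_int D4 + (1::real)" using arg_cong[OF D_eq, of real_of_int] by simp
  have "omega * omega = (1 + 2 * rD + rD * rD) / 4"
    by (simp only: omega_def) (simp add: field_simps)
  also have "rD * rD = 4 * of_int D4 + 1" unfolding rD_sq by (rule D)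
  also have "(1 + 2 * rD + (4 * of_int D4 + 1)) / 4 = omega + of_int D4" unfolding omega_def
    by (simp add: field_simps)
  finally show ?thesis .
qed

lemma omega_basis_algebraic: "algebraic_int (of_int m + of_int n * omega)"
proof -
  define t N where "t = 2 * m + n" and "N = m\<^sup>2 + m * n - n\<^sup>2 * D4"
  define x where "x = of_int m + of_int n * omega"
  have "x * x = of_int t * x - of_int N"
  proof -
    have "x * x = (of_int m)\<^sup>2 + 2 * of_int m * of_int n * omega + (of_int n)\<^sup>2 * (omega * omega)"
      by (simp add: x_def power2_eq_square algebra_simps)
    thus ?thesis unfolding omega_sq
      by (simp add: x_def t_def N_def power2_eq_square algebra_simps)
  qed
  hence "poly [:of_int (N), of_int (- t), 1:] x = 0" by (simp add: algebra_simps)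
  thus ?thesis unfolding x_def[symmetric]
    by (rule algebraic_int.intros[rotated 2]) (auto simp: coeff_pCons split: nat.splits)
qed

text \<open>
  A monic equation of degree \<open>e\<close> expresses the higher powers of \<open>x\<close> by the first \<open>e\<close> of them, so a
  common denominator of these serves for all powers.
\<close>

lemma powers_bounded_denominator:
  assumes "x \<in> K" "algebraic_int x"
  obtains d where "d \<noteq> (0::int)" "\<And>k. of_int d * x ^ k \<in> zspan 1 rD"
proof -
  obtain p where p: "lead_coeff p = 1" "\<And>i. coeff p i \<in> \<int>" "poly p x = 0"
    using assms(2) by (auto elim: algebraic_int.cases)
  define e where "e = degree p"
  obtain a b where x: "x = of_rat a + of_rat b * rD" using assms(1) by (rule K_E)
  obtain a1 a2 b1 b2 where ab: "a = of_int a1 / of_int a2" "a2 > 0" "b = of_int b1 / of_int b2" "b2 > 0"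
    by (cases a; cases b) (auto simp: Fract_of_int_quotient)
  define d0 where "d0 = a2 * b2"
  have mult: "u * v \<in> zspan 1 rD" if uv: "u \<in> zspan 1 rD" "v \<in> zspan 1 rD" for u v
  proof -
    obtain m n m' n' where "u = of_int m * 1 + of_int n * rD" "v = of_int m' * 1 + of_int n' * rD"
      using uv by (auto elim!: zspanE)
    thus ?thesis
      by (intro zspanI'[of _ "m * m' + D * n * n'" _ "m * n' + n * m'"]) (simp add: algebra_simps)
  qed
  have pow: "u ^ k \<in> zspan 1 rD" if "u \<in> zspan 1 rD" for u k
    by (induction k) (auto intro: mult that zspan_basis)
  have ab': "of_rat a = (of_int a1 / of_int a2 :: real)" "of_rat b = (of_int b1 / of_int b2 :: real)"
    unfolding ab(1,3) by (simp_all add: of_rat_divide)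
  have "of_int d0 * x = of_int (a1 * b2) * 1 + of_int (b1 * a2) * rD"
    using ab(2,4) unfolding x d0_def ab' by (simp add: field_simps)
  hence "of_int d0 * x \<in> zspan 1 rD" by (rule zspanI')
  hence d0k: "(of_int d0 * x) ^ k \<in> zspan 1 rD" for k by (rule pow)
  \<comment> \<open>Each factor \<open>x\<close> of a power consumes one factor \<open>d0\<close>.\<close>
  define d where "d = d0 ^ e"
  have "of_int d * x ^ k \<in> zspan 1 rD" for k
  proof (induction k rule: less_induct)
    case (less k)
    show ?case
    proof (cases "k \<le> e")
      case True
      have "of_int d * x ^ k = of_int (d0 ^ (e - k)) * (of_int d0 * x) ^ k"
      proof -
        have "d = d0 ^ (e - k) * d0 ^ k" unfolding d_def using True by (simp flip: power_add)
        thus ?thesis by (simp add: power_mult_distrib)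
      qed
      thus ?thesis by (simp only: zspan_of_int_mult[OF d0k])
    next
      case False
      have "0 = x ^ (k - e) * poly p x" using p(3) by simp
      also have "\<dots> = (\<Sum>i\<le>e. coeff p i * x ^ (k - e + i))"
        unfolding poly_altdef e_def[symmetric] sum_distrib_left
        by (intro sum.cong) (simp_all add: power_add mult_ac)
      also have "\<dots> = x ^ k + (\<Sum>i<e. coeff p i * x ^ (k - e + i))"
        using p(1) False by (simp add: e_def lessThan_Suc_atMost[symmetric])
      finally have "x ^ k = - (\<Sum>i<e. coeff p i * x ^ (k - e + i))" by simp
      hence "of_int d * x ^ k = - (of_int d * (\<Sum>i<e. coeff p i * x ^ (k - e + i)))" by simp
      also have "of_int d * (\<Sum>i<e. coeff p i * x ^ (k - e + i)) =
          (\<Sum>i<e. coeff p i * (of_int d * x ^ (k - e + i)))"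
        by (simp only: sum_distrib_left mult.left_commute)
      finally have "of_int d * x ^ k = - (\<Sum>i<e. coeff p i * (of_int d * x ^ (k - e + i)))" .
      moreover have "(\<Sum>i\<in>A. coeff p i * (of_int d * x ^ (k - e + i))) \<in> zspan 1 rD"
        if "A \<subseteq> {..<e}" for A
        using finite_subset[OF that finite_lessThan] that
      proof (induction A rule: finite_induct)
        case (insert i A)
        obtain c where c: "coeff p i = of_int c" using p(2)[of i] by (auto elim: Ints_cases)
        have "of_int d * x ^ (k - e + i) \<in> zspan 1 rD"
          using False insert.prems by (intro less.IH) auto
        hence "coeff p i * (of_int d * x ^ (k - e + i)) \<in> zspan 1 rD"
          unfolding c by (rule zspan_of_int_mult)
        thus ?case unfolding sum.insert[OF insert.hyps(1,2)]
          using insert.IH insert.prems by (intro zspan_add) auto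
      qed (simp add: zspan_0)
      ultimately show ?thesis by (simp add: zspan_minus)
    qed
  qed
  moreover have "d \<noteq> 0" using ab by (simp add: d_def d0_def)
  ultimately show ?thesis using that by blast
qed

text \<open>
  The norm is multiplicative, so that the powers of the norm have a common denominator as well.
\<close>

lemma norm_integral_if_powers_bounded:
  assumes x: "x \<in> K" and d: "d \<noteq> (0::int)" "\<And>k. of_int d * x ^ k \<in> zspan 1 rD"
  shows "quad_norm D x \<in> \<int>"
proof (rule rat_with_bounded_denominator)
  show "d\<^sup>2 \<noteq> 0" using d(1) by simp
  fix k
  obtain m n where mn: "of_int d * x ^ k = of_int m * 1 + of_int n * rD" using d(2)[of k]
    by (auto elim: zspanE)
  have "of_rat (of_int (d\<^sup>2) * quad_norm D x ^ k) = (of_int d * x ^ k) * cj (of_int d * x ^ k)"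
    using x by (simp add: of_rat_mult of_rat_power of_rat_quad_norm cj_mult K_intros cj_power
        power_mult_distrib power2_eq_square)
  also have "\<dots> = of_int (m\<^sup>2 - D * n\<^sup>2)"
    unfolding mn by (simp add: cj_add cj_mult K_intros algebra_simps power2_eq_square)
  also have "\<dots> = of_rat (of_int (m\<^sup>2 - D * n\<^sup>2))" by (simp only: of_rat_of_int_eq)
  finally show "\<exists>m. of_int (d\<^sup>2) * quad_norm D x ^ k = of_int m"
    by (metis of_rat_eq_iff)
qed

text \<open>
  If the powers of \<open>x\<close> have a common denominator, then so have those of \<open>x + 1\<close>. Hence the norms of \<open>x\<close>
  and \<open>x + 1\<close> are both integers, and their difference exceeds the trace of \<open>x\<close> by 1. With trace and
  norm integral, \<open>D\<close> being squarefree bounds the denominators of the coordinates by 2.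
\<close>

lemma quad_integers_eq: "\<O> = zspan 1 omega"
proof (intro equalityI subsetI)
  fix x assume "x \<in> zspan 1 omega"
  then obtain m n where x: "x = of_int m * 1 + of_int n * omega" by (rule zspanE)
  have "x \<in> K" unfolding x by (intro K_intros omega_K)
  moreover have "algebraic_int x" unfolding x using omega_basis_algebraic by simp
  ultimately show "x \<in> \<O>" by (simp add: quad_integers_def)
next
  fix x assume "x \<in> \<O>"
  hence x: "x \<in> K" "algebraic_int x" by (auto simp: quad_integers_def)
  obtain d where d: "d \<noteq> (0::int)" "\<And>k. of_int d * x ^ k \<in> zspan 1 rD"
    using powers_bounded_denominator[OF x] by blast
  have d': "of_int d * (x + 1) ^ k \<in> zspan 1 rD" for k
  proof -
    have "of_int d * (x + 1) ^ k = (\<Sum>i\<le>k. of_int (int (k choose i)) * (of_int d * x ^ i))"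
      unfolding binomial_ring[of x 1 k] sum_distrib_left by (intro sum.cong) auto
    moreover have "(\<Sum>i\<in>A. of_int (int (k choose i)) * (of_int d * x ^ i)) \<in> zspan 1 rD" if "finite A" for A
      using that by (induction A rule: finite_induct) (auto intro!: zspan_0 zspan_add zspan_of_int_mult d simp del: of_int_of_nat_eq)
    ultimately show ?thesis by simp
  qed
  obtain a b where ab: "x = of_rat a + of_rat b * rD" using x(1) by (rule K_E)
  have ab': "x + 1 = of_rat (a + 1) + of_rat b * rD" by (simp add: ab of_rat_add)
  obtain N where N: "a\<^sup>2 - of_int D * b\<^sup>2 = of_int N"
    using norm_integral_if_powers_bounded[OF x(1) d] unfolding ab quad_norm_coords
      by (auto elim: Ints_cases)
  obtain N' where N': "(a + 1)\<^sup>2 - of_int D * b\<^sup>2 = of_int N'"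
    using norm_integral_if_powers_bounded[OF _ d(1) d'] x(1) unfolding ab' quad_norm_coords
    by (metis Ints_cases K_I)
  define t where "t = N' - N - 1"
  have t: "2 * a = of_int t" using N N' by (simp add: t_def power2_eq_square algebra_simps)
  have eq: "of_int D * (2 * b)\<^sup>2 = of_int (t\<^sup>2 - 4 * N)"
  proof -
    have "of_int D * (2 * b)\<^sup>2 = (2 * a)\<^sup>2 - 4 * (a\<^sup>2 - of_int D * b\<^sup>2)"
      by (simp add: power2_eq_square algebra_simps)
    thus ?thesis unfolding N t by simp
  qed
  have "2 * b \<in> \<int>" by (rule squarefree_rat_square[OF D_squarefree eq])
  then obtain u where u: "2 * b = of_int u" by (auto elim: Ints_cases)
  have "D * u\<^sup>2 = t\<^sup>2 - 4 * N"
    using eq unfolding u by (metis of_int_eq_iff of_int_mult of_int_power)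
  hence "even (D * u\<^sup>2) = even (t\<^sup>2 - 4 * N)" by simp
  hence "even (t - u)" using D_odd by auto
  then obtain m where m: "t = u + 2 * m" by (metis dvd_def diff_add_cancel add.commute)
  have a: "of_rat a = (of_int t / 2 :: real)"
  proof -
    have "of_rat (2 * a) = (of_int t :: real)" unfolding t by simp
    thus ?thesis by (simp add: of_rat_mult)
  qed
  have b: "of_rat b = (of_int u / 2 :: real)"
  proof -
    have "of_rat (2 * b) = (of_int u :: real)" unfolding u by simp
    thus ?thesis by (simp add: of_rat_mult)
  qed
  show "x \<in> zspan 1 omega"
    by (rule zspanI'[of _ m _ u]) (simp add: ab a b m omega_def field_simps)
qed

lemma O_K: "x \<in> \<O> \<Longrightarrow> x \<in> K" by (simp add: quad_integers_def)

lemma O_E: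
  assumes "x \<in> \<O>" obtains m n where "x = of_int m + of_int n * omega"
  using assms unfolding quad_integers_eq by (auto elim!: zspanE)

lemma O_I: "of_int m + of_int n * omega \<in> \<O>"
  unfolding quad_integers_eq using zspanI[of m 1 n omega] by simp

lemma O_of_int: "of_int m \<in> \<O>" using O_I[of m 0] by simp
lemma O_0: "0 \<in> \<O>" using O_of_int[of 0] by simp
lemma O_1: "1 \<in> \<O>" using O_of_int[of 1] by simp
lemma O_omega: "omega \<in> \<O>" using O_I[of 0 1] by simp

lemma O_add: "x \<in> \<O> \<Longrightarrow> y \<in> \<O> \<Longrightarrow> x + y \<in> \<O>"
  unfolding quad_integers_eq by (rule zspan_add)

lemma O_minus: "x \<in> \<O> \<Longrightarrow> - x \<in> \<O>"
  unfolding quad_integers_eq by (rule zspan_minus)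

lemma O_diff: "x \<in> \<O> \<Longrightarrow> y \<in> \<O> \<Longrightarrow> x - y \<in> \<O>"
  using O_add[of x "- y"] O_minus[of y] by simp

lemma O_mult:
  assumes "x \<in> \<O>" "y \<in> \<O>" shows "x * y \<in> \<O>"
proof -
  obtain m n where x: "x = of_int m + of_int n * omega" using assms(1) by (rule O_E)
  obtain m' n' where y: "y = of_int m' + of_int n' * omega" using assms(2) by (rule O_E)
  have "x * y = of_int m * of_int m' + (of_int m * of_int n' + of_int n * of_int m') * omega +
      of_int n * of_int n' * (omega * omega)"
    by (simp add: x y algebra_simps)
  also have "\<dots> = of_int (m * m' + n * n' * D4) + of_int (m * n' + n * m' + n * n') * omega"
    unfolding omega_sq by (simp add: algebra_simps)
  finally show ?thesis by (simp only: O_I)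
qed

lemma cj_O: "x \<in> \<O> \<Longrightarrow> cj x \<in> \<O>"
proof (elim O_E)
  fix m n assume "x = of_int m + of_int n * omega"
  hence "cj x = of_int (m + n) + of_int (- n) * omega"
    by (simp add: cj_add cj_mult K_intros omega_K cj_omega algebra_simps)
  thus "cj x \<in> \<O>" by (simp only: O_I)
qed

lemma O_coords_unique:
  "of_int m + of_int n * omega = of_int m' + of_int n' * omega \<longleftrightarrow> m = m' \<and> n = n'"
proof
  assume eq: "of_int m + of_int n * omega = of_int m' + of_int n' * omega"
  have "of_rat (of_int m + of_int n / 2) + of_rat (of_int n / 2) * rD =
        of_rat (of_int m' + of_int n' / 2) + of_rat (of_int n' / 2) * rD"
  proof -
    have "of_rat (of_int i + of_int j / 2) + of_rat (of_int j / 2) * rD = of_int i + of_int j * omega" for i j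
    proof -
      have "of_rat (of_int i + of_int j / 2) = (of_int i + of_int j / 2 :: real)"
           "of_rat (of_int j / 2) = (of_int j / 2 :: real)"
        by (simp_all add: of_rat_add of_rat_divide)
      thus ?thesis by (simp only: omega_def) (simp add: field_simps)
    qed
    thus ?thesis using eq by simp
  qed
  thus "m = m' \<and> n = n'" unfolding coords_unique by auto
qed auto

lemma O_norm_int:
  assumes "x \<in> \<O>" obtains N where "x * cj x = of_int N"
proof -
  obtain m n where x: "x = of_int m + of_int n * omega" using assms by (rule O_E)
  have "x * cj x = of_int (m * m + m * n - n * n * D4)"
  proof -
    have cjx: "cj x = of_int m + of_int n * (1 - omega)"
      unfolding x by (simp add: cj_add cj_mult K_intros omega_K cj_omega)
    have "x * cj x = of_int m * of_int m + of_int m * of_int n + of_int n * of_int n * (omega - omega * omega)"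
      unfolding cjx unfolding x by (simp add: algebra_simps)
    thus ?thesis unfolding omega_sq by simp
  qed
  thus ?thesis by (rule that)
qed

end

section \<open>Products of modules\<close>

lemma ideal_multI: "a \<in> I \<Longrightarrow> b \<in> J \<Longrightarrow> a * b \<in> ideal_mult I J"
  unfolding ideal_mult_def
  by (rule CollectI, rule exI[of _ 1], rule exI[of _ "\<lambda>_. a"], rule exI[of _ "\<lambda>_. b"]) simp

lemma ideal_mult_0: "0 \<in> ideal_mult I J"
  unfolding ideal_mult_def
  by (rule CollectI, rule exI[of _ 0]) simp

lemma ideal_mult_add:
  assumes "x \<in> ideal_mult I J" "y \<in> ideal_mult I J"
  shows "x + y \<in> ideal_mult I J"
proof -
  obtain n f g where x: "x = (\<Sum>k<(n::nat). f k * g k)" "\<And>k. k < n \<Longrightarrow> f k \<in> I \<and> g k \<in> J"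
    using assms(1) by (auto simp: ideal_mult_def)
  obtain m f' g' where y: "y = (\<Sum>k<(m::nat). f' k * g' k)" "\<And>k. k < m \<Longrightarrow> f' k \<in> I \<and> g' k \<in> J"
    using assms(2) by (auto simp: ideal_mult_def)
  define F where "F = (\<lambda>k. if k < n then f k else f' (k - n))"
  define G where "G = (\<lambda>k. if k < n then g k else g' (k - n))"
  have "(\<Sum>k<n + m. F k * G k) = (\<Sum>k<n. F k * G k) + (\<Sum>k<m. F (n + k) * G (n + k))"
    by (simp add: sum.nat_group flip: sum.atLeastLessThan_concat[of 0 n "n + m"] atLeast0LessThan)
       (simp add: atLeast0LessThan add.commute sum.shift_bounds_nat_ivl[of _ 0 n m, simplified] flip: sum.shift_bounds_nat_ivl)
  also have "\<dots> = x + y" unfolding x(1) y(1) by (simp add: F_def G_def)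
  finally have "x + y = (\<Sum>k<n + m. F k * G k)" by simp
  moreover have "\<forall>k<n + m. F k \<in> I \<and> G k \<in> J" using x(2) y(2)
    by (auto simp: F_def G_def)
  ultimately show ?thesis unfolding ideal_mult_def by blast
qed

lemma ideal_mult_induct [consumes 1, case_names mult zero add]:
  assumes "x \<in> ideal_mult I J"
    and "\<And>a b. a \<in> I \<Longrightarrow> b \<in> J \<Longrightarrow> P (a * b)" "P 0" "\<And>x y. P x \<Longrightarrow> P y \<Longrightarrow> P (x + y)"
  shows "P x"
proof -
  obtain n f g where x: "x = (\<Sum>k<(n::nat). f k * g k)" "\<And>k. k < n \<Longrightarrow> f k \<in> I \<and> g k \<in> J"
    using assms(1) by (auto simp: ideal_mult_def)
  have "P (\<Sum>k<m. f k * g k)" if "m \<le> n" for m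
    using that by (induction m) (auto intro!: assms(2-4) x(2)[THEN conjunct1] x(2)[THEN conjunct2])
  thus ?thesis using x(1) by simp
qed

lemma ideal_mult_subset:
  assumes "\<And>a b. a \<in> I \<Longrightarrow> b \<in> J \<Longrightarrow> a * b \<in> L" "0 \<in> L" "\<And>x y. x \<in> L \<Longrightarrow> y \<in> L \<Longrightarrow> x + y \<in> L"
  shows "ideal_mult I J \<subseteq> L"
  using ideal_mult_induct[of _ I J "\<lambda>x. x \<in> L"] assms by blast

lemma ideal_mult_commute: "ideal_mult I J = ideal_mult J I"
proof -
  have "ideal_mult I J \<subseteq> ideal_mult J I" for I J
  proof (rule ideal_mult_subset)
    fix a b assume "a \<in> I" "b \<in> J"
    thus "a * b \<in> ideal_mult J I" using ideal_multI[of b J a I]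
      by (simp only: mult.commute[of a])
  qed (auto intro: ideal_mult_0 ideal_mult_add)
  thus ?thesis by blast
qed

text \<open>
  One inclusion, together with commutativity, gives the other.
\<close>

lemma ideal_mult_assoc: "ideal_mult (ideal_mult I J) L = ideal_mult I (ideal_mult J L)"
proof -
  have 1: "ideal_mult (ideal_mult I J) L \<subseteq> ideal_mult I (ideal_mult J L)" for I J L
  proof (rule ideal_mult_subset)
    fix a b assume "a \<in> ideal_mult I J" "b \<in> L"
    thus "a * b \<in> ideal_mult I (ideal_mult J L)"
      by (induction rule: ideal_mult_induct)
         (auto simp: distrib_right mult.assoc intro: ideal_multI ideal_mult_0 ideal_mult_add)
  qed (auto intro: ideal_mult_0 ideal_mult_add)
  have "ideal_mult I (ideal_mult J L) = ideal_mult (ideal_mult L J) I"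
    by (simp add: ideal_mult_commute)
  also have "\<dots> \<subseteq> ideal_mult L (ideal_mult J I)" by (rule 1)
  also have "\<dots> = ideal_mult (ideal_mult I J) L" by (simp add: ideal_mult_commute)
  finally show ?thesis using 1 by blast
qed

definition smul :: "real \<Rightarrow> real set \<Rightarrow> real set" where
  "smul x I = (\<lambda>r. x * r) ` I"

lemma smul_smul: "smul x (smul y I) = smul (x * y) I"
  by (auto simp: smul_def image_image mult.assoc)

lemma smul_1 [simp]: "smul 1 I = I"
  by (simp add: smul_def)

lemma in_smul_iff: "x \<noteq> 0 \<Longrightarrow> y \<in> smul x I \<longleftrightarrow> y / x \<in> I"
  by (force simp: smul_def)

lemma smul_ideal_mult: "ideal_mult (smul x I) J = smul x (ideal_mult I J)"
proof
  have zero: "0 \<in> smul x (ideal_mult I J)"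
    using imageI[OF ideal_mult_0, of "\<lambda>r. x * r"] by (simp add: smul_def)
  have add: "a + b \<in> smul x (ideal_mult I J)"
    if a: "a \<in> smul x (ideal_mult I J)" and b: "b \<in> smul x (ideal_mult I J)" for a b
  proof -
    obtain a' where a': "a' \<in> ideal_mult I J" "a = x * a'" using a by (auto simp: smul_def)
    obtain b' where b': "b' \<in> ideal_mult I J" "b = x * b'" using b by (auto simp: smul_def)
    have "a + b = x * (a' + b')" by (simp only: a'(2) b'(2) distrib_left)
    thus ?thesis unfolding smul_def using ideal_mult_add[OF a'(1) b'(1)] by blast
  qed
  show "ideal_mult (smul x I) J \<subseteq> smul x (ideal_mult I J)"
  proof (rule ideal_mult_subset)
    fix a b assume "a \<in> smul x I" "b \<in> J"
    thus "a * b \<in> smul x (ideal_mult I J)"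
      by (auto simp: smul_def mult.assoc intro!: imageI ideal_multI)
  qed (use zero add in auto)
  show "smul x (ideal_mult I J) \<subseteq> ideal_mult (smul x I) J"
  proof
    fix y assume "y \<in> smul x (ideal_mult I J)"
    then obtain z where z: "z \<in> ideal_mult I J" "y = x * z" by (auto simp: smul_def)
    have "x * z \<in> ideal_mult (smul x I) J" using z(1)
    proof (induction rule: ideal_mult_induct)
      case (mult a b)
      have "x * a \<in> smul x I" using mult(1) by (auto simp: smul_def)
      from ideal_multI[OF this mult(2)] show ?case by (simp only: mult.assoc)
    qed (auto simp: distrib_left intro: ideal_mult_0 ideal_mult_add)
    thus "y \<in> ideal_mult (smul x I) J" using z(2) by simp
  qed
qed

lemma smul_zspan: "smul c (zspan x y) = zspan (c * x) (c * y)"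
proof (intro equalityI subsetI)
  fix z assume "z \<in> smul c (zspan x y)"
  then obtain m n where "z = c * (of_int m * x + of_int n * y)"
    by (auto simp: smul_def elim!: zspanE)
  thus "z \<in> zspan (c * x) (c * y)" by (intro zspanI'[of _ m _ n]) (simp add: algebra_simps)
next
  fix z assume "z \<in> zspan (c * x) (c * y)"
  then obtain m n where "z = of_int m * (c * x) + of_int n * (c * y)" by (rule zspanE)
  hence "z = c * (of_int m * x + of_int n * y)" by (simp add: algebra_simps)
  thus "z \<in> smul c (zspan x y)" by (auto simp: smul_def intro!: imageI zspanI)
qed

context real_quadratic
begin

section \<open>Fractional ideals and binary quadratic forms\<close>

lemma frac_idealsI:
  assumes "I \<subseteq> K" "x \<in> I" "x \<noteq> 0" "\<And>x y. x \<in> I \<Longrightarrow> y \<in> I \<Longrightarrow> x + y \<in> I"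
    "\<And>r x. r \<in> \<O> \<Longrightarrow> x \<in> I \<Longrightarrow> r * x \<in> I"
    "d \<in> \<O>" "d \<noteq> 0" "\<And>x. x \<in> I \<Longrightarrow> d * x \<in> \<O>"
  shows "I \<in> frac_ideals D"
  using assms unfolding frac_ideals_def by auto

lemma frac_idealD:
  assumes "I \<in> frac_ideals D"
  shows "x \<in> I \<Longrightarrow> x \<in> K" "x \<in> I \<Longrightarrow> y \<in> I \<Longrightarrow> x + y \<in> I" "r \<in> \<O> \<Longrightarrow> x \<in> I \<Longrightarrow> r * x \<in> I"
    "0 \<in> I" "x \<in> I \<Longrightarrow> - x \<in> I" "x \<in> I \<Longrightarrow> of_int k * x \<in> I"
proof -
  show *: "x \<in> I \<Longrightarrow> x \<in> K" "x \<in> I \<Longrightarrow> y \<in> I \<Longrightarrow> x + y \<in> I" "r \<in> \<O> \<Longrightarrow> x \<in> I \<Longrightarrow> r * x \<in> I" for x y r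
    using assms unfolding frac_ideals_def by auto
  obtain y where "y \<in> I" using assms unfolding frac_ideals_def by auto
  from *(3)[OF O_0 this] show "0 \<in> I" by simp
  show "x \<in> I \<Longrightarrow> of_int k * x \<in> I" by (rule *(3)[OF O_of_int])
  show "x \<in> I \<Longrightarrow> - x \<in> I" using *(3)[OF O_of_int[of "-1"], of x] by simp
qed

lemma frac_ideal_nonzero:
  assumes "I \<in> frac_ideals D" obtains x where "x \<in> I" "x \<noteq> 0"
proof -
  have "I \<noteq> {0}" "I \<noteq> {}" using assms unfolding frac_ideals_def by auto
  thus ?thesis using that by blast
qed

lemma frac_ideal_denominator:
  assumes "I \<in> frac_ideals D" obtains d where "d \<in> \<O>" "d \<noteq> 0" "\<And>x. x \<in> I \<Longrightarrow> d * x \<in> \<O>"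
proof -
  have "\<exists>d\<in>\<O>. d \<noteq> 0 \<and> (\<forall>x\<in>I. d * x \<in> \<O>)"
    using assms unfolding frac_ideals_def by blast
  thus ?thesis using that by blast
qed

lemma O_frac_ideal: "\<O> \<in> frac_ideals D"
  by (rule frac_idealsI[of _ 1 1]) (auto simp: O_K O_1 O_add O_mult)

lemma K_denominator:
  assumes "x \<in> K" obtains d where "d \<noteq> 0" "of_int d * x \<in> \<O>"
proof -
  obtain a b where x: "x = of_rat a + of_rat b * rD" using assms by (rule K_E)
  obtain a1 a2 b1 b2 where ab: "a = of_int a1 / of_int a2" "a2 > 0" "b = of_int b1 / of_int b2" "b2 > 0"
    by (cases a; cases b) (auto simp: Fract_of_int_quotient)
  have ab': "of_rat a = (of_int a1 / of_int a2 :: real)" "of_rat b = (of_int b1 / of_int b2 :: real)"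
    unfolding ab(1,3) by (simp_all add: of_rat_divide)
  have "rD = 2 * omega - 1" by (simp add: omega_def field_simps)
  hence "of_int (a2 * b2) * x = of_int (a1 * b2 - b1 * a2) + of_int (2 * b1 * a2) * omega"
    using ab(2,4) unfolding x ab' \<open>rD = 2 * omega - 1\<close> by (simp add: field_simps)
  hence "of_int (a2 * b2) * x \<in> \<O>" by (simp only: O_I)
  thus ?thesis using that[of "a2 * b2"] ab by simp
qed

lemma smul_frac_ideal:
  assumes I: "I \<in> frac_ideals D" and x: "x \<in> K" "x \<noteq> 0"
  shows "smul x I \<in> frac_ideals D"
proof -
  obtain y where y: "y \<in> I" "y \<noteq> 0" using frac_ideal_nonzero[OF I] by blast
  obtain d where d: "d \<in> \<O>" "d \<noteq> 0" "\<And>x. x \<in> I \<Longrightarrow> d * x \<in> \<O>" using frac_ideal_denominator[OF I] by blast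
  obtain e where e: "e \<noteq> 0" "of_int e * x \<in> \<O>" using K_denominator[OF x(1)] by blast
  show ?thesis
  proof (rule frac_idealsI[of _ "x * y" "d * of_int e"])
    show "smul x I \<subseteq> K" using x frac_idealD(1)[OF I]
      by (auto simp: smul_def intro: K_mult)
    show "x * y \<in> smul x I" "x * y \<noteq> 0" using x y by (auto simp: smul_def)
    show "a + b \<in> smul x I" if "a \<in> smul x I" "b \<in> smul x I" for a b
      using that x frac_idealD(2)[OF I] by (auto simp: in_smul_iff add_divide_distrib)
    show "r * a \<in> smul x I" if "r \<in> \<O>" "a \<in> smul x I" for r a
      using that x frac_idealD(3)[OF I] by (auto simp: in_smul_iff simp flip: times_divide_eq_right)
    show "d * of_int e \<in> \<O>" "d * of_int e \<noteq> 0" using d e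
      by (auto intro: O_mult O_of_int)
    fix a assume "a \<in> smul x I"
    then obtain b where b: "b \<in> I" "a = x * b" by (auto simp: smul_def)
    have "d * of_int e * a = (d * b) * (of_int e * x)" by (simp only: b(2) mult_ac)
    thus "d * of_int e * a \<in> \<O>" by (simp only: O_mult[OF d(3)[OF b(1)] e(2)])
  qed
qed

lemma ideal_mult_frac_ideal:
  assumes I: "I \<in> frac_ideals D" and J: "J \<in> frac_ideals D"
  shows "ideal_mult I J \<in> frac_ideals D"
proof -
  obtain x where x: "x \<in> I" "x \<noteq> 0" using frac_ideal_nonzero[OF I] by blast
  obtain y where y: "y \<in> J" "y \<noteq> 0" using frac_ideal_nonzero[OF J] by blast
  obtain d where d: "d \<in> \<O>" "d \<noteq> 0" "\<And>x. x \<in> I \<Longrightarrow> d * x \<in> \<O>" using frac_ideal_denominator[OF I] by blast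
  obtain e where e: "e \<in> \<O>" "e \<noteq> 0" "\<And>x. x \<in> J \<Longrightarrow> e * x \<in> \<O>" using frac_ideal_denominator[OF J] by blast
  show ?thesis
  proof (rule frac_idealsI[of _ "x * y" "d * e"])
    show "ideal_mult I J \<subseteq> K"
      by (rule ideal_mult_subset) (auto intro: K_intros frac_idealD(1)[OF I] frac_idealD(1)[OF J])
    show "x * y \<in> ideal_mult I J" "x * y \<noteq> 0" using x y by (auto intro: ideal_multI)
    show "a + b \<in> ideal_mult I J" if "a \<in> ideal_mult I J" "b \<in> ideal_mult I J" for a b
      using that by (rule ideal_mult_add)
    show "r * a \<in> ideal_mult I J" if r: "r \<in> \<O>" and a: "a \<in> ideal_mult I J" for r a
      using a
    proof (induction rule: ideal_mult_induct)
      case (mult a b)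
      show ?case using ideal_multI[OF frac_idealD(3)[OF I r mult(1)] mult(2)]
        by (simp add: mult.assoc)
    qed (auto simp: distrib_left intro: ideal_mult_0 ideal_mult_add)
    show "d * e \<in> \<O>" "d * e \<noteq> 0" using d e by (auto intro: O_mult)
    fix a assume "a \<in> ideal_mult I J"
    thus "d * e * a \<in> \<O>"
    proof (induction rule: ideal_mult_induct)
      case (mult a b)
      have "d * e * (a * b) = (d * a) * (e * b)" by (simp only: mult_ac)
      thus ?case by (simp only: O_mult[OF d(3)[OF mult(1)] e(3)[OF mult(2)]])
    qed (auto simp: distrib_left intro: O_0 O_add)
  qed
qed

lemma ideal_mult_one: 
  assumes "I \<in> frac_ideals D" shows "ideal_mult \<O> I = I"
proof
  show "ideal_mult \<O> I \<subseteq> I"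
    by (rule ideal_mult_subset) (auto intro: frac_idealD[OF assms])
  show "I \<subseteq> ideal_mult \<O> I" using ideal_multI[OF O_1, of _ I] by auto
qed

lemma principal_ideal_smul: "principal_ideal D x = smul x \<O>"
  by (simp add: principal_ideal_def smul_def)

text \<open>
  The generator of the coefficients of \<open>\<omega>\<close> that occur in \<open>J\<close> is \<open>c\<close>, and the generator of the integers in
  \<open>J\<close> is \<open>c a\<close>. Multiplication by \<open>\<omega>\<close> shows that \<open>c\<close> divides all coordinates; multiplication of the
  second basis element by the conjugate of \<open>b + \<omega>\<close> shows that \<open>a\<close> divides the norm of \<open>b + \<omega>\<close>.
\<close>

lemma integral_ideal_hermite_basis:
  assumes J: "J \<in> frac_ideals D" and JO: "J \<subseteq> \<O>"
  obtains c a b where "c > 0" "a > 0" "J = zspan (of_int (c * a)) (of_int (c * b) + of_int c * omega)"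
    "a dvd b\<^sup>2 + b - D4"
proof -
  define S1 where "S1 = {m::int. of_int m \<in> J}"
  define S2 where "S2 = {n::int. \<exists>m::int. of_int m + of_int n * omega \<in> J}"
  obtain x where x: "x \<in> J" "x \<noteq> 0" using frac_ideal_nonzero[OF J] by blast
  obtain N where N: "x * cj x = of_int N" using O_norm_int JO x(1) by blast
  have "N \<noteq> 0" using N x JO O_K by (auto simp: cj_eq_0_iff subset_iff)
  have "of_int N \<in> J" using frac_idealD(3)[OF J cj_O x(1), of x] x JO N
    by (auto simp: mult.commute)
  have g1: "\<exists>x\<in>S1. x \<noteq> 0"
    using \<open>of_int N \<in> J\<close> \<open>N \<noteq> 0\<close> by (auto simp: S1_def)
  obtain a where a: "a > 0" "\<And>m. m \<in> S1 \<longleftrightarrow> a dvd m"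
    by (rule int_subgroup_generator[OF _ _ g1])
       (auto simp: S1_def intro: frac_idealD[OF J])
  have "of_int N * omega \<in> J"
    using frac_idealD(3)[OF J O_omega \<open>of_int N \<in> J\<close>] by (simp add: mult.commute)
  hence "N \<in> S2" unfolding S2_def by (intro CollectI exI[of _ 0]) simp
  hence g2: "\<exists>x\<in>S2. x \<noteq> 0" using \<open>N \<noteq> 0\<close> by blast
  obtain c where c: "c > 0" "\<And>m. m \<in> S2 \<longleftrightarrow> c dvd m"
  proof (rule int_subgroup_generator[OF _ _ g2])
    fix x y assume "x \<in> S2" "y \<in> S2"
    then obtain m m' where "of_int m + of_int x * omega \<in> J" "of_int m' + of_int y * omega \<in> J" by (auto simp: S2_def)
    from frac_idealD(2)[OF J this] have "of_int (m + m') + of_int (x + y) * omega \<in> J"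
      by (simp add: algebra_simps)
    thus "x + y \<in> S2" unfolding S2_def by blast
  next
    fix x assume "x \<in> S2"
    then obtain m where "of_int m + of_int x * omega \<in> J" by (auto simp: S2_def)
    from frac_idealD(5)[OF J this] have "of_int (- m) + of_int (- x) * omega \<in> J" by simp
    thus "- x \<in> S2" unfolding S2_def by blast
  qed blast
  have "c \<in> S2" using c(2) by simp
  then obtain b0 where b0: "of_int b0 + of_int c * omega \<in> J" by (auto simp: S2_def)
  have "of_int a \<in> J" using a(2)[of a] by (simp add: S1_def)
  have "of_int 0 + of_int a * omega \<in> J"
    using frac_idealD(3)[OF J O_omega \<open>of_int a \<in> J\<close>] by (simp add: mult.commute)
  hence "c dvd a" using c(2) unfolding S2_def by blast
  then obtain a' where a': "a = c * a'" by (auto simp: dvd_def)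
  have "omega * (of_int b0 + of_int c * omega) = of_int b0 * omega + of_int c * (omega * omega)"
    by (simp add: algebra_simps)
  also have "\<dots> = of_int (c * D4) + of_int (b0 + c) * omega" unfolding omega_sq
    by (simp add: algebra_simps)
  finally have "of_int (c * D4) + of_int (b0 + c) * omega \<in> J"
    using frac_idealD(3)[OF J O_omega b0] by simp
  hence "c dvd b0 + c" using c(2) unfolding S2_def by blast
  hence "c dvd b0" by simp
  then obtain b where b: "b0 = c * b" by (auto simp: dvd_def)
  have J_eq: "J = zspan (of_int a) (of_int b0 + of_int c * omega)"
  proof
    show "zspan (of_int a) (of_int b0 + of_int c * omega) \<subseteq> J"
      by (rule zspan_least) (auto intro: frac_idealD[OF J] \<open>of_int a \<in> J\<close> b0)
    show "J \<subseteq> zspan (of_int a) (of_int b0 + of_int c * omega)"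
    proof
      fix y assume y: "y \<in> J"
      obtain m n where mn: "y = of_int m + of_int n * omega" using O_E y JO by blast
      hence "c dvd n" using c(2)[of n] y unfolding S2_def by blast
      then obtain q where q: "n = c * q" by (auto simp: dvd_def)
      have "y + - (of_int q * (of_int b0 + of_int c * omega)) \<in> J"
        using frac_idealD(2,5,6)[OF J] y b0 by blast
      also have "y + - (of_int q * (of_int b0 + of_int c * omega)) = of_int (m - q * b0)"
        unfolding mn q by (simp add: algebra_simps)
      finally have "m - q * b0 \<in> S1" by (simp only: S1_def mem_Collect_eq)
      hence "a dvd m - q * b0" using a(2) by blast
      then obtain p where p: "m - q * b0 = a * p" by (auto simp: dvd_def)
      have "m = a * p + q * b0" using p by simp
      thus "y \<in> zspan (of_int a) (of_int b0 + of_int c * omega)"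
        by (intro zspanI'[of _ p _ q]) (simp add: mn q algebra_simps)
    qed
  qed
  have "(of_int b + (1 - omega)) * (of_int b0 + of_int c * omega) = of_int c * (of_int (b * b + b) - (omega * omega - omega))"
    by (simp add: b algebra_simps)
  also have "\<dots> = of_int (c * (b\<^sup>2 + b - D4))" unfolding omega_sq
    by (simp add: algebra_simps power2_eq_square)
  finally have "(of_int b + (1 - omega)) * (of_int b0 + of_int c * omega) = of_int (c * (b\<^sup>2 + b - D4))" .
  moreover have "of_int b + (1 - omega) \<in> \<O>" by (intro O_add O_diff O_of_int O_1 O_omega)
  ultimately have "of_int (c * (b\<^sup>2 + b - D4)) \<in> J" using frac_idealD(3)[OF J _ b0]
    by metis
  hence "c * (b\<^sup>2 + b - D4) \<in> S1" by (simp only: S1_def mem_Collect_eq)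
  hence "a dvd c * (b\<^sup>2 + b - D4)" using a(2) by blast
  hence dv: "a' dvd b\<^sup>2 + b - D4" using c(1) by (simp add: a')
  have "a' > 0" using a(1) c(1) by (simp add: a' zero_less_mult_iff)
  thus ?thesis using that[OF c(1) _ _ dv] J_eq by (simp only: a' b)
qed

lemma frac_ideal_normal_basis:
  assumes I: "I \<in> frac_ideals D"
  obtains c a b where "c \<in> K" "c \<noteq> 0" "a > 0" "I = zspan (c * of_int a) (c * (of_int b + omega))"
    "a dvd b\<^sup>2 + b - D4"
proof -
  obtain d where d: "d \<in> \<O>" "d \<noteq> 0" "\<And>x. x \<in> I \<Longrightarrow> d * x \<in> \<O>" using frac_ideal_denominator[OF I] by blast
  define J where "J = smul d I"
  have J: "J \<in> frac_ideals D" unfolding J_def by (rule smul_frac_ideal[OF I O_K[OF d(1)] d(2)])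
  have JO: "J \<subseteq> \<O>" unfolding J_def smul_def using d(3) by auto
  obtain c a b where cab: "c > 0" "a > 0" "J = zspan (of_int (c * a)) (of_int (c * b) + of_int c * omega)"
    "a dvd b\<^sup>2 + b - D4" using integral_ideal_hermite_basis[OF J JO] by blast
  have "I = smul (1 / d) J" using d(2) by (simp add: J_def smul_smul)
  also have "\<dots> = zspan (of_int c / d * of_int a) (of_int c / d * (of_int b + omega))"
    unfolding cab(3) smul_zspan by (simp add: algebra_simps)
  finally have "I = zspan (of_int c / d * of_int a) (of_int c / d * (of_int b + omega))" .
  moreover have "of_int c / d \<in> K" "of_int c / d \<noteq> 0" using cab(1) d
    by (auto intro: K_intros O_K)
  ultimately show ?thesis using that cab(2,4) by blast
qed

definition root1 :: "int bqf \<Rightarrow> real" where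
  "root1 Q = (- of_int (qB Q) + rD) / (2 * of_int (qA Q))"

text \<open>
  Up to a factor from the field, this is the ideal attached to the form (\<open>form_ideal_eq\<close>).
\<close>

definition lat :: "int bqf \<Rightarrow> real set" where
  "lat Q = zspan 1 (root1 Q)"

lemma disc_A_nonzero:
  assumes "bqf_disc Q = D" shows "qA Q \<noteq> 0"
proof
  assume "qA Q = 0"
  hence "(qB Q)\<^sup>2 = D" using assms by (simp add: bqf_disc_def)
  hence "qB Q dvd 1" using D_squarefree by (auto simp: squarefree_def)
  hence "(qB Q)\<^sup>2 = 1" by (metis power2_abs power_one zdvd1_eq)
  thus False using \<open>(qB Q)\<^sup>2 = D\<close> D_gt_1 by simp
qed

lemma disc_B_odd:
  assumes "bqf_disc Q = D" shows "odd (qB Q)"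
proof
  assume "even (qB Q)"
  hence "even ((qB Q)\<^sup>2 - 4 * qA Q * qC Q)" by simp
  thus False using assms D_odd unfolding bqf_disc_def by (simp only:)
qed

text \<open>
  The square of a common divisor of the coefficients divides the discriminant.
\<close>

lemma disc_primitive:
  assumes "bqf_disc Q = D" shows "gcd (qA Q) (gcd (qB Q) (qC Q)) = 1"
proof -
  define g where "g = gcd (qA Q) (gcd (qB Q) (qC Q))"
  have "g dvd qA Q" "g dvd qB Q" "g dvd qC Q"
    unfolding g_def by (auto intro: dvd_trans[OF gcd_dvd2])
  hence "g\<^sup>2 dvd (qB Q)\<^sup>2" "g * g dvd qA Q * qC Q" by (auto intro: mult_dvd_mono)
  hence "g\<^sup>2 dvd (qB Q)\<^sup>2 - 4 * (qA Q * qC Q)"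
    by (intro dvd_diff) (auto simp: power2_eq_square)
  hence "g\<^sup>2 dvd D" using assms by (simp add: bqf_disc_def mult.assoc)
  hence "g dvd 1" using D_squarefree by (auto simp: squarefree_def)
  thus ?thesis by (simp add: g_def)
qed

lemma form_ideal_eq:
  assumes "bqf_disc Q = D"
  shows "form_ideal D Q y = smul (2 * of_int (qA Q) * y) (lat Q)"
proof -
  have "2 * of_int (qA Q) * root1 Q = - of_int (qB Q) + rD"
    using disc_A_nonzero[OF assms] by (simp add: root1_def)
  hence "(2 * of_int (qA Q) * root1 Q) * y = (- of_int (qB Q) + rD) * y" by (simp only:)
  moreover have "2 * of_int (qA Q) * y * root1 Q = (2 * of_int (qA Q) * root1 Q) * y" by simp
  ultimately have "2 * of_int (qA Q) * y * root1 Q = (- of_int (qB Q) + rD) * y" by (simp only:)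
  hence "smul (2 * of_int (qA Q) * y) (lat Q) = zspan (2 * of_int (qA Q) * y) ((- of_int (qB Q) + rD) * y)"
    unfolding lat_def smul_zspan mult_1_right by (simp only:)
  also have "\<dots> = form_ideal D Q y" unfolding form_ideal_def zspan_def
    by (simp add: algebra_simps)
  finally show ?thesis by simp
qed

text \<open>
  The Hermite basis is, up to a factor, the basis of the ideal of a form whose first coefficient \<open>a\<close> is
  positive. Reversing the signs of the outer coefficients changes neither the discriminant nor the
  ideal, so the sign of the first coefficient can be fitted to the norm of \<open>y\<close>.
\<close>

lemma frac_ideal_eq_form_ideal:
  assumes I: "I \<in> frac_ideals D"
  obtains Q y where "bqf_disc Q = D" "y \<in> K" "y \<noteq> 0" "sgn (quad_norm D y) = of_int (sgn (qA Q))"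
    "form_ideal D Q y = I"
proof -
  obtain c a b where cab: "c \<in> K" "c \<noteq> 0" "a > 0" "I = zspan (c * of_int a) (c * (of_int b + omega))"
    "a dvd b\<^sup>2 + b - D4" using frac_ideal_normal_basis[OF I] by blast
  obtain e where e: "b\<^sup>2 + b - D4 = a * e" using cab(5) by (auto simp: dvd_def)
  \<comment> \<open>The basis of the ideal of a form carries a factor 2, which \<open>a\<close> and \<open>b + \<omega>\<close> lack.\<close>
  define y where "y = c / 2"
  have y: "y \<in> K" "y \<noteq> 0" using cab
    by (auto simp: y_def intro: K_divide K_of_int[of 2, simplified])
  define Q where "Q = (if quad_norm D y > 0 then BQF a (- (2 * b + 1)) e else BQF (- a) (- (2 * b + 1)) (- e))"
  have "(2 * b + 1)\<^sup>2 - 4 * (a * e) = D" unfolding e[symmetric] using D_eq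
    by (simp add: power2_eq_square algebra_simps)
  hence disc: "bqf_disc Q = D" by (auto simp: Q_def bqf_disc_def power2_eq_square algebra_simps)
  have "quad_norm D y \<noteq> 0"
    using of_rat_quad_norm[OF y(1)] norm_eq_0_iff[OF y(1)] y(2) by auto
  hence sgn: "sgn (quad_norm D y) = of_int (sgn (qA Q))" using cab(3) by (auto simp: Q_def sgn_if)
  have om2: "2 * (of_int b + omega) = - of_int (- (2 * b + 1)) + rD" by (simp add: omega_def)
  have "form_ideal D Q y = zspan (2 * of_int (qA Q) * y) ((- of_int (qB Q) + rD) * y)"
    unfolding form_ideal_def zspan_def by (simp add: algebra_simps)
  also have "\<dots> = zspan (c * of_int (qA Q)) (c * (of_int b + omega))"
  proof -
    have "(- of_int (qB Q) + rD) * y = c * (of_int b + omega)"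
      by (simp add: Q_def y_def omega_def field_simps)
    moreover have "2 * of_int (qA Q) * y = c * of_int (qA Q)" by (simp add: y_def)
    ultimately show ?thesis by (simp only:)
  qed
  also have "\<dots> = I"
  proof -
    have "zspan (- x) z = zspan x z" for x z
    proof -
      have "zspan (- x) z \<subseteq> zspan x z" for x z
        by (rule zspan_least) (auto intro: zspan_add zspan_of_int_mult zspan_minus zspan_basis)
      from this[of x z] this[of "- x" z] show ?thesis by auto
    qed
    thus ?thesis unfolding cab(4) by (simp add: Q_def)
  qed
  finally show ?thesis using that disc y sgn by blast
qed

section \<open>Pell's equation and the units of norm one\<close>

lemma int_norm_eq_0: "h\<^sup>2 - D * k\<^sup>2 = 0 \<longleftrightarrow> h = 0 \<and> k = 0"
  for h k :: int
proof
  assume "h\<^sup>2 - D * k\<^sup>2 = 0"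
  hence "(of_int h)\<^sup>2 = (of_int k * rD)\<^sup>2"
    by (metis eq_iff_diff_eq_0 mult.commute of_int_mult of_int_power power2_eq_square power_mult_distrib rD_sq)
  hence "of_int h = of_int k * rD \<or> of_int h = - (of_int k * rD)" by (simp add: power2_eq_iff)
  hence "of_rat (of_int h) + of_rat 0 * rD = of_rat 0 + of_rat (of_int k) * rD \<or>
         of_rat (of_int h) + of_rat 0 * rD = of_rat 0 + of_rat (of_int (- k)) * rD"
    by (simp add: of_rat_minus)
  thus "h = 0 \<and> k = 0" unfolding coords_unique by auto
qed simp

text \<open>
  The infinitely many fractions \<open>h/k\<close> with \<open>\<bar>\<surd>D - h/k\<bar> < 1/k\<^sup>2\<close> have norms \<open>h\<^sup>2 - D k\<^sup>2\<close> of bounded size. Two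
  of them agree in the norm \<open>m\<close> and in the residues modulo \<open>m\<close> of \<open>h\<close> and \<open>k\<close>, and the quotient of
  the corresponding elements \<open>h + k \<surd>D\<close> is a nontrivial solution.
\<close>

lemma pell_solution_exists: "\<exists>x y::int. x > 0 \<and> y > 0 \<and> x\<^sup>2 - D * y\<^sup>2 = 1"
proof -
  define A where "A = approx_set rD"
  define f :: "int \<times> int \<Rightarrow> int" where "f = (\<lambda>(h, k). h\<^sup>2 - D * k\<^sup>2)"
  have inf: "infinite A" using rD_irrational rational_iff_finite_approx_set by (simp add: A_def)
  define M where "M = \<lceil>1 + 2 * rD\<rceil>"
  have "f ` A \<subseteq> {- M..M}"
  proof
    fix m assume "m \<in> f ` A"
    then obtain h k where hk: "k > 0" "\<bar>rD - of_int h / of_int k\<bar> < 1 / (of_int k)\<^sup>2" "m = h\<^sup>2 - D * k\<^sup>2"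
      by (auto simp: A_def approx_set_def f_def)
    have k1: "of_int k \<ge> (1::real)" using hk(1) by simp
    have "\<bar>of_int h - of_int k * rD\<bar> = of_int k * \<bar>rD - of_int h / of_int k\<bar>"
      using hk(1) by (simp add: abs_mult_pos' field_simps abs_minus_commute)
    also have "\<dots> < of_int k * (1 / (of_int k)\<^sup>2)"
      using hk(1,2) by (intro mult_strict_left_mono) auto
    also have "\<dots> = 1 / of_int k" using hk(1) by (simp add: power2_eq_square)
    finally have d: "\<bar>of_int h - of_int k * rD\<bar> < 1 / of_int k" .
    have kinv: "1 / of_int k \<le> (1::real)" using k1 by simp
    have "\<bar>of_int h + of_int k * rD\<bar> \<le> \<bar>of_int h - of_int k * rD\<bar> + 2 * of_int k * rD"
    proof -
      have "of_int k * rD > 0" using hk(1) rD_pos by simp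
      thus ?thesis unfolding mult.assoc by linarith
    qed
    also have "\<dots> \<le> 1 + 2 * of_int k * rD" using d kinv by linarith
    also have "\<dots> \<le> of_int k * (1 + 2 * rD)" using k1 by (simp add: algebra_simps)
    finally have e: "\<bar>of_int h + of_int k * rD\<bar> \<le> of_int k * (1 + 2 * rD)" .
    have "\<bar>of_int m\<bar> = \<bar>of_int h - of_int k * rD\<bar> * \<bar>of_int h + of_int k * rD\<bar>"
      unfolding hk(3) abs_mult[symmetric] by (simp add: algebra_simps power2_eq_square)
    also have "\<dots> \<le> (1 / of_int k) * (of_int k * (1 + 2 * rD))"
      using d e hk(1) by (intro mult_mono) auto
    also have "\<dots> = 1 + 2 * rD" using hk(1) by simp
    also have "\<dots> \<le> of_int M" by (simp add: M_def)
    finally have "\<bar>m\<bar> \<le> M" by linarith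
    thus "m \<in> {- M..M}" by auto
  qed
  hence "finite (f ` A)" by (rule finite_subset) simp
  from pigeonhole_infinite[OF inf this] obtain a0 where a0: "a0 \<in> A" "infinite {a \<in> A. f a = f a0}" by blast
  define m where "m = f a0"
  define B where "B = {a \<in> A. f a = m}"
  have "m \<noteq> 0" using a0(1) int_norm_eq_0 by (auto simp: m_def f_def A_def approx_set_def)
  define g where "g = (\<lambda>(h, k). (h mod \<bar>m\<bar>, k mod \<bar>m\<bar>))"
  have "g ` B \<subseteq> {0..\<bar>m\<bar>} \<times> {0..\<bar>m\<bar>}"
    using \<open>m \<noteq> 0\<close> by (auto simp: g_def intro!: less_imp_le[OF pos_mod_bound])
  hence "finite (g ` B)" by (rule finite_subset) simp
  moreover have infB: "infinite B" using a0(2) by (simp add: B_def m_def)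
  ultimately obtain b where b: "b \<in> B" "infinite {a \<in> B. g a = g b}"
    using pigeonhole_infinite[of B g] by blast
  obtain c where c: "c \<in> B" "g c = g b" "c \<noteq> b"
  proof -
    have "\<not> {a \<in> B. g a = g b} \<subseteq> {b}" using b(2) finite_subset by blast
    thus ?thesis using that by blast
  qed
  obtain h1 k1 h2 k2 where hk: "b = (h1, k1)" "c = (h2, k2)" by (cases b; cases c)
  have prp: "k1 > 0" "coprime h1 k1" "k2 > 0" "coprime h2 k2"
    "h1\<^sup>2 - D * k1\<^sup>2 = m" "h2\<^sup>2 - D * k2\<^sup>2 = m" "h1 mod \<bar>m\<bar> = h2 mod \<bar>m\<bar>" "k1 mod \<bar>m\<bar> = k2 mod \<bar>m\<bar>"
    using b(1) c(1,2) by (auto simp: hk B_def A_def approx_set_def f_def g_def)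
  have "m dvd h1 - h2" "m dvd k1 - k2"
    using prp(7,8) by (simp_all add: mod_eq_dvd_iff)
  then obtain p q where pq: "h1 = h2 + m * p" "k1 = k2 + m * q"
    by (auto simp: dvd_def algebra_simps)
  \<comment> \<open>Up to conjugation, \<open>x + y \<surd>D\<close> is the quotient of \<open>h1 + k1 \<surd>D\<close> by \<open>h2 + k2 \<surd>D\<close>.\<close>
  define x where "x = 1 + h2 * p - D * k2 * q"
  define y where "y = p * k2 - h2 * q"
  have X: "h1 * h2 - D * k1 * k2 = m * x"
    using prp(6) by (simp add: pq x_def algebra_simps power2_eq_square)
  have Y: "h1 * k2 - h2 * k1 = m * y"
    by (simp add: pq y_def algebra_simps)
  have "m\<^sup>2 * (x\<^sup>2 - D * y\<^sup>2) = (m * x)\<^sup>2 - D * (m * y)\<^sup>2"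
    by (simp add: algebra_simps power2_eq_square)
  also have "\<dots> = (h1\<^sup>2 - D * k1\<^sup>2) * (h2\<^sup>2 - D * k2\<^sup>2)"
    unfolding X[symmetric] Y[symmetric] by (simp add: algebra_simps power2_eq_square)
  also have "\<dots> = m\<^sup>2 * 1" unfolding prp(5,6) by (simp add: power2_eq_square)
  finally have one: "x\<^sup>2 - D * y\<^sup>2 = 1" using \<open>m \<noteq> 0\<close> by simp
  have "y \<noteq> 0"
  proof
    assume "y = 0"
    hence eq: "h1 * k2 = h2 * k1" using Y by simp
    have "k1 dvd k2" using eq prp(2)
      by (metis coprime_commute coprime_dvd_mult_right_iff dvd_triv_right)
    moreover have "k2 dvd k1" using eq prp(4)
      by (metis coprime_commute coprime_dvd_mult_right_iff dvd_triv_right)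
    ultimately have "k1 = k2" using prp(1,3) by (simp add: zdvd_antisym_nonneg)
    hence "h1 = h2" using eq prp(1) by simp
    thus False using c(3) \<open>k1 = k2\<close> by (simp add: hk)
  qed
  moreover have "x \<noteq> 0"
  proof
    assume "x = 0"
    hence "D * y\<^sup>2 = - 1" using one by simp
    moreover have "D * y\<^sup>2 \<ge> 0" using D_gt_1 by simp
    ultimately show False by simp
  qed
  ultimately show ?thesis using one
    by (intro exI[of _ "\<bar>x\<bar>"] exI[of _ "\<bar>y\<bar>"]) auto
qed

definition pell_v :: int where "pell_v = fst (min_pell D)"
definition pell_u :: int where "pell_u = snd (min_pell D)"

text \<open>
  Along the solutions \<open>v\<close> increases with \<open>u\<close>, so that both minima are attained by the same solution.
\<close>

lemma min_pell_props:
  "pell_v > 0" "pell_u > 0" "pell_v\<^sup>2 - D * pell_u\<^sup>2 = 4"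
  "\<And>v u. v > 0 \<Longrightarrow> u > 0 \<Longrightarrow> v\<^sup>2 - D * u\<^sup>2 = 4 \<Longrightarrow> pell_v \<le> v \<and> pell_u \<le> u"
proof -
  define S where "S = (\<lambda>n::nat. n > 0 \<and> (\<exists>v::int. v > 0 \<and> v\<^sup>2 - D * (int n)\<^sup>2 = 4))"
  obtain x y :: int where xy: "x > 0" "y > 0" "x\<^sup>2 - D * y\<^sup>2 = 1"
    using pell_solution_exists by blast
  have "(2 * x)\<^sup>2 - D * (2 * y)\<^sup>2 = 4" using xy(3)
    by (simp add: power_mult_distrib algebra_simps)
  hence "S (nat (2 * y))" using xy(1,2) unfolding S_def by (intro conjI exI[of _ "2 * x"]) auto
  hence L: "S (LEAST n. S n)" by (rule LeastI)
  define u where "u = int (LEAST n. S n)"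
  obtain v where v: "v > 0" "v\<^sup>2 - D * u\<^sup>2 = 4" and u: "u > 0" using L
    by (auto simp: S_def u_def)
  have min: "v \<le> v' \<and> u \<le> u'" if "v' > 0" "u' > 0" "v'\<^sup>2 - D * u'\<^sup>2 = 4"
    for v' u'
  proof -
    have "S (nat u')" using that unfolding S_def by (intro conjI exI[of _ v']) auto
    hence "(LEAST n. S n) \<le> nat u'" by (rule Least_le)
    hence uu: "u \<le> u'" using that(2) by (simp add: u_def)
    hence "u\<^sup>2 \<le> u'\<^sup>2" using u by (intro power_mono) auto
    hence "D * u\<^sup>2 \<le> D * u'\<^sup>2" using D_gt_1 by (intro mult_left_mono) auto
    hence "v\<^sup>2 \<le> v'\<^sup>2" using v(2) that(3) by linarith
    hence "v \<le> v'" using that(1) by (simp add: power2_le_iff_abs_le)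
    thus ?thesis using uu by simp
  qed
  have "min_pell D = (v, u)"
    unfolding min_pell_def
  proof (rule the_equality)
    show "case (v, u) of (v, u) \<Rightarrow> v > 0 \<and> u > 0 \<and> v\<^sup>2 - D * u\<^sup>2 = 4 \<and>
      (\<forall>v' u'. v' > 0 \<and> u' > 0 \<and> v'\<^sup>2 - D * u'\<^sup>2 = 4 \<longrightarrow> v \<le> v' \<and> u \<le> u')"
      using v u min by auto
    fix z assume z: "case z of (v, u) \<Rightarrow> v > 0 \<and> u > 0 \<and> v\<^sup>2 - D * u\<^sup>2 = 4 \<and>
      (\<forall>v' u'. v' > 0 \<and> u' > 0 \<and> v'\<^sup>2 - D * u'\<^sup>2 = 4 \<longrightarrow> v \<le> v' \<and> u \<le> u')"
    obtain v1 u1 where z1: "z = (v1, u1)" by (cases z)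
    from z have "v1 \<le> v" "u1 \<le> u" using v u by (auto simp: z1)
    moreover from z have "v \<le> v1" "u \<le> u1" using min[of v1 u1] by (auto simp: z1)
    ultimately show "z = (v, u)" by (simp add: z1)
  qed
  thus "pell_v > 0" "pell_u > 0" "pell_v\<^sup>2 - D * pell_u\<^sup>2 = 4"
    "\<And>v u. v > 0 \<Longrightarrow> u > 0 \<Longrightarrow> v\<^sup>2 - D * u\<^sup>2 = 4 \<Longrightarrow> pell_v \<le> v \<and> pell_u \<le> u"
    using v u min by (auto simp: pell_v_def pell_u_def)
qed

definition eps :: real where "eps = (of_int pell_v + of_int pell_u * rD) / 2"

lemma eps_O: "eps \<in> \<O>"
proof -
  have "even (pell_v\<^sup>2 - D * pell_u\<^sup>2)" unfolding min_pell_props(3) by simp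
  hence "even (pell_v - pell_u)" using D_odd by auto
  then obtain m where "pell_v = 2 * m + pell_u" by (metis dvd_def diff_add_cancel)
  hence "eps = of_int m + of_int pell_u * omega" by (simp add: eps_def omega_def field_simps)
  thus ?thesis by (simp only: O_I)
qed

lemma eps_K: "eps \<in> K" by (rule O_K[OF eps_O])

lemma cj_eps: "cj eps = (of_int pell_v - of_int pell_u * rD) / 2"
proof -
  have "eps = of_rat (of_int pell_v / 2) + of_rat (of_int pell_u / 2) * rD"
    by (simp add: eps_def of_rat_divide add_divide_distrib)
  hence "cj eps = of_rat (of_int pell_v / 2) - of_rat (of_int pell_u / 2) * rD"
    by (simp only: cj_coords)
  thus ?thesis by (simp add: of_rat_divide diff_divide_distrib)
qed

lemma eps_norm: "eps * cj eps = 1"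
proof -
  have "eps * cj eps = of_int (pell_v\<^sup>2 - D * pell_u\<^sup>2) / 4"
    unfolding cj_eps unfolding eps_def by (simp add: field_simps power2_eq_square)
  thus ?thesis unfolding min_pell_props(3) by simp
qed

lemma eps_gt_1: "eps > 1"
proof -
  have "pell_u\<^sup>2 > 0" using min_pell_props(2) by simp
  hence "D * pell_u\<^sup>2 > 0" using D_gt_1 by simp
  hence "2\<^sup>2 < pell_v\<^sup>2" using min_pell_props(3) by simp
  hence "2 < pell_v" by (rule power2_less_imp_less) (use min_pell_props(1) in simp)
  moreover have "of_int pell_u * rD > 0" using min_pell_props(2) rD_pos by simp
  ultimately have "2 < of_int pell_v + of_int pell_u * rD" by linarith
  thus ?thesis by (simp add: eps_def)
qed

lemma cj_eps_eq: "cj eps = inverse eps"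
  using eps_norm by (metis inverse_unique)

lemma eps_powi_O: "eps powi n \<in> \<O>"
proof -
  have "x ^ n \<in> \<O>" if "x \<in> \<O>" for x n
    by (induction n) (auto simp: O_1 O_mult that)
  moreover have "inverse eps \<in> \<O>" using cj_O[OF eps_O] by (simp add: cj_eps_eq)
  ultimately show ?thesis using eps_O by (auto simp: power_int_def)
qed

lemma cj_eps_powi: "cj (eps powi n) = eps powi (- n)"
  by (simp add: cj_power_int eps_K cj_eps_eq power_int_minus power_int_inverse)

lemma eps_powi_norm: "eps powi n * cj (eps powi n) = 1"
  using eps_gt_1 by (simp add: cj_eps_powi power_int_minus)

lemma eps_powi_pos: "eps powi n > 0" using eps_gt_1 by simp

lemma power_int_bracket:
  assumes b: "b > (1::real)" and "x > 0"
  obtains k where "1 \<le> x * b powi (- k)" "x * b powi (- k) < b"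
proof -
  define k where "k = \<lfloor>log b x\<rfloor>"
  have "b powr of_int k \<le> b powr log b x" "b powr log b x < b powr (of_int k + 1)"
    using b by (auto simp: k_def intro!: powr_mono powr_less_mono)
  hence "b powi k \<le> x" "x < b powi k * b"
    using assms by (simp_all add: powr_add powr_real_of_int')
  moreover have "b powi k > 0" using b by simp
  ultimately show ?thesis using that[of k] by (simp add: power_int_minus field_simps)
qed

text \<open>
  A power of \<open>\<epsilon>\<close> brings a positive unit of norm one into the interval \<open>[1, \<epsilon>)\<close>. If the result is not
  1, its coordinates form a solution of Pell's equation that is smaller than the smallest one.
\<close>

lemma norm_one_unit:
  assumes x: "x \<in> \<O>" and n1: "x * cj x = 1"
  obtains k where "x = eps powi k \<or> x = - (eps powi k)"
proof -
  have pos: "\<exists>k. x = eps powi k" if x: "x \<in> \<O>" and n1: "x * cj x = 1" and "x > 0"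
    for x
  proof -
    obtain k where k: "1 \<le> x * eps powi (- k)" "x * eps powi (- k) < eps"
      using power_int_bracket[OF eps_gt_1 \<open>x > 0\<close>] by blast
    define y where "y = x * eps powi (- k)"
    have y: "y \<in> \<O>" unfolding y_def by (intro O_mult x eps_powi_O)
    have "y * cj y = (x * cj x) * (eps powi (- k) * cj (eps powi (- k)))"
      unfolding y_def by (simp add: cj_mult O_K x eps_powi_O)
    hence yn: "y * cj y = 1" unfolding n1 eps_powi_norm by simp
    obtain m r where mr: "y = of_int m + of_int r * omega" using y by (rule O_E)
    define t where "t = 2 * m + r"
    have y_eq: "y = (of_int t + of_int r * rD) / 2" by (simp add: mr omega_def t_def field_simps)
    have cjy: "cj y = (of_int t - of_int r * rD) / 2"
      unfolding mr t_def by (simp add: cj_add cj_mult K_intros omega_K cj_omega) (simp add: omega_def field_simps)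
    have y1: "y \<ge> 1" using k by (simp add: y_def)
    have cjy': "cj y = 1 / y" using yn y1 by (simp add: field_simps)
    have "of_int (t\<^sup>2 - D * r\<^sup>2) = 4 * (y * cj y)"
      unfolding cjy unfolding y_eq by (simp add: field_simps power2_eq_square)
    hence "of_int (t\<^sup>2 - D * r\<^sup>2) = (of_int 4 :: real)" unfolding yn by simp
    hence tr: "t\<^sup>2 - D * r\<^sup>2 = 4" by (simp only: of_int_eq_iff)
    \<comment> \<open>Otherwise \<open>y - y' = r \<surd>D\<close> and \<open>y + y' = t\<close> are positive, and \<open>(t, r)\<close> solves Pell's equation.\<close>
    have "y = 1"
    proof (rule ccontr)
      assume "y \<noteq> 1"
      hence "y > 1" using y1 by simp
      hence "1 / y < 1" "1 / y > 0" by auto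
      have "of_int t = y + cj y" unfolding cjy unfolding y_eq by (simp add: field_simps)
      hence t: "t > 0" using \<open>y > 1\<close> \<open>1 / y > 0\<close> cjy' by linarith
      have "of_int r * rD = y - cj y" unfolding cjy unfolding y_eq by (simp add: field_simps)
      hence "of_int r * rD > 0" using \<open>y > 1\<close> \<open>1 / y < 1\<close> cjy' by linarith
      hence r: "r > 0" using rD_pos by (simp add: zero_less_mult_iff)
      have "pell_v \<le> t" "pell_u \<le> r" using min_pell_props(4)[OF t r tr] by auto
      hence "eps \<le> y" unfolding eps_def y_eq using rD_pos
        by (intro divide_right_mono add_mono mult_right_mono) auto
      thus False using k(2) by (simp add: y_def)
    qed
    hence "x = eps powi k" using eps_gt_1 by (simp add: y_def power_int_minus field_simps)
    thus ?thesis by blast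
  qed
  have "x \<noteq> 0" using n1 by auto
  show ?thesis
  proof (cases "x > 0")
    case True
    thus ?thesis using pos[OF x n1] that by blast
  next
    case False
    have "- x \<in> \<O>" "- x * cj (- x) = 1" "- x > 0"
      using x n1 False \<open>x \<noteq> 0\<close> by (auto simp: O_minus cj_minus O_K)
    from pos[OF this] obtain k where "- x = eps powi k" by blast
    hence "x = - (eps powi k)" by simp
    thus ?thesis using that by blast
  qed
qed

section \<open>The index of an ideal\<close>

text \<open>
  The determinant of \<open>x\<close> and \<open>y\<close> with respect to the basis \<open>1, \<omega>\<close>, times \<open>- \<surd>D\<close>.
\<close>

definition area :: "real \<Rightarrow> real \<Rightarrow> real" where
  "area x y = x * cj y - y * cj x"

lemma area_zspan_change:
  assumes "x \<in> K" "y \<in> K" "u = of_int p * x + of_int q * y" "v = of_int r * x + of_int t * y"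
  shows "area u v = of_int (p * t - q * r) * area x y"
  unfolding assms(3,4) area_def using assms(1,2)
  by (simp add: cj_add cj_mult K_intros) (simp add: algebra_simps)

text \<open>
  The two bases differ by integral matrices that are inverse to each other, unless both areas vanish.
\<close>

lemma area_zspan_eq:
  assumes K: "x \<in> K" "y \<in> K" "u \<in> K" "v \<in> K" and eq: "zspan x y = zspan u v"
  shows "\<bar>area x y\<bar> = \<bar>area u v\<bar>"
proof -
  have "u \<in> zspan x y" "v \<in> zspan x y" unfolding eq by (rule zspan_basis)+
  then obtain p q r t where 1: "u = of_int p * x + of_int q * y" "v = of_int r * x + of_int t * y"
    by (auto elim!: zspanE)
  have "x \<in> zspan u v" "y \<in> zspan u v" unfolding eq[symmetric] by (rule zspan_basis)+
  then obtain p' q' r' t' where 2: "x = of_int p' * u + of_int q' * v" "y = of_int r' * u + of_int t' * v"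
    by (auto elim!: zspanE)
  define d e where "d = p * t - q * r" and "e = p' * t' - q' * r'"
  have a1: "area u v = of_int d * area x y" unfolding d_def by (rule area_zspan_change[OF K(1,2) 1])
  have a2: "area x y = of_int e * area u v" unfolding e_def by (rule area_zspan_change[OF K(3,4) 2])
  show ?thesis
  proof (cases "area x y = 0")
    case True
    thus ?thesis using a1 by simp
  next
    case False
    have "area x y = of_int e * (of_int d * area x y)" using a2 unfolding a1 .
    hence "of_int (e * d) * area x y = 1 * area x y" by simp
    hence "of_int (e * d) = (of_int 1 :: real)" using False by (metis mult_cancel_right of_int_1)
    hence "e * d = 1" by (simp only: of_int_eq_iff)
    hence "\<bar>d\<bar> = 1" by (metis abs_zmult_eq_1 mult.commute abs_1)
    hence "\<bar>of_int d\<bar> = (1::real)" by (metis of_int_1 of_int_abs)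
    thus ?thesis unfolding a1 by (simp only: abs_mult mult_1_left)
  qed
qed

text \<open>
  Division by \<open>c\<close> and then by \<open>a\<close> leaves one remainder \<open>i + j \<omega>\<close> with \<open>0 \<le> i < a\<close> and \<open>0 \<le> j < c\<close> in each
  class.
\<close>

lemma index_hermite:
  assumes a: "a > 0" and c: "c > 0" and J: "J = zspan (of_int a) (of_int b + of_int c * omega)"
  shows "ideal_norm D J = nat (a * c)"
proof -
  define r where "r = {(x, y). x \<in> \<O> \<and> y \<in> \<O> \<and> x - y \<in> J}"
  have J_iff: "of_int m + of_int n * omega \<in> J \<longleftrightarrow> (\<exists>p q. m = p * a + q * b \<and> n = q * c)" for m n
  proof -
    have "of_int m + of_int n * omega \<in> J \<longleftrightarrow>
        (\<exists>p q. of_int m + of_int n * omega = of_int p * of_int a + of_int q * (of_int b + of_int c * omega))"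
      by (simp add: J zspan_def)
    also have "\<dots> \<longleftrightarrow> (\<exists>p q. of_int m + of_int n * omega = of_int (p * a + q * b) + of_int (q * c) * omega)"
      by (simp add: algebra_simps)
    also have "\<dots> \<longleftrightarrow> (\<exists>p q. m = p * a + q * b \<and> n = q * c)"
      unfolding O_coords_unique ..
    finally show ?thesis .
  qed
  have J0: "0 \<in> J" and Jadd: "\<And>x y. x \<in> J \<Longrightarrow> y \<in> J \<Longrightarrow> x + y \<in> J" and Jneg: "\<And>x. x \<in> J \<Longrightarrow> - x \<in> J"
    unfolding J by (auto intro: zspan_0 zspan_add zspan_minus)
  have equiv: "equiv \<O> r"
  proof (rule equivI)
    show "r \<subseteq> \<O> \<times> \<O>" by (auto simp: r_def)
    show "refl_on \<O> r" by (auto simp: refl_on_def r_def J0)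
    show "sym r" by (rule symI) (use Jneg in \<open>force simp: r_def\<close>)
    show "trans r"
    proof (rule transI)
      fix x y z assume "(x, y) \<in> r" "(y, z) \<in> r"
      thus "(x, z) \<in> r" using Jadd[of "x - y" "y - z"] by (auto simp: r_def)
    qed
  qed
  define f where "f = (\<lambda>(i, j). r `` {of_int i + of_int j * omega})"
  have "bij_betw f ({0..<a} \<times> {0..<c}) (\<O> // r)"
  proof (rule bij_betwI')
    fix P P' assume PP: "P \<in> {0..<a} \<times> {0..<c}" "P' \<in> {0..<a} \<times> {0..<c}"
    obtain i j i' j' where ij: "P = (i, j)" "P' = (i', j')" by (cases P; cases P')
    show "f P = f P' \<longleftrightarrow> P = P'"
    proof
      assume "f P = f P'"
      hence "(of_int i + of_int j * omega, of_int i' + of_int j' * omega) \<in> r"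
        unfolding f_def ij by (simp add: eq_equiv_class_iff[OF equiv O_I O_I])
      hence "of_int (i - i') + of_int (j - j') * omega \<in> J"
        by (simp add: r_def algebra_simps)
      then obtain p q where pq: "i - i' = p * a + q * b" "j - j' = q * c" unfolding J_iff by blast
      have jj: "0 \<le> j" "j < c" "0 \<le> j'" "j' < c" "0 \<le> i" "i < a" "0 \<le> i'" "i' < a"
        using PP by (auto simp: ij)
      have "j mod c = j' mod c" using pq(2) by (simp add: mod_eq_dvd_iff)
      hence "j = j'" using jj by simp
      hence "q = 0" using pq(2) c by simp
      hence "i mod a = i' mod a" using pq(1) by (simp add: mod_eq_dvd_iff)
      hence "i = i'" using jj by simp
      thus "P = P'" using \<open>j = j'\<close> by (simp add: ij)
    qed simp
  next
    fix P assume "P \<in> {0..<a} \<times> {0..<c}"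
    thus "f P \<in> \<O> // r" by (auto simp: f_def intro!: quotientI O_I)
  next
    fix X assume "X \<in> \<O> // r"
    then obtain z where z: "z \<in> \<O>" "X = r `` {z}" by (auto elim: quotientE)
    obtain m n where mn: "z = of_int m + of_int n * omega" using z(1) by (rule O_E)
    define q j where "q = n div c" and "j = n mod c"
    define p i where "p = (m - q * b) div a" and "i = (m - q * b) mod a"
    have n: "n = q * c + j" and m: "m = p * a + q * b + i"
      using div_mult_mod_eq[of n c] div_mult_mod_eq[of "m - q * b" a]
      by (auto simp: q_def j_def p_def i_def)
    have "of_int (m - i) + of_int (n - j) * omega \<in> J"
      unfolding J_iff by (intro exI[of _ p] exI[of _ q]) (simp add: m n)
    hence "z - (of_int i + of_int j * omega) \<in> J" by (simp add: mn algebra_simps)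
    hence "(z, of_int i + of_int j * omega) \<in> r" using z(1) O_I by (simp add: r_def)
    hence "X = f (i, j)" unfolding z(2) f_def by (simp add: equiv_class_eq[OF equiv])
    moreover have "(i, j) \<in> {0..<a} \<times> {0..<c}" using a c by (simp add: i_def j_def)
    ultimately show "\<exists>P\<in>{0..<a} \<times> {0..<c}. X = f P" by blast
  qed
  from bij_betw_same_card[OF this] have "card (\<O> // r) = nat a * nat c"
    by (simp add: card_cartesian_product)
  thus ?thesis unfolding ideal_norm_def r_def using a c by (simp add: nat_mult_distrib)
qed

text \<open>
  The index is the absolute value of the determinant for a Hermite basis, and neither side depends on
  the choice of the basis.
\<close>

lemma ideal_norm_area:
  assumes J: "J \<in> frac_ideals D" and JO: "J \<subseteq> \<O>" and xy: "J = zspan x y"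
  shows "of_nat (ideal_norm D J) * rD = \<bar>area x y\<bar>"
proof -
  obtain c a b where cab: "c > 0" "a > 0" "J = zspan (of_int (c * a)) (of_int (c * b) + of_int c * omega)"
    using integral_ideal_hermite_basis[OF J JO] by metis
  have "ideal_norm D J = nat (c * a * c)"
    by (rule index_hermite[OF _ _ cab(3)]) (use cab in auto)
  hence n: "of_nat (ideal_norm D J) = (of_int (c * a * c) :: real)" using cab(1,2) by simp
  have xK: "x \<in> K" "y \<in> K" using JO O_K zspan_basis[where x=x and y=y] unfolding xy
    by blast+
  have basis_K: "of_int (c * a) \<in> K" "of_int (c * b) + of_int c * omega \<in> K"
    by (auto intro: K_intros omega_K)
  have "\<bar>area x y\<bar> = \<bar>area (of_int (c * a)) (of_int (c * b) + of_int c * omega)\<bar>"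
    by (rule area_zspan_eq[OF xK basis_K]) (use cab(3) xy in simp)
  also have "area (of_int (c * a)) (of_int (c * b) + of_int c * omega) = of_int (c * a * c) * (1 - 2 * omega)"
    unfolding area_def using cj_of_int[of "c * a"]
    by (simp add: cj_add cj_mult K_intros omega_K cj_omega del: of_int_mult) (simp add: algebra_simps)
  also have "1 - 2 * omega = - rD" by (simp add: omega_def field_simps)
  finally show ?thesis using n cab(1,2) rD_pos by (simp add: abs_mult)
qed

section \<open>The lattice of a form and the class groups\<close>

lemma cj_image_frac_ideal:
  assumes I: "I \<in> frac_ideals D" shows "cj ` I \<in> frac_ideals D"
proof -
  obtain x where x: "x \<in> I" "x \<noteq> 0" using frac_ideal_nonzero[OF I] by blast
  obtain d where d: "d \<in> \<O>" "d \<noteq> 0" "\<And>x. x \<in> I \<Longrightarrow> d * x \<in> \<O>" using frac_ideal_denominator[OF I] by blast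
  show ?thesis
  proof (rule frac_idealsI[of _ "cj x" "cj d"])
    show "cj ` I \<subseteq> K" using frac_idealD(1)[OF I] cj_K by blast
    show "cj x \<in> cj ` I" "cj x \<noteq> 0" using x frac_idealD(1)[OF I]
      by (auto simp: cj_eq_0_iff)
    show "a + b \<in> cj ` I" if "a \<in> cj ` I" "b \<in> cj ` I" for a b
      using that frac_idealD(1,2)[OF I] by (force simp flip: cj_add)
    show "r * a \<in> cj ` I" if r: "r \<in> \<O>" and a: "a \<in> cj ` I" for r a
    proof -
      obtain a' where a': "a' \<in> I" "a = cj a'" using a by blast
      have "r * a = cj (cj r * a')" using r a' frac_idealD(1)[OF I]
        by (simp add: cj_mult O_K cj_K cj_cj)
      thus ?thesis using frac_idealD(3)[OF I cj_O[OF r] a'(1)] by blast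
    qed
    show "cj d \<in> \<O>" "cj d \<noteq> 0" using d by (auto simp: cj_O cj_eq_0_iff O_K)
    show "cj d * a \<in> \<O>" if a: "a \<in> cj ` I" for a
    proof -
      obtain a' where a': "a' \<in> I" "a = cj a'" using a by blast
      have "cj d * a = cj (d * a')" using d(1) a' frac_idealD(1)[OF I] by (simp add: cj_mult O_K)
      thus ?thesis using cj_O[OF d(3)[OF a'(1)]] by simp
    qed
  qed
qed

definition root2 :: "int bqf \<Rightarrow> real" where
  "root2 Q = (- of_int (qB Q) - rD) / (2 * of_int (qA Q))"

lemma root1_K: "root1 Q \<in> K"
  unfolding root1_def by (intro K_divide K_add K_minus K_mult K_of_int K_rD K_of_int[of 2, simplified])

lemma cj_root1: "cj (root1 Q) = root2 Q"
proof -
  have "root1 Q = (of_int (- qB Q) + rD) / of_int (2 * qA Q)" by (simp add: root1_def)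
  also have "cj \<dots> = (cj (of_int (- qB Q)) + cj rD) / cj (of_int (2 * qA Q))"
    by (simp only: cj_divide cj_add K_intros)
  finally show ?thesis by (simp only: cj_of_int cj_rD) (simp add: root2_def)
qed

lemma root2_K: "root2 Q \<in> K" using cj_K[OF root1_K] by (simp add: cj_root1)

lemma root_facts:
  assumes disc: "bqf_disc Q = D"
  shows "of_int (qA Q) * (root1 Q + root2 Q) = - of_int (qB Q)"
    and "of_int (qA Q) * (root1 Q * root2 Q) = of_int (qC Q)"
    and "of_int (qA Q) * (root1 Q - root2 Q) = rD"
proof -
  note A = disc_A_nonzero[OF disc]
  show "of_int (qA Q) * (root1 Q + root2 Q) = - of_int (qB Q)"
    "of_int (qA Q) * (root1 Q - root2 Q) = rD"
    using A by (simp_all add: root1_def root2_def field_simps)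
  have "of_int D = ((of_int (qB Q))\<^sup>2 - 4 * of_int (qA Q) * of_int (qC Q) :: real)"
    using arg_cong[OF disc, of "of_int :: int \<Rightarrow> real"] by (simp add: bqf_disc_def)
  moreover have "(- of_int (qB Q) + rD) * (- of_int (qB Q) - rD) = (of_int (qB Q))\<^sup>2 - of_int D"
    by (simp add: algebra_simps power2_eq_square)
  ultimately have p: "(- of_int (qB Q) + rD) * (- of_int (qB Q) - rD) = 4 * of_int (qA Q) * of_int (qC Q)"
    by simp
  have "of_int (qA Q) * (root1 Q * root2 Q) =
      ((- of_int (qB Q) + rD) * (- of_int (qB Q) - rD)) / (4 * of_int (qA Q))"
    using A by (simp add: root1_def root2_def)
  thus "of_int (qA Q) * (root1 Q * root2 Q) = of_int (qC Q)"
    unfolding p using A by simp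
qed

lemma root1_quadratic:
  assumes disc: "bqf_disc Q = D"
  shows "of_int (qA Q) * (root1 Q * root1 Q) = - of_int (qB Q) * root1 Q - of_int (qC Q)"
proof -
  have "of_int (qA Q) * (root1 Q * root1 Q) =
      of_int (qA Q) * (root1 Q + root2 Q) * root1 Q - of_int (qA Q) * (root1 Q * root2 Q)"
    by (simp add: algebra_simps)
  thus ?thesis by (simp only: root_facts[OF disc])
qed

text \<open>
  With \<open>B = 2 k - 1\<close>, the number \<open>\<omega>\<close> is \<open>k + A w\<close>, and the equation of \<open>w\<close> expresses \<open>A w\<^sup>2\<close> by 1 and \<open>w\<close>.
\<close>

lemma omega_times_lat:
  assumes disc: "bqf_disc Q = D" shows "x \<in> lat Q \<Longrightarrow> omega * x \<in> lat Q"
proof -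
  obtain k where k: "qB Q = 2 * k - 1" using disc_B_odd[OF disc]
    by (metis add_diff_cancel_right' oddE diff_add_cancel dvd_def even_add odd_one)
  have omega: "omega = of_int k + of_int (qA Q) * root1 Q"
    using disc_A_nonzero[OF disc] by (simp add: omega_def root1_def k field_simps)
  have omw: "omega * root1 Q = of_int (- qC Q) + of_int (1 - k) * root1 Q"
    using root1_quadratic[OF disc] unfolding omega by (simp add: algebra_simps k)
  assume "x \<in> lat Q"
  then obtain m n where x: "x = of_int m * 1 + of_int n * root1 Q" unfolding lat_def
    by (rule zspanE)
  have "omega * x = of_int m * omega + of_int n * (omega * root1 Q)" by (simp add: x algebra_simps)
  also have "\<dots> = of_int (m * k - n * qC Q) * 1 + of_int (m * qA Q + n * (1 - k)) * root1 Q"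
    unfolding omw unfolding omega by (simp add: algebra_simps)
  finally show "omega * x \<in> lat Q" unfolding lat_def by (rule zspanI')
qed

lemma lat_K: "x \<in> lat Q \<Longrightarrow> x \<in> K"
  unfolding lat_def by (auto elim!: zspanE intro!: K_intros root1_K)

lemma A_lat_O:
  assumes disc: "bqf_disc Q = D" and "x \<in> lat Q"
  shows "of_int (qA Q) * x \<in> \<O>"
proof -
  obtain k where k: "qB Q = 2 * k - 1" using disc_B_odd[OF disc]
    by (metis add_diff_cancel_right' oddE diff_add_cancel dvd_def even_add odd_one)
  have Aw: "of_int (qA Q) * root1 Q = omega - of_int k"
    using disc_A_nonzero[OF disc] by (simp add: omega_def root1_def k field_simps)
  obtain m n where x: "x = of_int m * 1 + of_int n * root1 Q" using assms(2) unfolding lat_def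
    by (rule zspanE)
  have "of_int (qA Q) * x = of_int (qA Q * m) + of_int n * (of_int (qA Q) * root1 Q)"
    by (simp add: x algebra_simps)
  also have "\<dots> = of_int (qA Q * m - n * k) + of_int n * omega" unfolding Aw
    by (simp add: algebra_simps)
  finally show ?thesis by (simp only: O_I)
qed

lemma lat_frac_ideal:
  assumes disc: "bqf_disc Q = D" shows "lat Q \<in> frac_ideals D"
proof (rule frac_idealsI[of _ 1 "of_int (qA Q)"])
  show "lat Q \<subseteq> K" using lat_K by blast
  show "1 \<in> lat Q" unfolding lat_def by (rule zspan_basis)
  show "x + y \<in> lat Q" if "x \<in> lat Q" "y \<in> lat Q" for x y using that unfolding lat_def
    by (rule zspan_add)
  show "r * x \<in> lat Q" if r: "r \<in> \<O>" and x: "x \<in> lat Q" for r x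
  proof -
    obtain m n where "r = of_int m + of_int n * omega" using r by (rule O_E)
    hence "r * x = of_int m * x + of_int n * (omega * x)" by (simp add: algebra_simps)
    thus ?thesis using x omega_times_lat[OF disc x] unfolding lat_def
      by (auto intro: zspan_add zspan_of_int_mult)
  qed
  show "of_int (qA Q) \<in> \<O>" by (rule O_of_int)
qed (use disc_A_nonzero[OF disc] A_lat_O[OF disc] in auto)

lemma cj_lat: "cj ` lat Q = zspan 1 (root2 Q)"
proof -
  have "cj (of_int m * 1 + of_int n * root1 Q) = of_int m * 1 + of_int n * root2 Q" for m n
    by (simp add: cj_add cj_mult K_intros root1_K cj_root1)
  thus ?thesis unfolding lat_def zspan_def by (force simp: image_iff)
qed

text \<open>
  The product is generated by \<open>1, w, w'\<close> and \<open>w w' = C/A\<close>, all of which lie in \<open>(1/A) \<O>\<close>. It contains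
  \<open>A/A\<close>, \<open>B/A = - (w + w')\<close> and \<open>C/A\<close>, hence \<open>1/A\<close>, because the coefficients are coprime.
\<close>

lemma lat_times_conjugate:
  assumes disc: "bqf_disc Q = D"
  shows "ideal_mult (lat Q) (cj ` lat Q) = smul (1 / of_int (qA Q)) \<O>"
proof -
  note A = disc_A_nonzero[OF disc]
  define L where "L = ideal_mult (lat Q) (cj ` lat Q)"
  have L: "L \<in> frac_ideals D" unfolding L_def
    by (intro ideal_mult_frac_ideal lat_frac_ideal cj_image_frac_ideal disc)
  have "L \<subseteq> smul (1 / of_int (qA Q)) \<O>" unfolding L_def
  proof (rule ideal_mult_subset)
    fix a b assume "a \<in> lat Q" "b \<in> cj ` lat Q"
    then obtain m n m' n' where ab: "a = of_int m * 1 + of_int n * root1 Q" "b = of_int m' * 1 + of_int n' * root2 Q"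
      unfolding cj_lat unfolding lat_def by (elim zspanE) blast
    have w2: "of_int (qA Q) * root2 Q = - of_int (qB Q) - of_int (qA Q) * root1 Q"
      using root_facts(1)[OF disc] by (simp add: algebra_simps)
    have "of_int (qA Q) * (a * b) = of_int (qA Q * m * m') + of_int (m * n') * (of_int (qA Q) * root2 Q) +
        of_int (n * m') * (of_int (qA Q) * root1 Q) + of_int (n * n') * (of_int (qA Q) * (root1 Q * root2 Q))"
      by (simp add: ab algebra_simps)
    also have "\<dots> \<in> \<O>"
    proof -
      define W where "W = of_int (qA Q) * root1 Q"
      have W: "W \<in> \<O>"
        using A_lat_O[OF disc, of "root1 Q"] by (simp add: W_def lat_def zspan_basis)
      show ?thesis unfolding w2 root_facts(2)[OF disc] unfolding W_def[symmetric]
        by (intro O_add O_mult O_of_int O_diff O_minus W)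
    qed
    finally show "a * b \<in> smul (1 / of_int (qA Q)) \<O>" using A
      by (simp add: in_smul_iff mult.commute)
  qed (use A in \<open>auto simp: in_smul_iff O_0 distrib_right intro: O_add\<close>)
  moreover have "smul (1 / of_int (qA Q)) \<O> \<subseteq> L"
  proof -
    have 1: "1 \<in> lat Q" "root1 Q \<in> lat Q" "1 \<in> cj ` lat Q" "root2 Q \<in> cj ` lat Q"
      unfolding cj_lat unfolding lat_def by (auto intro: zspan_basis)
    have p: "1 \<in> L" "root1 Q \<in> L" "root2 Q \<in> L" "root1 Q * root2 Q \<in> L"
      using ideal_multI[OF 1(1) 1(3)] ideal_multI[OF 1(2) 1(3)] ideal_multI[OF 1(1) 1(4)] ideal_multI[OF 1(2) 1(4)]
      unfolding L_def by auto
    define A' where "A' = (of_int (qA Q) :: real)"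
    have mA: "1 / A' * of_int (qA Q) \<in> L" "1 / A' * of_int (qB Q) \<in> L" "1 / A' * of_int (qC Q) \<in> L"
    proof -
      show "1 / A' * of_int (qA Q) \<in> L" using p(1) A by (simp add: A'_def)
      have "1 / A' * of_int (qB Q) = - (root1 Q + root2 Q)"
        using root_facts(1)[OF disc] A by (simp add: A'_def field_simps)
      moreover have "root1 Q + root2 Q \<in> L" by (rule frac_idealD(2)[OF L p(2,3)])
      ultimately show "1 / A' * of_int (qB Q) \<in> L" using frac_idealD(5)[OF L] by (simp only:)
      have "1 / A' * of_int (qC Q) = root1 Q * root2 Q"
        using root_facts(2)[OF disc] A by (simp add: A'_def field_simps)
      thus "1 / A' * of_int (qC Q) \<in> L" using p(4) by simp
    qed
    have comb: "1 / A' * of_int (gcd x y) \<in> L" if xy: "1 / A' * of_int x \<in> L" "1 / A' * of_int y \<in> L" for x y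
    proof -
      obtain u v where "u * x + v * y = gcd x y" using bezout_int by blast
      hence g: "(of_int (gcd x y) :: real) = of_int u * of_int x + of_int v * of_int y"
        by (metis of_int_add of_int_mult)
      have "1 / A' * of_int (gcd x y) = of_int u * (1 / A' * of_int x) + of_int v * (1 / A' * of_int y)"
        unfolding g by (simp add: algebra_simps)
      moreover have "of_int u * (1 / A' * of_int x) + of_int v * (1 / A' * of_int y) \<in> L"
        by (intro frac_idealD(2,6)[OF L] xy)
      ultimately show ?thesis by (simp only:)
    qed
    have "1 / A' \<in> L" using comb[OF mA(1) comb[OF mA(2,3)]] disc_primitive[OF disc] by simp
    hence "r * (1 / A') \<in> L" if "r \<in> \<O>" for r using frac_idealD(3)[OF L that] by blast
    thus ?thesis unfolding smul_def A'_def by (auto simp only: mult.commute)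
  qed
  ultimately show ?thesis unfolding L_def by blast
qed

lemma frac_ideal_inverse:
  assumes I: "I \<in> frac_ideals D"
  obtains J where "J \<in> frac_ideals D" "ideal_mult J I = \<O>"
proof -
  obtain Q y where Q: "bqf_disc Q = D" "y \<in> K" "y \<noteq> 0" "form_ideal D Q y = I"
    using frac_ideal_eq_form_ideal[OF I] by metis
  note A = disc_A_nonzero[OF Q(1)]
  define c where "c = 2 * of_int (qA Q) * y"
  have c: "c \<in> K" "c \<noteq> 0" using A Q K_mult[OF K_of_int[of "2 * qA Q"] Q(2)]
    by (auto simp: c_def)
  have I_eq: "I = smul c (lat Q)" using form_ideal_eq[OF Q(1), of y] Q(4) by (simp add: c_def)
  define J where "J = smul (of_int (qA Q) / c) (cj ` lat Q)"
  have "J \<in> frac_ideals D" unfolding J_def using c A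
    by (intro smul_frac_ideal cj_image_frac_ideal lat_frac_ideal Q K_intros) auto
  moreover have "ideal_mult J I = smul (of_int (qA Q) / c * c * (1 / of_int (qA Q))) \<O>"
    unfolding J_def I_eq smul_ideal_mult
    by (subst ideal_mult_commute, subst smul_ideal_mult)
       (simp add: lat_times_conjugate[OF Q(1)] smul_smul mult.assoc)
  hence "ideal_mult J I = \<O>" using c A by simp
  ultimately show ?thesis using that by blast
qed

lemma comm_group_ideals: "comm_group (ideal_group D)"
proof (rule comm_groupI)
  fix x assume "x \<in> carrier (ideal_group D)"
  hence x: "x \<in> frac_ideals D" by (simp add: ideal_group_def)
  show "\<exists>y\<in>carrier (ideal_group D). y \<otimes>\<^bsub>ideal_group D\<^esub> x = \<one>\<^bsub>ideal_group D\<^esub>"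
    using frac_ideal_inverse[OF x] by (auto simp: ideal_group_def)
  show "\<one>\<^bsub>ideal_group D\<^esub> \<otimes>\<^bsub>ideal_group D\<^esub> x = x"
    using x by (simp add: ideal_group_def ideal_mult_one)
next
  fix x y
  show "x \<otimes>\<^bsub>ideal_group D\<^esub> y = y \<otimes>\<^bsub>ideal_group D\<^esub> x"
    by (simp add: ideal_group_def ideal_mult_commute[of x y])
qed (simp_all add: ideal_group_def ideal_mult_frac_ideal O_frac_ideal ideal_mult_assoc)

text \<open>
  The classes are cosets of groups of principal ideals. It is convenient to view them as the sets of all
  multiples of one ideal.
\<close>

definition wide_class :: "real set \<Rightarrow> real set set" where
  "wide_class I = {smul x I | x. x \<in> K \<and> x \<noteq> 0}"

definition narrow_class :: "real set \<Rightarrow> real set set" where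
  "narrow_class I = {smul x I | x. x \<in> K \<and> x * cj x > 0}"

lemma smul_eq_principal_mult:
  assumes "I \<in> frac_ideals D" shows "ideal_mult (smul x \<O>) I = smul x I"
  using assms by (simp add: smul_ideal_mult ideal_mult_one)

lemma wide_class_coset:
  assumes "I \<in> frac_ideals D"
  shows "principal_ideals D #>\<^bsub>ideal_group D\<^esub> I = wide_class I"
  unfolding r_coset_def wide_class_def principal_ideals_def
  using smul_eq_principal_mult[OF assms]
  by (auto simp: ideal_group_def principal_ideal_smul)

lemma quad_norm_pos_iff: "x \<in> K \<Longrightarrow> quad_norm D x > 0 \<longleftrightarrow> x * cj x > 0"
  by (metis of_rat_quad_norm of_rat_0 of_rat_less)

lemma narrow_class_coset:
  assumes "I \<in> frac_ideals D"
  shows "pos_principal_ideals D #>\<^bsub>ideal_group D\<^esub> I = narrow_class I"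
proof -
  have "pos_principal_ideals D #>\<^bsub>ideal_group D\<^esub> I =
      {ideal_mult (smul x \<O>) I | x. x \<in> K \<and> quad_norm D x > 0}"
    unfolding r_coset_def pos_principal_ideals_def
      by (auto simp: ideal_group_def principal_ideal_smul)
  also have "\<dots> = narrow_class I"
    unfolding narrow_class_def smul_eq_principal_mult[OF assms] using quad_norm_pos_iff by blast
  finally show ?thesis .
qed

lemma subgroup_principal: "subgroup (principal_ideals D) (ideal_group D)"
proof -
  interpret comm_group "ideal_group D" by (rule comm_group_ideals)
  have mult: "smul x \<O> \<otimes>\<^bsub>ideal_group D\<^esub> smul y \<O> = smul (x * y) \<O>"
    if "y \<in> K" "y \<noteq> 0" for x y
    using smul_eq_principal_mult[OF smul_frac_ideal[OF O_frac_ideal that]]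
    by (simp add: ideal_group_def smul_smul)
  show ?thesis
  proof (rule subgroupI)
    show "principal_ideals D \<subseteq> carrier (ideal_group D)"
      by (auto simp: principal_ideals_def principal_ideal_smul ideal_group_def intro!: smul_frac_ideal O_frac_ideal)
    show "principal_ideals D \<noteq> {}" using K_1 by (auto simp: principal_ideals_def)
  next
    fix a assume "a \<in> principal_ideals D"
    then obtain x where x: "x \<in> K" "x \<noteq> 0" "a = smul x \<O>"
      by (auto simp: principal_ideals_def principal_ideal_smul)
    have "inv\<^bsub>ideal_group D\<^esub> a = smul (inverse x) \<O>"
    proof (rule inv_equality)
      show "smul (inverse x) \<O> \<otimes>\<^bsub>ideal_group D\<^esub> a = \<one>\<^bsub>ideal_group D\<^esub>"
        unfolding x(3) mult[OF x(1,2)] using x(2) by (simp add: ideal_group_def)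
    qed (use x in \<open>auto simp: ideal_group_def intro!: smul_frac_ideal O_frac_ideal K_intros\<close>)
    thus "inv\<^bsub>ideal_group D\<^esub> a \<in> principal_ideals D"
      using x by (auto simp: principal_ideals_def principal_ideal_smul intro!: exI[of _ "inverse x"] K_intros)
  next
    fix a b assume "a \<in> principal_ideals D" "b \<in> principal_ideals D"
    then obtain x y where xy: "x \<in> K" "x \<noteq> 0" "a = smul x \<O>" "y \<in> K" "y \<noteq> 0" "b = smul y \<O>"
      by (auto simp: principal_ideals_def principal_ideal_smul)
    thus "a \<otimes>\<^bsub>ideal_group D\<^esub> b \<in> principal_ideals D"
      by (auto simp: mult principal_ideals_def principal_ideal_smul intro!: exI[of _ "x * y"] K_intros)
  qed
qed

lemma normal_principal: "normal (principal_ideals D) (ideal_group D)"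
  using comm_group.normal_iff_subgroup[OF comm_group_ideals] subgroup_principal by blast

lemma group_wide: "group (wide_class_group D)"
  unfolding wide_class_group_def by (rule normal.factorgroup_is_group[OF normal_principal])

lemma carrier_wide: "carrier (wide_class_group D) = wide_class ` frac_ideals D"
proof -
  have "carrier (wide_class_group D) = (\<lambda>I. principal_ideals D #>\<^bsub>ideal_group D\<^esub> I) ` frac_ideals D"
    by (auto simp: wide_class_group_def FactGroup_def RCOSETS_def ideal_group_def)
  thus ?thesis using wide_class_coset by (auto simp: image_iff)
qed

lemma carrier_narrow: "carrier (narrow_class_group D) = narrow_class ` frac_ideals D"
proof -
  have "carrier (narrow_class_group D) = (\<lambda>I. pos_principal_ideals D #>\<^bsub>ideal_group D\<^esub> I) ` frac_ideals D"
    by (auto simp: narrow_class_group_def FactGroup_def RCOSETS_def ideal_group_def)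
  thus ?thesis using narrow_class_coset by (auto simp: image_iff)
qed

lemma narrow_class_self: "I \<in> narrow_class I"
  unfolding narrow_class_def using K_1 by (auto intro!: exI[of _ 1])

lemma wide_class_smul:
  assumes "x \<in> K" "x \<noteq> 0" shows "wide_class (smul x I) = wide_class I"
proof -
  have "smul y (smul x I) \<in> wide_class I" if y: "y \<in> K" "y \<noteq> 0" for y
  proof -
    have "y * x \<in> K" "y * x \<noteq> 0" using y assms by (auto intro: K_mult)
    thus ?thesis unfolding wide_class_def smul_smul by blast
  qed
  moreover have "smul y I \<in> wide_class (smul x I)" if y: "y \<in> K" "y \<noteq> 0" for y
  proof -
    have "smul y I = smul (y / x) (smul x I)" using assms by (simp add: smul_smul)
    moreover have "y / x \<in> K" "y / x \<noteq> 0" using y assms by (auto intro: K_divide)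
    ultimately show ?thesis unfolding wide_class_def by blast
  qed
  ultimately show ?thesis unfolding wide_class_def by blast
qed

lemma narrow_class_smul:
  assumes x: "x \<in> K" "x * cj x > 0" shows "narrow_class (smul x I) = narrow_class I"
proof -
  have x0: "x \<noteq> 0" using x(2) by auto
  have "smul y (smul x I) \<in> narrow_class I" if y: "y \<in> K" "y * cj y > 0" for y
  proof -
    have "(y * x) * cj (y * x) = (y * cj y) * (x * cj x)" using x y by (simp add: cj_mult)
    hence "(y * x) * cj (y * x) > 0" using mult_pos_pos[OF y(2) x(2)] by (simp only:)
    thus ?thesis unfolding narrow_class_def smul_smul using K_mult[OF y(1) x(1)] by blast
  qed
  moreover have "smul y I \<in> narrow_class (smul x I)" if y: "y \<in> K" "y * cj y > 0" for y
  proof -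
    have "smul y I = smul (y / x) (smul x I)" using x0 by (simp add: smul_smul)
    moreover have "(y / x) * cj (y / x) = (y * cj y) / (x * cj x)" using x y
      by (simp add: cj_divide)
    hence "(y / x) * cj (y / x) > 0" using divide_pos_pos[OF y(2) x(2)] by (simp only:)
    ultimately show ?thesis unfolding narrow_class_def using K_divide[OF y(1) x(1)] by blast
  qed
  ultimately show ?thesis unfolding narrow_class_def by blast
qed

text \<open>
  The product of the lattice and its conjugate is principal.
\<close>

lemma wide_class_inv:
  assumes disc: "bqf_disc Q = D"
  shows "inv\<^bsub>wide_class_group D\<^esub> (wide_class (lat Q)) = wide_class (cj ` lat Q)"
    and "inv\<^bsub>wide_class_group D\<^esub> (wide_class (cj ` lat Q)) = wide_class (lat Q)"
proof -
  interpret group "wide_class_group D" by (rule group_wide)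
  note A = disc_A_nonzero[OF disc]
  have L: "lat Q \<in> frac_ideals D" "cj ` lat Q \<in> frac_ideals D"
    by (auto intro: lat_frac_ideal cj_image_frac_ideal disc)
  have c: "wide_class (lat Q) \<in> carrier (wide_class_group D)" "wide_class (cj ` lat Q) \<in> carrier (wide_class_group D)"
    unfolding carrier_wide using L by auto
  have "wide_class (cj ` lat Q) \<otimes>\<^bsub>wide_class_group D\<^esub> wide_class (lat Q) =
     (principal_ideals D #>\<^bsub>ideal_group D\<^esub> (cj ` lat Q)) <#>\<^bsub>ideal_group D\<^esub> (principal_ideals D #>\<^bsub>ideal_group D\<^esub> (lat Q))"
    by (simp add: wide_class_coset[OF L(1)] wide_class_coset[OF L(2)] wide_class_group_def FactGroup_def)
  also have "\<dots> = principal_ideals D #>\<^bsub>ideal_group D\<^esub> ideal_mult (cj ` lat Q) (lat Q)"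
    using normal.rcos_sum[OF normal_principal, of "cj ` lat Q" "lat Q"] L
      by (simp add: ideal_group_def)
  also have "ideal_mult (cj ` lat Q) (lat Q) = smul (1 / of_int (qA Q)) \<O>"
    using lat_times_conjugate[OF disc] by (simp add: ideal_mult_commute)
  also have "principal_ideals D #>\<^bsub>ideal_group D\<^esub> smul (1 / of_int (qA Q)) \<O> = wide_class (smul (1 / of_int (qA Q)) \<O>)"
    using A by (intro wide_class_coset smul_frac_ideal O_frac_ideal K_intros) auto
  also have "\<dots> = wide_class \<O>" using A by (intro wide_class_smul K_intros) auto
  also have "\<dots> = \<one>\<^bsub>wide_class_group D\<^esub>"
    by (auto simp: wide_class_def wide_class_group_def FactGroup_def principal_ideals_def principal_ideal_smul)
  finally have eq: "wide_class (cj ` lat Q) \<otimes>\<^bsub>wide_class_group D\<^esub> wide_class (lat Q) = \<one>\<^bsub>wide_class_group D\<^esub>" .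
  show i: "inv\<^bsub>wide_class_group D\<^esub> (wide_class (lat Q)) = wide_class (cj ` lat Q)"
    by (rule inv_equality[OF eq c])
  show "inv\<^bsub>wide_class_group D\<^esub> (wide_class (cj ` lat Q)) = wide_class (lat Q)"
    using inv_inv[OF c(1)] unfolding i .
qed

lemma form_of_class:
  assumes \<alpha>: "\<alpha> \<in> carrier (wide_class_group D)"
  obtains Q where "bqf_disc Q = D" "\<alpha> = wide_class (lat Q)"
proof -
  obtain I where I: "I \<in> frac_ideals D" "\<alpha> = wide_class I" using \<alpha>
    unfolding carrier_wide by blast
  obtain Q y where Q: "bqf_disc Q = D" "y \<in> K" "y \<noteq> 0" "form_ideal D Q y = I"
    using frac_ideal_eq_form_ideal[OF I(1)] by metis
  have "2 * of_int (qA Q) * y \<in> K" "2 * of_int (qA Q) * y \<noteq> 0"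
    using disc_A_nonzero[OF Q(1)] Q K_mult[OF K_of_int[of "2 * qA Q"] Q(2)] by auto
  hence "\<alpha> = wide_class (lat Q)"
    unfolding I(2) Q(4)[symmetric] form_ideal_eq[OF Q(1)] by (rule wide_class_smul)
  thus ?thesis using that Q(1) by blast
qed

lemma wide_class_eq:
  assumes "I \<in> wide_class J" shows "wide_class I = wide_class J"
proof -
  obtain x where "I = smul x J" "x \<in> K" "x \<noteq> 0" using assms
    by (auto simp: wide_class_def)
  thus ?thesis using wide_class_smul by simp
qed

definition unit_set :: "real set" where
  "unit_set = {u \<in> \<O>. \<bar>u * cj u\<bar> = 1}"

lemma unit_set_inverse: "u \<in> unit_set \<Longrightarrow> inverse u \<in> \<O>"
proof -
  assume u: "u \<in> unit_set"
  hence "u * cj u = 1 \<or> u * (- cj u) = 1" by (auto simp: unit_set_def abs_if split: if_splits)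
  hence "inverse u = cj u \<or> inverse u = - cj u" by (metis inverse_unique)
  thus ?thesis using u cj_O O_minus by (auto simp: unit_set_def)
qed

lemma smul_O_eq_iff:
  assumes u: "u \<in> K" "u \<noteq> 0"
  shows "smul u \<O> = \<O> \<longleftrightarrow> u \<in> unit_set"
proof
  assume eq: "smul u \<O> = \<O>"
  have "u * 1 \<in> smul u \<O>" unfolding smul_def using O_1 by blast
  hence uO: "u \<in> \<O>" using eq by simp
  have "1 \<in> smul u \<O>" using eq O_1 by simp
  hence "1 / u \<in> \<O>" using in_smul_iff[OF u(2)] by blast
  then obtain b where b: "(1 / u) * cj (1 / u) = of_int b" by (rule O_norm_int)
  obtain a where a: "u * cj u = of_int a" using uO by (rule O_norm_int)
  have "of_int (a * b) = (u * cj u) * ((1 / u) * cj (1 / u))" unfolding a b by simp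
  also have "\<dots> = 1" using u by (simp add: cj_divide K_1 cj_eq_0_iff)
  finally have "a * b = 1" by (metis of_int_1 of_int_eq_iff)
  hence "\<bar>a\<bar> = 1" by (metis abs_zmult_eq_1 abs_1)
  hence "\<bar>of_int a\<bar> = (1::real)" by (metis of_int_1 of_int_abs)
  thus "u \<in> unit_set" using uO a by (simp add: unit_set_def)
next
  assume U: "u \<in> unit_set"
  hence uO: "u \<in> \<O>" by (simp add: unit_set_def)
  have "smul u \<O> \<subseteq> \<O>" using O_mult[OF uO] by (auto simp: smul_def)
  moreover have "r / u \<in> \<O>" if "r \<in> \<O>" for r
    using O_mult[OF that unit_set_inverse[OF U]] by (simp add: divide_inverse)
  hence "\<O> \<subseteq> smul u \<O>" using in_smul_iff[OF u(2)] by blast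
  ultimately show "smul u \<O> = \<O>" by blast
qed

text \<open>
  Ideals being invertible, the ideal \<open>I\<close> can be cancelled.
\<close>

lemma smul_eq_iff:
  assumes I: "I \<in> frac_ideals D" and x: "x \<in> K" "x \<noteq> 0" and y: "y \<in> K" "y \<noteq> 0"
  shows "smul x I = smul y I \<longleftrightarrow> x / y \<in> unit_set"
proof -
  obtain J where J: "J \<in> frac_ideals D" "ideal_mult J I = \<O>" using frac_ideal_inverse[OF I]
    by blast
  have "smul x I = smul y I \<longleftrightarrow> smul (x / y) \<O> = \<O>"
  proof
    assume "smul x I = smul y I"
    hence "smul (inverse y) (ideal_mult (smul x I) J) = smul (inverse y) (ideal_mult (smul y I) J)" by simp
    thus "smul (x / y) \<O> = \<O>" unfolding smul_ideal_mult smul_smul using y J(2)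
      by (simp add: ideal_mult_commute[of I] divide_inverse mult.commute)
  next
    assume "smul (x / y) \<O> = \<O>"
    hence "smul y (ideal_mult (smul (x / y) \<O>) I) = smul y (ideal_mult \<O> I)" by simp
    thus "smul x I = smul y I" using y
      by (simp add: smul_eq_principal_mult[OF I] ideal_mult_one[OF I] smul_smul)
  qed
  also have "\<dots> \<longleftrightarrow> x / y \<in> unit_set" using x y
    by (intro smul_O_eq_iff K_divide) auto
  finally show ?thesis .
qed

definition has_negative_unit :: bool where
  "has_negative_unit \<longleftrightarrow> (\<exists>u\<in>\<O>. u * cj u = - 1)"

text \<open>
  Multiplication by \<open>\<surd>D\<close> reverses the sign of the norm, since the norm of \<open>\<surd>D\<close> is \<open>- D\<close>.
\<close>

lemma narrow_classes_in_wide: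
  assumes I: "I \<in> frac_ideals D"
  shows "{\<beta> \<in> carrier (narrow_class_group D). \<beta> \<subseteq> wide_class I} = {narrow_class I, narrow_class (smul rD I)}"
proof (intro equalityI subsetI)
  fix \<beta> assume "\<beta> \<in> {narrow_class I, narrow_class (smul rD I)}"
  moreover have "smul rD I \<in> frac_ideals D" using rD_pos by (intro smul_frac_ideal I K_rD) auto
  moreover have sub: "narrow_class I \<subseteq> wide_class I" for I
  proof
    fix J assume "J \<in> narrow_class I"
    then obtain x where x: "J = smul x I" "x \<in> K" "x * cj x > 0" unfolding narrow_class_def
      by blast
    have "x \<noteq> 0" using x(3) by auto
    thus "J \<in> wide_class I" unfolding wide_class_def using x(1,2) by blast
  qed
  moreover have "narrow_class (smul rD I) \<subseteq> wide_class I"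
    using sub[of "smul rD I"] wide_class_smul[OF K_rD, of I] rD_pos by auto
  ultimately show "\<beta> \<in> {\<beta> \<in> carrier (narrow_class_group D). \<beta> \<subseteq> wide_class I}"
    unfolding carrier_narrow using I by auto
next
  fix \<beta> assume "\<beta> \<in> {\<beta> \<in> carrier (narrow_class_group D). \<beta> \<subseteq> wide_class I}"
  then obtain J where J: "\<beta> = narrow_class J" "\<beta> \<subseteq> wide_class I"
    unfolding carrier_narrow by blast
  have "J \<in> wide_class I" using narrow_class_self J by blast
  then obtain x where x: "J = smul x I" "x \<in> K" "x \<noteq> 0" unfolding wide_class_def by blast
  show "\<beta> \<in> {narrow_class I, narrow_class (smul rD I)}"
  proof (cases "x * cj x > 0")
    case True
    thus ?thesis using narrow_class_smul[OF x(2)] J(1) x(1) by simp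
  next
    case False
    have "x * cj x \<noteq> 0" using norm_eq_0_iff[OF x(2)] x(3) by simp
    hence neg: "x * cj x < 0" using False by linarith
    \<comment> \<open>Now \<open>x\<close> and \<open>\<surd>D\<close> both have negative norm.\<close>
    define z where "z = x / rD"
    have zK: "z \<in> K" unfolding z_def by (intro K_divide x K_rD)
    have "z * cj z = - (x * cj x) / of_int D"
      using x by (simp add: z_def cj_divide K_rD)
    hence "z * cj z > 0" using neg D_gt_1 by (simp add: divide_neg_pos)
    moreover have "J = smul z (smul rD I)" using rD_pos by (simp add: x(1) z_def smul_smul)
    ultimately have "\<beta> = narrow_class (smul rD I)" using narrow_class_smul[OF zK] J(1) by simp
    thus ?thesis by simp
  qed
qed

text \<open>
  The ideals \<open>\<surd>D I\<close> and \<open>x I\<close> agree exactly if \<open>\<surd>D/x\<close> is a unit, and for \<open>x\<close> of positive norm this unit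
  has negative norm.
\<close>

lemma narrow_class_eq_iff:
  assumes I: "I \<in> frac_ideals D"
  shows "narrow_class I = narrow_class (smul rD I) \<longleftrightarrow> has_negative_unit"
proof
  assume "narrow_class I = narrow_class (smul rD I)"
  hence "smul rD I \<in> narrow_class I" using narrow_class_self by blast
  then obtain x where x: "smul rD I = smul x I" "x \<in> K" "x * cj x > 0"
    unfolding narrow_class_def by blast
  have x0: "x \<noteq> 0" using x(3) by auto
  define u where "u = rD / x"
  have u: "u \<in> unit_set" unfolding u_def using smul_eq_iff[OF I K_rD _ x(2) x0] x(1) rD_pos
    by auto
  have "u * cj u = - of_int D / (x * cj x)" using x by (simp add: u_def cj_divide K_rD)
  hence "u * cj u < 0" using x(3) D_gt_1 by (simp add: divide_neg_pos)
  hence "u * cj u = - 1" using u by (simp add: unit_set_def)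
  thus has_negative_unit using u unfolding has_negative_unit_def unit_set_def by blast
next
  assume has_negative_unit
  then obtain u where u: "u \<in> \<O>" "u * cj u = - 1" unfolding has_negative_unit_def by blast
  have u0: "u \<noteq> 0" and uK: "u \<in> K" using u O_K by auto
  have "u \<in> unit_set" using u by (simp add: unit_set_def)
  define z where "z = rD * u"
  have zK: "z \<in> K" unfolding z_def by (intro K_mult K_rD uK)
  have "z * cj z = (rD * cj rD) * (u * cj u)" unfolding z_def by (simp add: cj_mult K_rD uK)
  hence zp: "z * cj z > 0" unfolding u(2) using D_gt_1 by simp
  have "smul z I = smul rD I"
    using smul_eq_iff[OF I zK _ K_rD] \<open>u \<in> unit_set\<close> rD_pos u0 by (simp add: z_def)
  thus "narrow_class I = narrow_class (smul rD I)" using narrow_class_smul[OF zK zp, of I] by simp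
qed

section \<open>Lattice sums modulo units and the zeta function of a class\<close>

text \<open>
  The translation of the kernel that belongs to the point \<open>x\<close> of the lattice.
\<close>

definition ratio_log :: "real \<Rightarrow> real" where
  "ratio_log x = ln \<bar>cj x / x\<bar>"

definition period :: real where
  "period = 2 * ln eps"

text \<open>
  One point from each orbit under multiplication by powers of \<open>\<epsilon>\<close>.
\<close>

definition unit_domain :: "real set \<Rightarrow> real set" where
  "unit_domain L = {x \<in> L. x \<noteq> 0 \<and> 0 \<le> ratio_log x \<and> ratio_log x < period}"

text \<open>
  For \<open>x = c w + d\<close> this is \<open>\<bar>Q(d, -c)\<bar>\<close>, the absolute value of the first coefficient of \<open>gQ\<close> for every
  \<open>g\<close> with bottom row \<open>(c, d)\<close>.
\<close>

abbreviation form_value :: "int bqf \<Rightarrow> real \<Rightarrow> real" where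
  "form_value Q x \<equiv> \<bar>of_int (qA Q) * (x * cj x)\<bar>"

lemma period_pos: "period > 0"
  using eps_gt_1 by (simp add: period_def)

lemma ratio_log_mult:
  assumes "x \<in> K" "x \<noteq> 0" "y \<in> K" "y \<noteq> 0"
  shows "ratio_log (x * y) = ratio_log x + ratio_log y"
proof -
  have "\<bar>cj (x * y) / (x * y)\<bar> = \<bar>cj x / x\<bar> * \<bar>cj y / y\<bar>"
    using assms by (simp add: cj_mult abs_mult)
  moreover have "\<bar>cj x / x\<bar> > 0" "\<bar>cj y / y\<bar> > 0" using assms
    by (simp_all add: cj_eq_0_iff)
  ultimately show ?thesis unfolding ratio_log_def by (simp only: ln_mult) auto
qed

lemma ratio_log_eps_powi: "ratio_log (eps powi n) = - period * of_int n"
proof -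
  have e: "eps > 0" using eps_gt_1 by simp
  have "ratio_log (eps powi n) = ln (eps powi (- n) / eps powi n)"
    unfolding ratio_log_def cj_eps_powi using e by simp
  also have "\<dots> = ln (eps powi (- n)) - ln (eps powi n)" using e by (simp add: ln_div)
  finally have "ratio_log (eps powi n) = ln (eps powi (- n)) - ln (eps powi n)" .
  moreover have "ln (eps powi m) = of_int m * ln eps" for m
    using e by (simp add: ln_powr flip: powr_real_of_int')
  ultimately show ?thesis by (simp only: period_def) simp
qed

lemma eps_powi_K: "eps powi n \<in> K" by (rule O_K[OF eps_powi_O])

text \<open>
  The number of units modulo powers of \<open>\<epsilon>\<close>.
\<close>

definition unit_index :: nat where
  "unit_index = (if has_negative_unit then 4 else 2)"

text \<open>
  Representatives are distinguished by their sign and by the sign of their norm, neither of which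
  changes under multiplication by a power of \<open>\<epsilon>\<close>.
\<close>

lemma unit_representatives:
  obtains R where "card R = unit_index" "finite R" "R \<subseteq> unit_set"
    "inj_on (\<lambda>u. (sgn u, sgn (u * cj u))) R"
    "\<And>v. v \<in> unit_set \<Longrightarrow> \<exists>u\<in>R. \<exists>k. v = u * eps powi k"
proof (cases has_negative_unit)
  case True
  then obtain e where e: "e \<in> \<O>" "e * cj e = - 1" by (auto simp: has_negative_unit_def)
  have e0: "e \<noteq> 0" using e(2) by auto
  have eK: "e \<in> K" by (rule O_K[OF e(1)])
  define R where "R = {1, - 1, e, - e}"
  have me: "- e * cj (- e) = - 1" "(- 1) * cj (- 1) = 1" "1 * cj 1 = (1::real)"
    using e(2) eK K_1 cj_minus[OF K_1] by (simp_all add: cj_minus)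
  have inj: "inj_on (\<lambda>u. (sgn u, sgn (u * cj u))) R"
    unfolding R_def using e0 e(2) me by (auto simp: inj_on_def sgn_if)
  have ne: "e \<noteq> 1" "e \<noteq> - 1" using e(2) me by auto
  hence card: "card R = 4" using e0 by (auto simp: R_def)
  show ?thesis
  proof (rule that[of R])
    show "card R = unit_index" using card True by (simp add: unit_index_def)
    show "R \<subseteq> unit_set" unfolding R_def unit_set_def
      using e me O_1 O_minus[OF O_1] O_minus[OF e(1)] by auto
    show "\<exists>u\<in>R. \<exists>k. v = u * eps powi k" if v: "v \<in> unit_set" for v
    proof -
      have vO: "v \<in> \<O>" and "\<bar>v * cj v\<bar> = 1" using v by (auto simp: unit_set_def)
      then consider "v * cj v = 1" | "v * cj v = - 1" by (auto simp: abs_if split: if_splits)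
      thus ?thesis
      proof cases
        case 1
        then obtain k where "v = eps powi k \<or> v = - (eps powi k)" using norm_one_unit[OF vO]
          by blast
        hence "v = 1 * eps powi k \<or> v = - 1 * eps powi k" by simp
        thus ?thesis unfolding R_def by blast
      next
        case 2
        have "e \<in> unit_set" using e by (simp add: unit_set_def)
        hence ie: "inverse e \<in> \<O>" by (rule unit_set_inverse)
        have wO: "v * inverse e \<in> \<O>" by (rule O_mult[OF vO ie])
        have "(v * inverse e) * cj (v * inverse e) = (v * cj v) / (e * cj e)"
          using vO e(1) by (simp add: cj_mult cj_inverse O_K K_inverse divide_inverse)
        hence "(v * inverse e) * cj (v * inverse e) = 1" unfolding 2 e(2) by simp
        then obtain k where k: "v * inverse e = eps powi k \<or> v * inverse e = - (eps powi k)"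
          using norm_one_unit[OF wO] by blast
        have "v = e * (v * inverse e)" using e0 by simp
        hence "v = e * eps powi k \<or> v = - e * eps powi k" using k
          by (metis mult_minus_left mult_minus_right)
        thus ?thesis unfolding R_def by blast
      qed
    qed
  qed (use inj in \<open>auto simp: R_def\<close>)
next
  case False
  define R where "R = {1, - 1 :: real}"
  have me: "(- 1) * cj (- 1) = 1" using cj_minus[OF K_1] by simp
  show ?thesis
  proof (rule that[of R])
    show "card R = unit_index" using False by (simp add: unit_index_def R_def)
    show "R \<subseteq> unit_set" unfolding R_def unit_set_def using me O_1 O_minus[OF O_1] by auto
    show "inj_on (\<lambda>u. (sgn u, sgn (u * cj u))) R" by (auto simp: R_def inj_on_def)
    show "\<exists>u\<in>R. \<exists>k. v = u * eps powi k" if v: "v \<in> unit_set" for v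
    proof -
      have vO: "v \<in> \<O>" and "\<bar>v * cj v\<bar> = 1" using v by (auto simp: unit_set_def)
      moreover have "v * cj v \<noteq> - 1" using False vO by (auto simp: has_negative_unit_def)
      ultimately have "v * cj v = 1" by (auto simp: abs_if split: if_splits)
      then obtain k where "v = eps powi k \<or> v = - (eps powi k)" using norm_one_unit[OF vO]
        by blast
      hence "v = 1 * eps powi k \<or> v = - 1 * eps powi k" by simp
      thus ?thesis unfolding R_def by blast
    qed
  qed (simp add: R_def)
qed

text \<open>
  Among the products of \<open>x\<close>, a representative and a power of \<open>\<epsilon>\<close>, exactly one power leads into the
  fundamental domain for each representative.
\<close>

lemma card_units_in_domain:
  assumes x: "x \<in> K" "x \<noteq> 0"
  shows "card {v \<in> unit_set. 0 \<le> ratio_log (x * v) \<and> ratio_log (x * v) < period} = unit_index"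
    and "finite {v \<in> unit_set. 0 \<le> ratio_log (x * v) \<and> ratio_log (x * v) < period}"
proof -
  obtain R where R: "card R = unit_index" "finite R" "R \<subseteq> unit_set"
    "inj_on (\<lambda>u. (sgn u, sgn (u * cj u))) R"
    "\<And>v. v \<in> unit_set \<Longrightarrow> \<exists>u\<in>R. \<exists>k. v = u * eps powi k"
    by (rule unit_representatives) (rule that)
  define V where "V = {v \<in> unit_set. 0 \<le> ratio_log (x * v) \<and> ratio_log (x * v) < period}"
  \<comment> \<open>The exponent of the power of \<open>\<epsilon>\<close> that moves the position of \<open>x u\<close> into the fundamental domain.\<close>
  define k where "k u = \<lfloor>(ratio_log x + ratio_log u) / period\<rfloor>" for u
  define f where "f u = u * eps powi k u" for u
  have unit: "u \<in> K" "u \<noteq> 0" "u \<in> \<O>" "\<bar>u * cj u\<bar> = 1"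
    if "u \<in> unit_set" for u
    using that O_K by (auto simp: unit_set_def)
  have rl: "ratio_log (x * (u * eps powi n)) = ratio_log x + ratio_log u - period * of_int n"
    if "u \<in> unit_set" for u n
    using unit[OF that] x eps_gt_1
      by (simp add: ratio_log_mult K_mult eps_powi_K ratio_log_eps_powi)
  have norm_f: "(u * eps powi n) * cj (u * eps powi n) = u * cj u" if "u \<in> unit_set" for u n
  proof -
    have "(u * eps powi n) * cj (u * eps powi n) = (u * cj u) * (eps powi n * cj (eps powi n))"
      using unit[OF that] by (simp add: cj_mult eps_powi_K)
    thus ?thesis unfolding eps_powi_norm by simp
  qed
  have sgn_f: "sgn (u * eps powi n) = sgn u" for u n
    unfolding sgn_mult sgn_pos[OF eps_powi_pos] by simp
  have "bij_betw f R V"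
    unfolding bij_betw_def
  proof
    show "inj_on f R"
    proof (rule inj_onI)
      fix u u' assume u: "u \<in> R" "u' \<in> R" "f u = f u'"
      have "sgn u = sgn u'" using arg_cong[OF u(3), of sgn] by (simp add: f_def sgn_f)
      moreover have "f v * cj (f v) = v * cj v" if "v \<in> R" for v
        unfolding f_def using that R(3) by (intro norm_f) auto
      hence "u * cj u = u' * cj u'" using u by metis
      ultimately show "u = u'" using inj_onD[OF R(4) _ u(1,2)] by simp
    qed
    show "f ` R = V"
    proof (intro equalityI subsetI)
      fix v assume "v \<in> f ` R"
      then obtain u where u: "u \<in> R" "v = u * eps powi k u" by (auto simp: f_def)
      have uU: "u \<in> unit_set" using u R(3) by blast
      have "v \<in> unit_set" unfolding unit_set_def u(2) mem_Collect_eq norm_f[OF uU]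
        using unit(4)[OF uU] O_mult[OF unit(3)[OF uU] eps_powi_O] by blast
      moreover have "0 \<le> ratio_log (x * v)" "ratio_log (x * v) < period"
        unfolding u(2) rl[OF uU] k_def
        using floor_divide_lower[OF period_pos, of "ratio_log x + ratio_log u"]
          floor_divide_upper[OF period_pos, of "ratio_log x + ratio_log u"]
        by (simp_all add: algebra_simps)
      ultimately show "v \<in> V" by (simp add: V_def)
    next
      fix v assume v: "v \<in> V"
      hence "\<exists>u\<in>R. \<exists>k. v = u * eps powi k" using R(5) unfolding V_def by blast
      then obtain u n where u: "u \<in> R" "v = u * eps powi n" by blast
      have uU: "u \<in> unit_set" using u R(3) by blast
      have "0 \<le> ratio_log x + ratio_log u - period * of_int n" "ratio_log x + ratio_log u - period * of_int n < period"
        using v unfolding V_def u(2) by (simp_all add: rl[OF uU])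
      hence "k u = n" unfolding k_def using period_pos by (simp add: floor_eq_iff field_simps)
      thus "v \<in> f ` R" using u by (auto simp: f_def)
    qed
  qed
  hence "card V = unit_index" "finite V"
    using bij_betw_same_card[of f R V] bij_betw_finite[of f R V] R(1,2) by simp_all
  thus "card {v \<in> unit_set. 0 \<le> ratio_log (x * v) \<and> ratio_log (x * v) < period} = unit_index"
    and "finite {v \<in> unit_set. 0 \<le> ratio_log (x * v) \<and> ratio_log (x * v) < period}"
    unfolding V_def .
qed

text \<open>
  The quotient of the principal ideal of \<open>x\<close> by the lattice, because the conjugate lattice is the
  inverse of the lattice up to the factor \<open>A\<close>.
\<close>

definition cofactor :: "int bqf \<Rightarrow> real \<Rightarrow> real set" where
  "cofactor Q x = smul (of_int (qA Q) * x) (cj ` lat Q)"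

lemma cofactor_frac_ideal:
  assumes "bqf_disc Q = D" "x \<in> K" "x \<noteq> 0"
  shows "cofactor Q x \<in> frac_ideals D"
  unfolding cofactor_def using assms disc_A_nonzero[OF assms(1)]
  by (intro smul_frac_ideal cj_image_frac_ideal lat_frac_ideal K_intros) auto

lemma cofactor_integral_iff:
  assumes disc: "bqf_disc Q = D" and x: "x \<in> K" "x \<noteq> 0"
  shows "cofactor Q x \<subseteq> \<O> \<longleftrightarrow> x \<in> lat Q"
proof
  note A = disc_A_nonzero[OF disc]
  have prod: "ideal_mult (cofactor Q x) (lat Q) = smul x \<O>"
    unfolding cofactor_def smul_ideal_mult ideal_mult_commute[of "cj ` lat Q"] lat_times_conjugate[OF disc]
    using A by (simp add: smul_smul)
  show "x \<in> lat Q" if sub: "cofactor Q x \<subseteq> \<O>"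
  proof -
    have "ideal_mult (cofactor Q x) (lat Q) \<subseteq> lat Q"
      by (rule ideal_mult_subset) (use sub frac_idealD[OF lat_frac_ideal[OF disc]] in auto)
    moreover have "x * 1 \<in> smul x \<O>" unfolding smul_def using O_1 by blast
    ultimately show ?thesis unfolding prod by auto
  qed
  show "cofactor Q x \<subseteq> \<O>" if "x \<in> lat Q"
  proof
    fix z assume "z \<in> cofactor Q x"
    then obtain y where y: "y \<in> cj ` lat Q" "z = of_int (qA Q) * x * y"
      by (auto simp: cofactor_def smul_def)
    have "x * y \<in> smul (1 / of_int (qA Q)) \<O>"
      using ideal_multI[OF that y(1)] lat_times_conjugate[OF disc] by simp
    thus "z \<in> \<O>" using A by (simp add: in_smul_iff y(2) mult_ac)
  qed
qed

text \<open>
  For \<open>y = A x\<close>, the area of the basis \<open>y, y w'\<close> is \<open>y y' (w - w')\<close>, and \<open>A (w - w') = \<surd>D\<close>.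
\<close>

lemma ideal_norm_cofactor:
  assumes disc: "bqf_disc Q = D" and x: "x \<in> lat Q" "x \<noteq> 0"
  shows "of_nat (ideal_norm D (cofactor Q x)) = form_value Q x"
proof -
  have xK: "x \<in> K" using lat_K x by blast
  define y where "y = of_int (qA Q) * x"
  have yK: "y \<in> K" unfolding y_def by (intro K_intros xK)
  have J: "cofactor Q x = zspan y (y * root2 Q)"
    unfolding cofactor_def cj_lat smul_zspan by (simp add: y_def)
  have "of_nat (ideal_norm D (cofactor Q x)) * rD = \<bar>area y (y * root2 Q)\<bar>"
    by (rule ideal_norm_area[OF cofactor_frac_ideal[OF disc xK x(2)] _ J])
       (use cofactor_integral_iff[OF disc xK x(2)] x in simp)
  also have "cj (root2 Q) = root1 Q" using cj_cj[OF root1_K] by (simp add: cj_root1)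
  hence "area y (y * root2 Q) = (y * cj y) * (root1 Q - root2 Q)"
    unfolding area_def by (simp add: cj_mult yK root2_K algebra_simps)
  also have "y * cj y = of_int (qA Q) * (of_int (qA Q) * (x * cj x))"
    unfolding y_def by (simp add: cj_mult xK K_intros)
  also have "of_int (qA Q) * (of_int (qA Q) * (x * cj x)) * (root1 Q - root2 Q) =
      of_int (qA Q) * (x * cj x) * (of_int (qA Q) * (root1 Q - root2 Q))" by simp
  also have "\<dots> = of_int (qA Q) * (x * cj x) * rD" unfolding root_facts(3)[OF disc] ..
  finally have "of_nat (ideal_norm D (cofactor Q x)) * rD = form_value Q x * rD"
    using rD_pos by (simp add: abs_mult)
  thus ?thesis using rD_pos by simp
qed

lemma cofactor_fibre:
  assumes disc: "bqf_disc Q = D" and x: "x \<in> lat Q" "x \<noteq> 0"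
  shows "card {y \<in> unit_domain (lat Q). cofactor Q y = cofactor Q x} = unit_index"
    "finite {y \<in> unit_domain (lat Q). cofactor Q y = cofactor Q x}"
proof -
  have xK: "x \<in> K" using lat_K x by blast
  note A = disc_A_nonzero[OF disc]
  define V where "V = {v \<in> unit_set. 0 \<le> ratio_log (x * v) \<and> ratio_log (x * v) < period}"
  have "{y \<in> unit_domain (lat Q). cofactor Q y = cofactor Q x} = (\<lambda>v. x * v) ` V"
  proof (intro equalityI subsetI)
    fix y assume y: "y \<in> {y \<in> unit_domain (lat Q). cofactor Q y = cofactor Q x}"
    hence yL: "y \<in> lat Q" "y \<noteq> 0" by (auto simp: unit_domain_def)
    have yK: "y \<in> K" using lat_K yL by blast
    have "(of_int (qA Q) * y) / (of_int (qA Q) * x) \<in> unit_set"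
    proof (subst smul_eq_iff[symmetric, OF cj_image_frac_ideal[OF lat_frac_ideal[OF disc]]])
      show "smul (of_int (qA Q) * y) (cj ` lat Q) = smul (of_int (qA Q) * x) (cj ` lat Q)"
        using y by (simp add: cofactor_def)
    qed (use xK yK x yL A in \<open>auto intro: K_intros\<close>)
    hence "y / x \<in> unit_set" using A by simp
    moreover have "x * (y / x) = y" using x(2) by simp
    ultimately show "y \<in> (\<lambda>v. x * v) ` V"
      using y unfolding V_def unit_domain_def by (intro image_eqI[of _ _ "y / x"]) auto
  next
    fix y assume "y \<in> (\<lambda>v. x * v) ` V"
    then obtain v where v: "v \<in> unit_set" "y = x * v" "0 \<le> ratio_log y" "ratio_log y < period" by (auto simp: V_def)
    have vO: "v \<in> \<O>" "v \<noteq> 0" using v(1) by (auto simp: unit_set_def)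
    have "v * x \<in> lat Q" by (rule frac_idealD(3)[OF lat_frac_ideal[OF disc] vO(1) x(1)])
    hence yL: "y \<in> lat Q" "y \<noteq> 0" using v(2) vO x(2) by (auto simp: mult.commute)
    have yK: "y \<in> K" using lat_K yL by blast
    have "cofactor Q y = cofactor Q x" unfolding cofactor_def
    proof (subst smul_eq_iff[OF cj_image_frac_ideal[OF lat_frac_ideal[OF disc]]])
      have "(of_int (qA Q) * y) / (of_int (qA Q) * x) = v" using A x(2) v(2) by simp
      thus "(of_int (qA Q) * y) / (of_int (qA Q) * x) \<in> unit_set" using v(1) by simp
    qed (use xK yK x yL A in \<open>auto intro: K_intros\<close>)
    thus "y \<in> {y \<in> unit_domain (lat Q). cofactor Q y = cofactor Q x}"
      using yL v by (simp add: unit_domain_def)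
  qed
  moreover have "inj_on (\<lambda>v. x * v) V" using x(2) by (auto simp: inj_on_def)
  ultimately show "card {y \<in> unit_domain (lat Q). cofactor Q y = cofactor Q x} = unit_index"
    "finite {y \<in> unit_domain (lat Q). cofactor Q y = cofactor Q x}"
    using card_units_in_domain[OF xK x(2)] unfolding V_def by (auto simp: card_image)
qed

text \<open>
  Surjectivity holds because every point has a multiple by a unit in the fundamental domain.
\<close>

lemma cofactor_image:
  assumes disc: "bqf_disc Q = D"
  shows "cofactor Q ` unit_domain (lat Q) = {I \<in> wide_class (cj ` lat Q). I \<subseteq> \<O>}"
proof (intro equalityI subsetI)
  note A = disc_A_nonzero[OF disc]
  fix I assume "I \<in> cofactor Q ` unit_domain (lat Q)"
  then obtain x where x: "x \<in> lat Q" "x \<noteq> 0" "I = cofactor Q x"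
    by (auto simp: unit_domain_def)
  have xK: "x \<in> K" using lat_K x by blast
  have "of_int (qA Q) * x \<in> K" by (intro K_mult K_of_int xK)
  moreover have "of_int (qA Q) * x \<noteq> 0" using x(2) A by simp
  ultimately have "I \<in> wide_class (cj ` lat Q)" unfolding x(3) cofactor_def wide_class_def
    by blast
  thus "I \<in> {I \<in> wide_class (cj ` lat Q). I \<subseteq> \<O>}"
    using cofactor_integral_iff[OF disc xK x(2)] x by simp
next
  note A = disc_A_nonzero[OF disc]
  fix I assume "I \<in> {I \<in> wide_class (cj ` lat Q). I \<subseteq> \<O>}"
  then obtain y where y: "y \<in> K" "y \<noteq> 0" "I = smul y (cj ` lat Q)" "I \<subseteq> \<O>"
    unfolding wide_class_def by blast
  define x where "x = y / of_int (qA Q)"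
  have x: "x \<in> K" "x \<noteq> 0" unfolding x_def using y A
    by (intro K_divide K_of_int, simp_all)
  have I: "I = cofactor Q x" using A by (simp add: y(3) cofactor_def x_def)
  have xL: "x \<in> lat Q" using cofactor_integral_iff[OF disc x] y(4) I by simp
  have "unit_index > 0" by (simp add: unit_index_def)
  hence "{z \<in> unit_domain (lat Q). cofactor Q z = cofactor Q x} \<noteq> {}"
    using cofactor_fibre(1)[OF disc xL x(2)] by (metis card.empty less_irrefl)
  thus "I \<in> cofactor Q ` unit_domain (lat Q)" unfolding I by blast
qed

text \<open>
  The points are grouped by the ideals attached to them; all groups have the same number of elements.
\<close>

theorem lattice_sum_eq_class_zeta:
  assumes disc: "bqf_disc Q = D"
    and summable: "(\<lambda>x. of_real (form_value Q x) powr (- s)) summable_on unit_domain (lat Q)"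
  shows "(\<Sum>\<^sub>\<infinity>x\<in>unit_domain (lat Q). of_real (form_value Q x) powr (- s)) =
     of_nat unit_index * class_zeta D (wide_class (cj ` lat Q)) (s :: complex)"
proof -
  define U where "U = unit_domain (lat Q)"
  define Js where "Js = {I \<in> wide_class (cj ` lat Q). I \<subseteq> \<O>}"
  define fib where "fib I = {x \<in> U. cofactor Q x = I}" for I
  define g where "g I = (of_nat (ideal_norm D I) :: complex) powr (- s)" for I
  have eq: "of_real (form_value Q x) powr (- s) = g (cofactor Q x)" if "x \<in> U" for x
  proof -
    have "of_real (form_value Q x) = complex_of_real (of_nat (ideal_norm D (cofactor Q x)))"
      using ideal_norm_cofactor[OF disc, of x] that by (simp add: U_def unit_domain_def)
    thus ?thesis by (simp add: g_def)
  qed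
  have bij: "bij_betw snd (Sigma Js fib) U"
  proof (rule bij_betw_byWitness[where f' = "\<lambda>x. (cofactor Q x, x)"])
    show "(\<lambda>x. (cofactor Q x, x)) ` U \<subseteq> Sigma Js fib"
      using cofactor_image[OF disc] by (auto simp: Js_def fib_def U_def)
  qed (auto simp: fib_def)
  have "(\<lambda>x. g (cofactor Q x)) summable_on U"
    using summable unfolding U_def[symmetric]
      by (rule summable_on_cong[THEN iffD1, rotated]) (rule eq)
  hence "(\<lambda>z. g (cofactor Q (snd z))) summable_on Sigma Js fib"
    by (subst summable_on_reindex_bij_betw[OF bij])
  hence sm: "(\<lambda>(I, x). g I) summable_on Sigma Js fib"
    by (rule summable_on_cong[THEN iffD1, rotated]) (auto simp: fib_def)
  have "(\<Sum>\<^sub>\<infinity>x\<in>U. of_real (form_value Q x) powr (- s)) = (\<Sum>\<^sub>\<infinity>x\<in>U. g (cofactor Q x))"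
    by (intro infsum_cong eq)
  also have "\<dots> = (\<Sum>\<^sub>\<infinity>z\<in>Sigma Js fib. g (cofactor Q (snd z)))"
    by (rule infsum_reindex_bij_betw[OF bij, symmetric])
  also have "\<dots> = (\<Sum>\<^sub>\<infinity>(I, x)\<in>Sigma Js fib. g I)"
    by (rule infsum_cong) (auto simp: fib_def)
  also have "\<dots> = (\<Sum>\<^sub>\<infinity>I\<in>Js. \<Sum>\<^sub>\<infinity>x\<in>fib I. g I)"
    by (rule infsum_Sigma'_banach[OF sm, symmetric])
  also have "\<dots> = (\<Sum>\<^sub>\<infinity>I\<in>Js. of_nat unit_index * g I)"
  proof (rule infsum_cong)
    fix I assume "I \<in> Js"
    hence "I \<in> cofactor Q ` unit_domain (lat Q)" unfolding cofactor_image[OF disc] Js_def .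
    then obtain x where x: "x \<in> lat Q" "x \<noteq> 0" "I = cofactor Q x"
      by (auto simp: unit_domain_def)
    have "card (fib I) = unit_index" "finite (fib I)"
      using cofactor_fibre[OF disc x(1,2)] by (simp_all add: fib_def U_def x(3))
    thus "(\<Sum>\<^sub>\<infinity>x\<in>fib I. g I) = of_nat unit_index * g I" by simp
  qed
  also have "\<dots> = of_nat unit_index * (\<Sum>\<^sub>\<infinity>I\<in>Js. g I)"
    by (rule infsum_cmult_right')
  finally show ?thesis by (simp add: U_def class_zeta_def Js_def g_def)
qed

end

section \<open>Convergence of the lattice sums\<close>

lemma summable_on_int_powr:
  fixes r :: real
  assumes "r > 1"
  shows "(\<lambda>n::int. (1 + \<bar>of_int n\<bar>) powr (- r)) summable_on UNIV"
proof -
  have "summable (\<lambda>n. real n powr (- r))" using assms by (simp add: summable_real_powr_iff)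
  hence "summable (\<lambda>n. (1 + real n) powr (- r))"
    using summable_Suc_iff[of "\<lambda>n. real n powr (- r)"] by simp
  hence nat: "(\<lambda>n. (1 + real n) powr (- r)) summable_on UNIV"
    by (subst summable_on_UNIV_nonneg_real_iff) auto
  have 1: "(\<lambda>n::int. (1 + \<bar>of_int n\<bar>) powr (- r)) summable_on (range int)"
    by (subst summable_on_reindex) (auto simp: o_def nat)
  have 2: "(\<lambda>n::int. (1 + \<bar>of_int n\<bar>) powr (- r)) summable_on (range (\<lambda>n. - int n))"
    by (subst summable_on_reindex) (auto simp: o_def nat inj_on_def)
  have "n \<in> range int \<union> range (\<lambda>n. - int n)" for n :: int
    by (cases n rule: int_cases2) auto
  hence "UNIV = range int \<union> range (\<lambda>n. - int n)" by auto
  thus ?thesis using summable_on_union[OF 1 2] by metis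
qed

lemma summable_on_int_pairs_powr:
  fixes r :: real
  assumes "r > 1"
  shows "(\<lambda>(m::int, n::int). (1 + \<bar>of_int m\<bar>) powr (- r) * (1 + \<bar>of_int n\<bar>) powr (- r)) summable_on UNIV"
proof -
  define f where "f = (\<lambda>n::int. (1 + \<bar>of_int n\<bar>) powr (- r))"
  have f: "f summable_on UNIV" unfolding f_def by (rule summable_on_int_powr[OF assms])
  have "(\<lambda>(m, n). f m * f n) summable_on (UNIV \<times> UNIV)"
  proof (rule summable_on_SigmaI[where g = "\<lambda>m. f m * infsum f UNIV"])
    fix m :: int
    show "((\<lambda>n. (\<lambda>(m, n). f m * f n) (m, n)) has_sum (f m * infsum f UNIV)) UNIV"
      using has_sum_cmult_right[OF has_sum_infsum[OF f], of "f m"] by simp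
  next
    show "(\<lambda>m. f m * infsum f UNIV) summable_on UNIV" by (intro summable_on_cmult_left f)
  qed (auto simp: f_def)
  thus ?thesis by (simp add: f_def)
qed

lemma zeta_has_sum:
  assumes "Re s > 1"
  shows "((\<lambda>n. 1 / of_nat (Suc n) powr s) has_sum riemann_zeta s) UNIV"
proof -
  have norm: "norm (1 / of_nat (Suc n) powr s :: complex) = of_nat (Suc n) powr (- Re s)" for n
    by (simp add: norm_divide norm_powr_real_powr powr_minus_divide del: of_nat_Suc)
  have "summable (\<lambda>n. real n powr (- Re s))" using assms
    by (simp add: summable_real_powr_iff)
  hence "summable (\<lambda>n. real (Suc n) powr (- Re s))"
    by (subst summable_Suc_iff)
  hence sm: "summable (\<lambda>n. norm (1 / of_nat (Suc n) powr s :: complex))" unfolding norm .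
  from norm_summable_imp_has_sum[OF sm summable_sums[OF summable_norm_cancel[OF sm]]]
  show "((\<lambda>n. 1 / of_nat (Suc n) powr s) has_sum riemann_zeta s) UNIV"
    by (simp add: riemann_zeta_def)
qed

text \<open>
  The terms after the first one add up to at most \<open>\<pi>\<^sup>2/6 - 1 < 1\<close> in absolute value.
\<close>

lemma riemann_zeta_nonzero:
  assumes "Re s > 2"
  shows "riemann_zeta s \<noteq> 0"
proof
  assume z: "riemann_zeta s = 0"
  define f :: "nat \<Rightarrow> complex" where "f n = 1 / of_nat (Suc n) powr s" for n
  have norm: "norm (f n) = of_nat (Suc n) powr (- Re s)" for n
    by (simp add: f_def norm_divide norm_powr_real_powr powr_minus_divide del: of_nat_Suc)
  have le: "norm (f n) \<le> 1 / (of_nat n + 1)\<^sup>2" for n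
  proof -
    have "of_nat (Suc n) powr (- Re s) \<le> (of_nat (Suc n) :: real) powr (- 2)"
      using assms by (intro powr_mono) auto
    also have "\<dots> = 1 / (of_nat n + 1)\<^sup>2"
      by (simp add: powr_minus_divide powr_numeral add.commute)
    finally show ?thesis unfolding norm .
  qed
  have sq: "(\<lambda>n. 1 / (of_nat n + 1)\<^sup>2 :: real) sums (pi\<^sup>2 / 6)"
    using inverse_squares_sums by (simp add: add.commute)
  have sm: "summable (\<lambda>n. norm (f n))"
    by (rule summable_comparison_test[OF _ sums_summable[OF sq]]) (auto intro: le)
  have "(\<Sum>n. f n) = 0" using z by (simp add: riemann_zeta_def f_def)
  hence "(\<Sum>n. f (Suc n)) = - 1"
    using suminf_split_head[OF summable_norm_cancel[OF sm]] by (simp add: f_def)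
  hence "1 = norm (\<Sum>n. f (Suc n))" by simp
  also have "\<dots> \<le> (\<Sum>n. norm (f (Suc n)))"
    by (rule summable_norm) (use summable_Suc_iff[of "\<lambda>n. norm (f n)"] sm in blast)
  also have "\<dots> \<le> (\<Sum>n. 1 / (of_nat (Suc n) + 1)\<^sup>2)"
  proof (rule suminf_le)
    show "summable (\<lambda>n. norm (f (Suc n)))"
      using summable_Suc_iff[of "\<lambda>n. norm (f n)"] sm by blast
    show "summable (\<lambda>n. 1 / (of_nat (Suc n) + 1)\<^sup>2 :: real)"
      using sums_summable[OF sq] summable_Suc_iff[of "\<lambda>n. 1 / (of_nat n + 1)\<^sup>2 :: real"] by blast
  qed (rule le)
  also have "\<dots> = pi\<^sup>2 / 6 - 1"
    using suminf_split_head[OF sums_summable[OF sq]] sums_unique[OF sq] by simp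
  also have "\<dots> < 1"
  proof -
    have "pi < 3.2" using pi_approx by simp
    hence "pi\<^sup>2 < 3.2\<^sup>2" using pi_gt_zero by (intro power_strict_mono) auto
    thus ?thesis by (simp add: power2_eq_square)
  qed
  finally show False by simp
qed

context real_quadratic
begin

lemma lat_coords_unique:
  assumes "bqf_disc Q = D"
  shows "of_int m + of_int n * root1 Q = of_int m' + of_int n' * root1 Q \<longleftrightarrow> m = m' \<and> n = n'"
proof
  assume eq: "of_int m + of_int n * root1 Q = of_int m' + of_int n' * root1 Q"
  have A: "of_int (qA Q) \<noteq> (0::real)" using disc_A_nonzero[OF assms] by simp
  have "cj (of_int i + of_int j * root1 Q) = of_int i + of_int j * root2 Q" for i j
    by (simp add: cj_add cj_mult K_intros root1_K cj_root1)
  hence eq': "of_int m + of_int n * root2 Q = of_int m' + of_int n' * root2 Q"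
    using arg_cong[OF eq, of cj] by simp
  have "of_int n * (root1 Q - root2 Q) = of_int n' * (root1 Q - root2 Q)"
    using eq eq' by (simp add: algebra_simps)
  moreover have "root1 Q - root2 Q \<noteq> 0" using root_facts(3)[OF assms] rD_pos by auto
  ultimately have "n = n'" by simp
  thus "m = m' \<and> n = n'" using eq by simp
qed auto

text \<open>
  The coordinates of \<open>x\<close> are linear in \<open>x\<close> and its conjugate, and at least one of them has absolute
  value at least 1. The product on the left is chosen because it separates the variables.
\<close>

lemma lat_size_bound:
  assumes disc: "bqf_disc Q = D"
  obtains C where "C > 0" "\<And>m n x. x = of_int m + of_int n * root1 Q \<Longrightarrow> x \<noteq> 0 \<Longrightarrow>
     (1 + \<bar>of_int m\<bar>) * (1 + \<bar>of_int n\<bar>) \<le> C * (x\<^sup>2 + (cj x)\<^sup>2)"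
proof -
  define w w' where "w = root1 Q" and "w' = root2 Q"
  define \<delta> where "\<delta> = \<bar>w - w'\<bar>"
  have d: "\<delta> > 0" using root_facts(3)[OF disc] rD_pos
    by (auto simp: \<delta>_def w_def w'_def)
  \<comment> \<open>With \<open>S = \<bar>x\<bar> + \<bar>x'\<bar>\<close>, the coordinates satisfy \<open>\<bar>n\<bar> \<le> S/\<delta>\<close> and \<open>\<bar>m\<bar> \<le> S + \<bar>w\<bar> S/\<delta>\<close>.\<close>
  define c where "c = (1 + \<bar>w\<bar>) / \<delta> + 1"
  have c: "c > 0" using d by (simp add: c_def add_nonneg_pos)
  show ?thesis
  proof (rule that[of "8 * c\<^sup>2"])
    show "8 * c\<^sup>2 > 0" using c by simp
    fix m n x assume x: "x = of_int m + of_int n * root1 Q" "x \<noteq> 0"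
    have cjx: "cj x = of_int m + of_int n * w'"
      unfolding x(1) w'_def by (simp add: cj_add cj_mult K_intros root1_K cj_root1)
    define S where "S = \<bar>x\<bar> + \<bar>cj x\<bar>"
    have "of_int n * (w - w') = x - cj x" unfolding cjx unfolding x(1) w_def
      by (simp add: algebra_simps)
    hence "\<bar>of_int n\<bar> * \<delta> = \<bar>x - cj x\<bar>" unfolding \<delta>_def
      by (metis abs_mult)
    hence "\<bar>of_int n\<bar> * \<delta> \<le> S" by (simp add: S_def)
    hence n: "\<bar>of_int n\<bar> \<le> S / \<delta>" using d by (simp add: field_simps)
    have "of_int m = x - of_int n * w" by (simp add: x(1) w_def)
    hence "\<bar>of_int m\<bar> \<le> \<bar>x\<bar> + \<bar>of_int n\<bar> * \<bar>w\<bar>"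
      by (metis abs_triangle_ineq4 abs_mult)
    also have "\<dots> \<le> S + (S / \<delta>) * \<bar>w\<bar>" using n
      by (intro add_mono mult_right_mono) (auto simp: S_def)
    finally have m: "\<bar>of_int m\<bar> \<le> S + (S / \<delta>) * \<bar>w\<bar>" .
    define t where "t = \<bar>of_int m\<bar> + (\<bar>of_int n\<bar> :: real)"
    have tS: "t \<le> c * S" using m n by (simp add: t_def c_def algebra_simps add_divide_distrib)
    have "m \<noteq> 0 \<or> n \<noteq> 0" using x by auto
    hence "1 \<le> \<bar>m\<bar> + \<bar>n\<bar>" by auto
    hence t1: "1 \<le> t" unfolding t_def by (metis of_int_1_le_iff of_int_add of_int_abs)
    have "(1 + \<bar>of_int m\<bar>) * (1 + \<bar>of_int n\<bar>) \<le> (1 + t) * (1 + t)"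
      by (intro mult_mono) (auto simp: t_def)
    also have "\<dots> \<le> (2 * t) * (2 * t)" using t1 by (intro mult_mono) auto
    also have "\<dots> = 4 * t\<^sup>2" by (simp add: power2_eq_square)
    also have "\<dots> \<le> 4 * (c * S)\<^sup>2" using tS t1
      by (intro mult_left_mono power_mono) auto
    also have "\<dots> = 4 * c\<^sup>2 * S\<^sup>2" by (simp add: power_mult_distrib)
    also have "S\<^sup>2 \<le> 2 * (x\<^sup>2 + (cj x)\<^sup>2)"
    proof -
      have "0 \<le> (\<bar>x\<bar> - \<bar>cj x\<bar>)\<^sup>2" by simp
      thus ?thesis by (simp add: S_def power2_sum power2_diff)
    qed
    hence "4 * c\<^sup>2 * S\<^sup>2 \<le> 4 * c\<^sup>2 * (2 * (x\<^sup>2 + (cj x)\<^sup>2))"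
      using c by (intro mult_left_mono) auto
    also have "\<dots> = 8 * c\<^sup>2 * (x\<^sup>2 + (cj x)\<^sup>2)" by simp
    finally show "(1 + \<bar>of_int m\<bar>) * (1 + \<bar>of_int n\<bar>) \<le> 8 * c\<^sup>2 * (x\<^sup>2 + (cj x)\<^sup>2)" by simp
  qed
qed

text \<open>
  The sum is dominated by a product of two convergent sums over the integers.
\<close>

lemma lat_sum_converges:
  assumes disc: "bqf_disc Q = D" and r: "r > 1"
  shows "(\<lambda>x. (x\<^sup>2 + (cj x)\<^sup>2) powr (- r)) summable_on (lat Q - {0})"
proof -
  obtain C where C: "C > 0" "\<And>m n x. x = of_int m + of_int n * root1 Q \<Longrightarrow> x \<noteq> 0 \<Longrightarrow>
     (1 + \<bar>of_int m\<bar>) * (1 + \<bar>of_int n\<bar>) \<le> C * (x\<^sup>2 + (cj x)\<^sup>2)"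
    using lat_size_bound[OF disc] by blast
  define f :: "int \<times> int \<Rightarrow> real" where "f = (\<lambda>(m, n). of_int m + of_int n * root1 Q)"
  define S where "S = UNIV - {(0::int, 0::int)}"
  have "f (m, n) = 0 \<longleftrightarrow> m = 0 \<and> n = 0" for m n
    using lat_coords_unique[OF disc, of m n 0 0] by (simp add: f_def)
  hence bij: "bij_betw f S (lat Q - {0})"
    unfolding bij_betw_def S_def
  proof (intro conjI)
    show "inj_on f (UNIV - {(0, 0)})"
      using lat_coords_unique[OF disc] by (auto simp: inj_on_def f_def)
    show "f ` (UNIV - {(0, 0)}) = lat Q - {0}"
      if "\<And>m n. f (m, n) = 0 \<longleftrightarrow> m = 0 \<and> n = 0"
    proof (intro equalityI subsetI)
      fix x assume "x \<in> f ` (UNIV - {(0, 0)})"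
      then obtain m n where mn: "x = f (m, n)" "(m, n) \<noteq> (0, 0)" by auto
      have "x \<in> lat Q" unfolding mn(1) f_def lat_def by (auto intro!: zspanI'[of _ m _ n])
      thus "x \<in> lat Q - {0}" using mn that by auto
    next
      fix x assume x: "x \<in> lat Q - {0}"
      then obtain m n where "x = of_int m * 1 + of_int n * root1 Q" unfolding lat_def
        by (auto elim: zspanE)
      hence "x = f (m, n)" by (simp add: f_def)
      moreover have "(m, n) \<noteq> (0, 0)" using x calculation that by auto
      ultimately show "x \<in> f ` (UNIV - {(0, 0)})" by blast
    qed
  qed
  have "(\<lambda>z. ((f z)\<^sup>2 + (cj (f z))\<^sup>2) powr (- r)) summable_on S"
  proof (rule summable_on_comparison_test)
    have "(\<lambda>(m::int, n::int). (1 + \<bar>of_int m\<bar>) powr (- r) * (1 + \<bar>of_int n\<bar>) powr (- r)) summable_on S"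
      by (rule summable_on_subset[OF summable_on_int_pairs_powr[OF r]]) auto
    thus "(\<lambda>z. C powr r * (case z of (m::int, n::int) \<Rightarrow> (1 + \<bar>of_int m\<bar>) powr (- r) * (1 + \<bar>of_int n\<bar>) powr (- r))) summable_on S"
      by (rule summable_on_cmult_right)
    fix z assume "z \<in> S"
    obtain m n where z: "z = (m, n)" by (cases z)
    have fz: "f z \<noteq> 0" using bij \<open>z \<in> S\<close> by (auto simp: bij_betw_def)
    have le: "(1 + \<bar>of_int m\<bar>) * (1 + \<bar>of_int n\<bar>) \<le> C * ((f z)\<^sup>2 + (cj (f z))\<^sup>2)"
      by (rule C(2)[OF _ fz]) (simp add: f_def z)
    have p1: "(1 + \<bar>of_int m\<bar>) * (1 + \<bar>of_int n\<bar>) > (0::real)"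
      by (intro mult_pos_pos) auto
    have p2: "(f z)\<^sup>2 + (cj (f z))\<^sup>2 > 0" using fz by (simp add: sum_power2_gt_zero_iff)
    have "((f z)\<^sup>2 + (cj (f z))\<^sup>2) powr (- r) = C powr r * (C * ((f z)\<^sup>2 + (cj (f z))\<^sup>2)) powr (- r)"
      using C(1) p2 by (simp add: powr_mult powr_minus)
    also have "\<dots> \<le> C powr r * ((1 + \<bar>of_int m\<bar>) * (1 + \<bar>of_int n\<bar>)) powr (- r)"
      using le p1 r by (intro mult_left_mono powr_mono2') auto
    also have "\<dots> = C powr r * (case z of (m::int, n::int) \<Rightarrow> (1 + \<bar>of_int m\<bar>) powr (- r) * (1 + \<bar>of_int n\<bar>) powr (- r))"
      by (simp add: z powr_mult)
    finally show "((f z)\<^sup>2 + (cj (f z))\<^sup>2) powr (- r) \<le> \<dots>" .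
  qed auto
  thus ?thesis by (subst (asm) summable_on_reindex_bij_betw[OF bij])
qed

end

section \<open>The coset sum as a sum over primitive lattice points\<close>

lemma unipotent_in_generate: "mat2 1 n 0 1 \<in> generate SL2Z {T_mat}"
proof -
  interpret group SL2Z by (rule group_SL2Z)
  have mult: "mat2 1 m 0 1 \<otimes>\<^bsub>SL2Z\<^esub> mat2 1 n 0 1 = mat2 1 (m + n) 0 1" for m n
    by (simp add: SL2Z_def vec_eq_iff forall_2 matrix_matrix_mult_def sum_2)
  have one: "mat2 1 0 0 1 = \<one>\<^bsub>SL2Z\<^esub>"
    by (simp add: SL2Z_def vec_eq_iff forall_2 mat_def)
  have T: "mat2 1 1 0 1 \<in> generate SL2Z {T_mat}"
    using generate.incl[of T_mat "{T_mat}" SL2Z] by (simp add: T_mat_def)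
  have "inv\<^bsub>SL2Z\<^esub> T_mat = mat2 1 (- 1) 0 1"
  proof (rule inv_equality)
    show "mat2 1 (- 1) 0 1 \<otimes>\<^bsub>SL2Z\<^esub> T_mat = \<one>\<^bsub>SL2Z\<^esub>"
      unfolding T_mat_def mult using one by simp
  qed (simp_all add: SL2Z_def T_mat_def det_2)
  hence Ti: "mat2 1 (- 1) 0 1 \<in> generate SL2Z {T_mat}"
    using generate.inv[of T_mat "{T_mat}" SL2Z] by simp
  show ?thesis
  proof (induction n rule: int_induct[of _ 0])
    case base
    show ?case unfolding one by (rule generate.one)
  next
    case (step1 i)
    from generate.eng[OF this(2) T] show ?case unfolding mult .
  next
    case (step2 i)
    from generate.eng[OF this(2) Ti] show ?case unfolding mult by simp
  qed
qed

text \<open>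
  The entry \<open>n\<close> is read off from the product of \<open>g\<close> with the inverse of \<open>h\<close>.
\<close>

lemma same_row_same_coset:
  fixes g h :: "int ^ 2 ^ 2"
  assumes "det g = 1" "det h = 1" "g $ 2 $ 1 = h $ 2 $ 1" "g $ 2 $ 2 = h $ 2 $ 2"
  shows "\<exists>n. g = mat2 1 n 0 1 ** h"
proof -
  define a b c d a' b' where "a = g $ 1 $ 1" "b = g $ 1 $ 2" "c = g $ 2 $ 1" "d = g $ 2 $ 2"
    "a' = h $ 1 $ 1" "b' = h $ 1 $ 2"
  note defs = this
  define n where "n = b * a' - a * b'"
  have dg: "a * d = 1 + b * c" using assms(1) by (simp add: det_2 defs)
  have dh: "a' * d = 1 + b' * c" using assms by (simp add: det_2 defs)
  have "a' + n * c = a' * (1 + b * c) - a * (b' * c)" by (simp add: n_def algebra_simps)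
  also have "\<dots> = a * (a' * d - b' * c)" unfolding dg[symmetric] by (simp add: algebra_simps)
  also have "\<dots> = a" unfolding dh by simp
  finally have 1: "a' + n * c = a" .
  have "b' + n * d = b' - b' * (a * d) + b * (a' * d)" by (simp add: n_def algebra_simps)
  also have "\<dots> = b" unfolding dg dh by (simp add: algebra_simps)
  finally have 2: "b' + n * d = b" .
  have "g = mat2 1 n 0 1 ** h"
    using 1 2 assms(3,4) by (simp add: vec_eq_iff forall_2 matrix_matrix_mult_def sum_2 defs)
  thus ?thesis by blast
qed

lemma coset_same_row:
  fixes g h :: "int ^ 2 ^ 2"
  assumes "X \<in> rcosets\<^bsub>SL2Z\<^esub> (generate SL2Z {T_mat})" "g \<in> X" "h \<in> X"
  shows "det g = 1" "g $ 2 $ 1 = h $ 2 $ 1" "g $ 2 $ 2 = h $ 2 $ 2"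
proof -
  obtain a where a: "det a = 1" "X = generate SL2Z {T_mat} #>\<^bsub>SL2Z\<^esub> a"
    using assms(1) by (auto simp: RCOSETS_def SL2Z_def)
  have *: "det g = 1 \<and> g $ 2 $ 1 = a $ 2 $ 1 \<and> g $ 2 $ 2 = a $ 2 $ 2" if gX: "g \<in> X"
    for g
  proof -
    have mult: "h \<otimes>\<^bsub>SL2Z\<^esub> a = h ** a" for h by (simp add: SL2Z_def)
    obtain h where h: "h \<in> generate SL2Z {T_mat}" "g = h ** a"
      using gX unfolding a(2) r_coset_def mult by blast
    obtain n where n: "h = mat2 1 n 0 1" using generate_T_mat[OF h(1)] by blast
    have "det g = det (mat2 1 n 0 1) * det a" unfolding h(2) n by (rule det_mul)
    hence "det g = 1" using a(1) by (simp add: det_2)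
    moreover have "g $ 2 $ 1 = a $ 2 $ 1" "g $ 2 $ 2 = a $ 2 $ 2"
      unfolding h(2) n by (simp_all add: matrix_matrix_mult_def sum_2)
    ultimately show ?thesis by blast
  qed
  show "det g = 1" "g $ 2 $ 1 = h $ 2 $ 1" "g $ 2 $ 2 = h $ 2 $ 2"
    using *[OF assms(2)] *[OF assms(3)] by auto
qed

lemma row_completion:
  assumes "coprime c (d :: int)"
  obtains g :: "int ^ 2 ^ 2" where "det g = 1" "g $ 2 $ 1 = c" "g $ 2 $ 2 = d"
proof -
  obtain u v where "u * c + v * d = 1" using assms by (metis bezout_int coprime_imp_gcd_eq_1)
  hence "det (mat2 v (- u) c d) = 1" by (simp add: det_2 algebra_simps)
  thus ?thesis using that[of "mat2 v (- u) c d"] by simp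
qed

lemma row_coprime:
  fixes g :: "int ^ 2 ^ 2"
  assumes "det g = 1" shows "coprime (g $ 2 $ 1) (g $ 2 $ 2)"
proof (rule coprimeI)
  fix k assume "k dvd g $ 2 $ 1" "k dvd g $ 2 $ 2"
  hence "k dvd g $ 1 $ 1 * g $ 2 $ 2 - g $ 1 $ 2 * g $ 2 $ 1" by (intro dvd_diff) auto
  thus "is_unit k" using assms by (simp add: det_2)
qed

lemma moebius_denominator_nonzero:
  assumes "z \<in> upper_half_plane" "coprime c (d :: int)"
  shows "of_int c * z + of_int d \<noteq> 0"
proof
  assume eq: "of_int c * z + of_int d = 0"
  hence "Im (of_int c * z + of_int d) = 0" by simp
  hence "c = 0" using assms(1) by (simp add: upper_half_plane_def)
  moreover from this have "d = 0" using eq by simp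
  ultimately show False using assms(2) by simp
qed

text \<open>
  With \<open>j = c z + d\<close>, the value of \<open>gQ\<close> at \<open>gz\<close> is \<open>Q(z)/j\<^sup>2\<close>, and the derivative of \<open>gQ\<close> at \<open>gz\<close> is a linear
  function of \<open>z\<close> divided by \<open>j\<close>.
\<close>

lemma phi_transform:
  fixes g :: "int ^ 2 ^ 2"
  assumes g: "det g = 1" and z: "z \<in> upper_half_plane"
  defines "c \<equiv> of_int (g $ 2 $ 1)" and "d \<equiv> of_int (g $ 2 $ 2)"
  shows "phi (moebius g z) (bqf_act g Q) =
    bqf_at Q z / ((c * z + d) *
      ((2 * of_real (qA Q) * d - of_real (qB Q) * c) * z + (of_real (qB Q) * d - 2 * of_real (qC Q) * c)))"
proof -
  define a b where "a = (of_int (g $ 1 $ 1) :: complex)" and "b = (of_int (g $ 1 $ 2) :: complex)"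
  define A B C where "A = (of_real (qA Q) :: complex)" and "B = (of_real (qB Q) :: complex)"
    and "C = (of_real (qC Q) :: complex)"
  have det: "a * d - b * c = 1"
  proof -
    have "of_int (g $ 1 $ 1 * g $ 2 $ 2 - g $ 1 $ 2 * g $ 2 $ 1) = (1 :: complex)"
      using g by (simp only: det_2 of_int_1)
    thus ?thesis by (simp add: a_def b_def c_def d_def)
  qed
  define j where "j = c * z + d"
  have j: "j \<noteq> 0" unfolding j_def c_def d_def
    by (rule moebius_denominator_nonzero[OF z row_coprime[OF g]])
  define A' where "A' = A * d\<^sup>2 - B * d * c + C * c\<^sup>2"
  define B' where "B' = - 2 * A * d * b + B * (d * a + b * c) - 2 * C * c * a"
  define C' where "C' = A * b\<^sup>2 - B * b * a + C * a\<^sup>2"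
  have gz: "moebius g z = (a * z + b) / j" by (simp add: moebius_def a_def b_def j_def c_def d_def)
  have act: "bqf_act g Q = bqf_subst Q (mat2 (g $ 2 $ 2) (- (g $ 1 $ 2)) (- (g $ 2 $ 1)) (g $ 1 $ 1))"
    unfolding bqf_act_def matrix_inv_SL2[OF g] ..
  have coeffs: "of_real (qA (bqf_act g Q)) = A'" "of_real (qB (bqf_act g Q)) = B'" "of_real (qC (bqf_act g Q)) = C'"
    unfolding act bqf_subst_def Let_def A'_def B'_def C'_def
    by (simp_all add: A_def B_def C_def a_def b_def c_def d_def algebra_simps)
  have at: "bqf_at (bqf_act g Q) (moebius g z) = A' * ((a * z + b) / j)\<^sup>2 + B' * ((a * z + b) / j) + C'"
    unfolding bqf_at_def bqf_eval_def gz coeffs[symmetric] by (simp add: bqf.map_sel)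
  have dat: "bqf_deriv_at (bqf_act g Q) (moebius g z) = 2 * A' * ((a * z + b) / j) + B'"
    unfolding bqf_deriv_at_def gz coeffs[symmetric] by simp
  have n: "(A' * ((a * z + b) / j)\<^sup>2 + B' * ((a * z + b) / j) + C') * j\<^sup>2 = bqf_at Q z"
  proof -
    have "(A' * ((a * z + b) / j)\<^sup>2 + B' * ((a * z + b) / j) + C') * j\<^sup>2 =
        A' * (a * z + b)\<^sup>2 + B' * (a * z + b) * j + C' * j\<^sup>2"
      using j by (simp add: field_simps power2_eq_square)
    also have "\<dots> = (a * d - b * c)\<^sup>2 * (A * z\<^sup>2 + B * z + C)"
      unfolding A'_def B'_def C'_def j_def by (simp add: algebra_simps power2_eq_square)
    also have "\<dots> = bqf_at Q z"
      unfolding det by (simp add: bqf_at_def bqf_eval_def bqf.map_sel A_def B_def C_def)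
    finally show ?thesis .
  qed
  have m: "(2 * A' * ((a * z + b) / j) + B') * j = (2 * A * d - B * c) * z + (B * d - 2 * C * c)"
  proof -
    have "(2 * A' * ((a * z + b) / j) + B') * j = 2 * A' * (a * z + b) + B' * j"
      using j by (simp add: field_simps)
    also have "\<dots> = (a * d - b * c) * ((2 * A * d - B * c) * z + (B * d - 2 * C * c))"
      unfolding A'_def B'_def C'_def j_def by (simp add: algebra_simps power2_eq_square)
    finally show ?thesis unfolding det by simp
  qed
  have "phi (moebius g z) (bqf_act g Q) =
      ((A' * ((a * z + b) / j)\<^sup>2 + B' * ((a * z + b) / j) + C') * j\<^sup>2) / (j * ((2 * A' * ((a * z + b) / j) + B') * j))"
    unfolding phi_def at dat using j by (simp add: power2_eq_square)
  thus ?thesis unfolding n m by (simp add: j_def A_def B_def C_def)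
qed

text \<open>
  Both linear factors of the denominator are combinations of \<open>p = \<mu>' (z - w)\<close> and \<open>q = \<mu> (z - w')\<close>,
  namely \<open>q - p\<close> and \<open>q + p\<close> up to constants.
\<close>

lemma phi_partial_fractions:
  fixes z w w' \<mu> \<mu>' A c d :: complex
  assumes "\<mu> = c * w + d" "\<mu>' = c * w' + d" "A \<noteq> 0" "w \<noteq> w'"
  shows "A * (z - w) * (z - w') /
      ((c * z + d) * ((2 * A * d + A * (w + w') * c) * z + (- A * (w + w') * d - 2 * (A * (w * w')) * c))) =
     (w - w') * (z - w) * (z - w') / ((\<mu> * (z - w'))\<^sup>2 - (\<mu>' * (z - w))\<^sup>2)"
proof -
  define p q where "p = \<mu>' * (z - w)" and "q = \<mu> * (z - w')"
  have 1: "(w - w') * (c * z + d) = q - p"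
    unfolding p_def q_def assms(1,2) by (simp add: algebra_simps)
  have 2: "(2 * A * d + A * (w + w') * c) * z + (- A * (w + w') * d - 2 * (A * (w * w')) * c) = A * (q + p)"
    unfolding p_def q_def assms(1,2) by (simp add: algebra_simps)
  have "A * (z - w) * (z - w') / ((c * z + d) * (A * (q + p))) =
      (A * (w - w')) * ((z - w) * (z - w')) / ((A * (w - w')) * ((c * z + d) * (q + p)))"
    using assms(3,4) by simp
  also have "(A * (w - w')) * ((c * z + d) * (q + p)) = A * ((w - w') * (c * z + d) * (q + p))"
    by simp
  also have "\<dots> = A * (q\<^sup>2 - p\<^sup>2)" unfolding 1
    by (simp add: algebra_simps power2_eq_square)
  also have "(A * (w - w')) * ((z - w) * (z - w')) / (A * (q\<^sup>2 - p\<^sup>2)) = (w - w') * (z - w) * (z - w') / (q\<^sup>2 - p\<^sup>2)"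
    using assms(3) by simp
  finally show ?thesis unfolding 2 by (simp add: p_def q_def)
qed

context real_quadratic
begin

text \<open>
  The bottom rows of unimodular matrices, recorded as points of the lattice.
\<close>

definition prim :: "int bqf \<Rightarrow> real set" where
  "prim Q = {of_int d + of_int c * root1 Q | c d. coprime c d}"

text \<open>
  Left multiplication by powers of \<open>T\<close> is exactly what leaves the bottom row unchanged, and every
  coprime pair is a bottom row.
\<close>

lemma bij_prim_cosets:
  assumes disc: "bqf_disc Q = D"
  shows "bij_betw (\<lambda>X. (let g = (SOME g. g \<in> X) in of_int (g $ 2 $ 2) + of_int (g $ 2 $ 1) * root1 Q))
     (rcosets\<^bsub>SL2Z\<^esub> (generate SL2Z {T_mat})) (prim Q)"
proof -
  interpret group SL2Z by (rule group_SL2Z)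
  let ?H = "generate SL2Z {T_mat}"
  define r where "r g = of_int (g $ 2 $ 2) + of_int (g $ 2 $ 1) * root1 Q" for g :: "int ^ 2 ^ 2"
  define f where "f X = r (SOME g. g \<in> X)" for X
  have sub: "?H \<subseteq> carrier SL2Z"
    using generate_in_carrier[of "{T_mat}"] by (auto simp: SL2Z_def T_mat_def det_2)
  have sg: "subgroup ?H SL2Z" by (rule generate_is_subgroup) (auto simp: SL2Z_def T_mat_def det_2)
  have self: "g \<in> ?H #>\<^bsub>SL2Z\<^esub> g" if "det g = 1" for g
    using that subgroup.one_closed[OF sg]
      by (auto simp: r_coset_def SL2Z_def intro!: bexI[of _ "mat 1"])
  have coset: "?H #>\<^bsub>SL2Z\<^esub> g \<in> rcosets\<^bsub>SL2Z\<^esub> ?H" if "det g = 1"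
    for g
    using that by (auto simp: RCOSETS_def SL2Z_def)
  have mem: "(SOME g. g \<in> X) \<in> X" if X: "X \<in> rcosets\<^bsub>SL2Z\<^esub> ?H" for X
  proof -
    obtain a where "det a = 1" "X = ?H #>\<^bsub>SL2Z\<^esub> a" using X
      by (auto simp: RCOSETS_def SL2Z_def)
    thus ?thesis using self[of a] someI[of "\<lambda>g. g \<in> X" a] by simp
  qed
  have f_eq: "f X = r g" if "X \<in> rcosets\<^bsub>SL2Z\<^esub> ?H" "g \<in> X" for X g
    using coset_same_row[OF that(1) mem[OF that(1)] that(2)] by (simp add: f_def r_def)
  have r_eq: "r g = r h \<Longrightarrow> g $ 2 $ 1 = h $ 2 $ 1 \<and> g $ 2 $ 2 = h $ 2 $ 2"
    for g h
    using lat_coords_unique[OF disc] by (auto simp: r_def)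
  have "bij_betw f (rcosets\<^bsub>SL2Z\<^esub> ?H) (prim Q)"
    unfolding bij_betw_def
  proof
    show "inj_on f (rcosets\<^bsub>SL2Z\<^esub> ?H)"
    proof (rule inj_onI)
      fix X X' assume X: "X \<in> rcosets\<^bsub>SL2Z\<^esub> ?H" "X' \<in> rcosets\<^bsub>SL2Z\<^esub> ?H" "f X = f X'"
      define g h where "g = (SOME g. g \<in> X)" and "h = (SOME g. g \<in> X')"
      have gh: "g \<in> X" "h \<in> X'" using mem X by (auto simp: g_def h_def)
      have "r g = r h" using X(3) by (simp add: f_def g_def h_def)
      hence rows: "g $ 2 $ 1 = h $ 2 $ 1" "g $ 2 $ 2 = h $ 2 $ 2" using r_eq by blast+
      have dets: "det g = 1" "det h = 1" using coset_same_row(1) X(1,2) gh by blast+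
      obtain n where n: "g = mat2 1 n 0 1 ** h" using same_row_same_coset[OF dets rows] by blast
      have cs: "g \<in> carrier SL2Z" "h \<in> carrier SL2Z" using dets by (auto simp: SL2Z_def)
      have "g \<in> ?H #>\<^bsub>SL2Z\<^esub> h"
        unfolding r_coset_def n using unipotent_in_generate[of n] by (auto simp: SL2Z_def)
      moreover have "X = ?H #>\<^bsub>SL2Z\<^esub> g" "X' = ?H #>\<^bsub>SL2Z\<^esub> h"
      proof -
        obtain a where a: "a \<in> carrier SL2Z" "X = ?H #>\<^bsub>SL2Z\<^esub> a" using X(1)
          by (auto simp: RCOSETS_def)
        show "X = ?H #>\<^bsub>SL2Z\<^esub> g"
          using repr_independence[OF _ a(1) sg, of g] gh(1) a(2) by simp
        obtain b where b: "b \<in> carrier SL2Z" "X' = ?H #>\<^bsub>SL2Z\<^esub> b" using X(2)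
          by (auto simp: RCOSETS_def)
        show "X' = ?H #>\<^bsub>SL2Z\<^esub> h"
          using repr_independence[OF _ b(1) sg, of h] gh(2) b(2) by simp
      qed
      ultimately show "X = X'" using repr_independence[OF _ cs(2) sg, of g] by simp
    qed
    show "f ` (rcosets\<^bsub>SL2Z\<^esub> ?H) = prim Q"
    proof (intro equalityI subsetI)
      fix x assume "x \<in> f ` (rcosets\<^bsub>SL2Z\<^esub> ?H)"
      then obtain X where X: "X \<in> rcosets\<^bsub>SL2Z\<^esub> ?H" "x = f X" by blast
      have "det (SOME g. g \<in> X) = 1" using coset_same_row(1)[OF X(1) mem mem] X(1) by blast
      from row_coprime[OF this] show "x \<in> prim Q" unfolding X(2) f_def r_def prim_def by blast
    next
      fix x assume "x \<in> prim Q"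
      then obtain c d where cd: "x = of_int d + of_int c * root1 Q" "coprime c d"
        unfolding prim_def by blast
      obtain g :: "int ^ 2 ^ 2" where g: "det g = 1" "g $ 2 $ 1 = c" "g $ 2 $ 2 = d"
        using row_completion[OF cd(2)] .
      have "x = f (?H #>\<^bsub>SL2Z\<^esub> g)"
        using f_eq[OF coset[OF g(1)] self[OF g(1)]] g cd(1) by (simp add: r_def)
      thus "x \<in> f ` (rcosets\<^bsub>SL2Z\<^esub> ?H)" using coset[OF g(1)] by blast
    qed
  qed
  thus ?thesis by (simp add: f_def[abs_def] r_def Let_def)
qed

text \<open>
  The sign of \<open>A\<close> is the sign of \<open>w - w'\<close>, so that the argument of the logarithm lies in the upper half
  plane.
\<close>

definition strip_coord :: "int bqf \<Rightarrow> complex \<Rightarrow> complex" where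
  "strip_coord Q z = Ln (of_real (sgn (of_int (qA Q))) * ((z - of_real (root1 Q)) / (z - of_real (root2 Q))))"

lemma strip_coord_arg:
  assumes disc: "bqf_disc Q = D" and z: "z \<in> upper_half_plane"
  shows "Im (of_real (sgn (of_int (qA Q))) * ((z - of_real (root1 Q)) / (z - of_real (root2 Q)))) > 0"
proof -
  define w w' where "w = root1 Q" and "w' = root2 Q"
  have y: "Im z > 0" using z by (simp add: upper_half_plane_def)
  have A: "of_int (qA Q) \<noteq> (0::real)" using disc_A_nonzero[OF disc] by simp
  have ww: "w - w' = rD / of_int (qA Q)" using root_facts(3)[OF disc] A
    by (simp add: w_def w'_def field_simps)
  have "sgn (of_int (qA Q)) * (w - w') > 0" 
  proof -
    have "sgn (of_int (qA Q)) * (w - w') = rD / \<bar>of_int (qA Q)\<bar>"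
      unfolding ww by (auto simp: sgn_if abs_if)
    thus ?thesis using A rD_pos by simp
  qed
  hence pos: "sgn (of_int (qA Q)) * (Im z * (w - w')) > 0" using y by (simp add: mult.left_commute)
  have den: "(Re z - w')\<^sup>2 + (Im z)\<^sup>2 > 0" using y by (simp add: add_nonneg_pos)
  have "Im ((z - of_real w) / (z - of_real w')) = Im z * (w - w') / ((Re z - w')\<^sup>2 + (Im z)\<^sup>2)"
    by (simp add: Im_divide algebra_simps)
  note Im_quot = this
  have Im_scale: "Im (of_real r * u) = r * Im u" for r u by simp
  have "Im (of_real (sgn (of_int (qA Q))) * ((z - of_real w) / (z - of_real w'))) =
      sgn (of_int (qA Q)) * (Im z * (w - w')) / ((Re z - w')\<^sup>2 + (Im z)\<^sup>2)"
    unfolding Im_scale Im_quot by simp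
  thus ?thesis using pos den unfolding w_def w'_def by simp
qed

lemma strip_coord_strip:
  assumes "bqf_disc Q = D" "z \<in> upper_half_plane"
  shows "strip_coord Q z \<in> strip"
  using Im_Ln_pos_lt_imp[OF strip_coord_arg[OF assms]] by (simp add: strip_coord_def strip_def)

lemma upper_minus_real_nonzero: "z \<in> upper_half_plane \<Longrightarrow> z - of_real x \<noteq> 0"
  by (auto simp: upper_half_plane_def complex_eq_iff)

lemma bqf_at_factor:
  assumes disc: "bqf_disc Q = D"
  shows "bqf_at (map_bqf of_int Q) z = of_int (qA Q) * ((z - of_real (root1 Q)) * (z - of_real (root2 Q)))"
proof -
  have "of_int (qA Q) * ((z - of_real (root1 Q)) * (z - of_real (root2 Q))) =
     of_int (qA Q) * z\<^sup>2 - of_real (of_int (qA Q) * (root1 Q + root2 Q)) * z + of_real (of_int (qA Q) * (root1 Q * root2 Q))"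
    by (simp add: algebra_simps power2_eq_square)
  thus ?thesis unfolding root_facts[OF disc]
    by (simp add: bqf_at_def bqf_eval_def bqf.map_sel)
qed

lemma strip_coord_deriv:
  assumes disc: "bqf_disc Q = D" and z: "z \<in> upper_half_plane"
  shows "(strip_coord Q has_field_derivative of_real rD / bqf_at (map_bqf of_int Q) z) (at z)"
proof -
  define w w' where "w = complex_of_real (root1 Q)" and "w' = complex_of_real (root2 Q)"
  define e where "e = complex_of_real (sgn (of_int (qA Q)))"
  have A: "of_int (qA Q) \<noteq> (0::complex)" using disc_A_nonzero[OF disc] by simp
  have e: "e \<noteq> 0" using disc_A_nonzero[OF disc] by (simp add: e_def sgn_if)
  have nz: "z - w \<noteq> 0" "z - w' \<noteq> 0" unfolding w_def w'_def
    by (rule upper_minus_real_nonzero[OF z])+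
  have arg: "e * ((z - w) / (z - w')) \<notin> \<real>\<^sub>\<le>\<^sub>0"
    using strip_coord_arg[OF disc z] by (auto simp: e_def w_def w'_def complex_nonpos_Reals_iff)
  have inner: "((\<lambda>z. e * ((z - w) / (z - w'))) has_field_derivative e * ((w - w') / (z - w')\<^sup>2)) (at z)"
    using nz by (auto intro!: derivative_eq_intros simp: power2_eq_square algebra_simps)
  have "((\<lambda>z. Ln (e * ((z - w) / (z - w')))) has_field_derivative
      e * ((w - w') / (z - w')\<^sup>2) / (e * ((z - w) / (z - w')))) (at z)"
    using DERIV_chain2[OF has_field_derivative_Ln[OF arg] inner]
      by (simp add: divide_inverse mult.commute)
  also have "e * ((w - w') / (z - w')\<^sup>2) / (e * ((z - w) / (z - w'))) = (w - w') / ((z - w) * (z - w'))"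
    using e nz by (simp add: power2_eq_square)
  also have "\<dots> = (of_int (qA Q) * (w - w')) / (of_int (qA Q) * ((z - w) * (z - w')))"
    using A by simp
  also have "of_int (qA Q) * (w - w') = of_real rD"
    using arg_cong[OF root_facts(3)[OF disc], of complex_of_real] by (simp add: w_def w'_def)
  finally show ?thesis unfolding bqf_at_factor[OF disc]
    by (simp add: strip_coord_def[abs_def] e_def w_def w'_def)
qed

text \<open>
  In the notation of \<open>phi_partial_fractions\<close>, \<open>exp t\<close> is \<open>\<plusminus> p/q\<close>, the sign being that of \<open>A \<mu> \<mu>'\<close>. The same
  sign relates \<open>A \<mu> \<mu>'\<close> to its absolute value, and the two signs cancel.
\<close>

lemma phi_eq_kernel_base:
  fixes g :: "int ^ 2 ^ 2"
  assumes disc: "bqf_disc Q = D" and g: "det g = 1" and z: "z \<in> upper_half_plane"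
    and \<mu>: "\<mu> = of_int (g $ 2 $ 2) + of_int (g $ 2 $ 1) * root1 Q"
  defines "t \<equiv> strip_coord Q z + of_real (ratio_log \<mu>)"
  shows "phi (moebius g z) (bqf_act g (map_bqf of_int Q)) =
     of_real (rD / form_value Q \<mu>) * (1 / (exp (- t) - exp t))"
proof -
  define A where "A = (of_int (qA Q) :: real)"
  define c d where "c = (of_int (g $ 2 $ 1) :: real)" and "d = (of_int (g $ 2 $ 2) :: real)"
  define w w' where "w = root1 Q" and "w' = root2 Q"
  have A: "A \<noteq> 0" using disc_A_nonzero[OF disc] by (simp add: A_def)
  have \<mu>': "cj \<mu> = c * w' + d"
    unfolding \<mu> c_def d_def w'_def by (simp add: cj_add cj_mult K_intros root1_K cj_root1)
  have \<mu>_eq: "\<mu> = c * w + d" by (simp add: \<mu> c_def d_def w_def)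
  have \<mu>K: "\<mu> \<in> K" unfolding \<mu> by (intro K_intros root1_K)
  have \<mu>0: "\<mu> \<noteq> 0"
  proof
    assume "\<mu> = 0"
    hence "g $ 2 $ 2 = 0 \<and> g $ 2 $ 1 = 0"
      using lat_coords_unique[OF disc, of "g $ 2 $ 2" "g $ 2 $ 1" 0 0] by (simp add: \<mu>)
    thus False using g by (simp add: det_2)
  qed
  have \<mu>'0: "cj \<mu> \<noteq> 0" using \<mu>0 \<mu>K by (simp add: cj_eq_0_iff)
  have rf: "A * (w + w') = - of_int (qB Q)" "A * (w * w') = of_int (qC Q)" "A * (w - w') = rD"
    using root_facts[OF disc] by (simp_all add: A_def w_def w'_def)
  have ww: "w \<noteq> w'" using rf(3) rD_pos by auto
  define W W' M M' :: complex where "W = of_real w" and "W' = of_real w'" and "M = of_real \<mu>"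
    and "M' = of_real (cj \<mu>)"
  have nz: "z - W \<noteq> 0" "z - W' \<noteq> 0" unfolding W_def W'_def
    by (rule upper_minus_real_nonzero[OF z])+
  have M0: "M \<noteq> 0" "M' \<noteq> 0" using \<mu>0 \<mu>'0 by (simp_all add: M_def M'_def)
  define p q where "p = M' * (z - W)" and "q = M * (z - W')"
  have pq0: "p \<noteq> 0" "q \<noteq> 0" using nz M0 by (simp_all add: p_def q_def)
  have B: "complex_of_real (of_int (qB Q)) = - (of_real A * (W + W'))"
    using arg_cong[OF rf(1), of complex_of_real] by (simp add: W_def W'_def)
  have C: "complex_of_real (of_int (qC Q)) = of_real A * (W * W')"
    using arg_cong[OF rf(2), of complex_of_real] by (simp add: W_def W'_def)
  have "phi (moebius g z) (bqf_act g (map_bqf of_int Q)) =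
    of_real A * (z - W) * (z - W') / ((of_real c * z + of_real d) *
      ((2 * of_real A * of_real d + of_real A * (W + W') * of_real c) * z + (- of_real A * (W + W') * of_real d - 2 * (of_real A * (W * W')) * of_real c)))"
    unfolding phi_transform[OF g z] bqf_at_factor[OF disc] using B C
    by (simp add: bqf.map_sel A_def c_def d_def W_def W'_def w_def w'_def mult.assoc)
  also have "\<dots> = (W - W') * (z - W) * (z - W') / ((M * (z - W'))\<^sup>2 - (M' * (z - W))\<^sup>2)"
  proof (rule phi_partial_fractions)
    show "M = of_real c * W + of_real d" by (simp add: M_def W_def \<mu>_eq)
    show "M' = of_real c * W' + of_real d" by (simp add: M'_def W'_def \<mu>')
  qed (use A ww in \<open>simp_all add: W_def W'_def\<close>)
  also have "\<dots> = (W - W') * (z - W) * (z - W') / (q\<^sup>2 - p\<^sup>2)"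
    by (simp add: p_def q_def)
  finally have lhs: "phi (moebius g z) (bqf_act g (map_bqf of_int Q)) =
    (W - W') * (z - W) * (z - W') / (q\<^sup>2 - p\<^sup>2)" .
  \<comment> \<open>The sign that relates \<open>exp t\<close> to \<open>p/q\<close>, and \<open>A \<mu> \<mu>'\<close> to its absolute value.\<close>
  define e where "e = sgn (A * (\<mu> * cj \<mu>))"
  have e: "e * e = 1" "e \<noteq> 0" using A \<mu>0 \<mu>'0 by (auto simp: e_def sgn_if)
  have N: "A * (\<mu> * cj \<mu>) = e * \<bar>A * (\<mu> * cj \<mu>)\<bar>"
    by (simp add: e_def sgn_mult_abs)
  have expt: "exp t = of_real e * (p / q)"
  proof -
    have nz': "of_real (sgn (of_int (qA Q))) * ((z - of_real (root1 Q)) / (z - of_real (root2 Q))) \<noteq> 0"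
      using strip_coord_arg[OF disc z] by auto
    have "exp (strip_coord Q z) = of_real (sgn A) * ((z - W) / (z - W'))"
      unfolding strip_coord_def exp_Ln[OF nz'] by (simp add: A_def W_def W'_def w_def w'_def)
    moreover have "exp (complex_of_real (ratio_log \<mu>)) = of_real \<bar>cj \<mu> / \<mu>\<bar>"
      unfolding ratio_log_def using \<mu>0 \<mu>'0 by (simp add: exp_of_real)
    moreover have "\<bar>cj \<mu> / \<mu>\<bar> = sgn (\<mu> * cj \<mu>) * (cj \<mu> / \<mu>)"
      using \<mu>0 \<mu>'0
        by (auto simp: abs_if sgn_if zero_less_mult_iff mult_less_0_iff divide_less_0_iff)
    ultimately have "exp t = of_real (sgn A) * ((z - W) / (z - W')) * of_real (sgn (\<mu> * cj \<mu>) * (cj \<mu> / \<mu>))"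
      by (simp only: t_def exp_add)
    also have "\<dots> = of_real (sgn A * sgn (\<mu> * cj \<mu>)) * (p / q)"
      by (simp add: p_def q_def M_def M'_def mult_ac)
    finally show ?thesis by (simp add: e_def sgn_mult)
  qed
  have expmt: "exp (- t) = of_real e * (q / p)"
  proof -
    have "of_real e * of_real e = (1::complex)" using e(1) by (metis of_real_1 of_real_mult)
    hence "(of_real e * (q / p)) * (of_real e * (p / q)) = 1" using pq0
      by (simp add: mult.assoc mult.left_commute)
    hence "(of_real e * (q / p)) * exp t = 1" unfolding expt .
    thus ?thesis by (metis exp_minus inverse_unique mult.commute)
  qed
  have "exp (- t) - exp t = of_real e * ((q\<^sup>2 - p\<^sup>2) / (p * q))"
    unfolding expt expmt using pq0 by (simp add: field_simps power2_eq_square)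
  hence "of_real (rD / \<bar>A * (\<mu> * cj \<mu>)\<bar>) * (1 / (exp (- t) - exp t)) =
      of_real (rD / \<bar>A * (\<mu> * cj \<mu>)\<bar> / e) * (p * q / (q\<^sup>2 - p\<^sup>2))" by simp
  also have "rD / \<bar>A * (\<mu> * cj \<mu>)\<bar> / e = (w - w') / (\<mu> * cj \<mu>)"
  proof -
    have "rD / \<bar>A * (\<mu> * cj \<mu>)\<bar> / e = rD / (e * \<bar>A * (\<mu> * cj \<mu>)\<bar>)" by (simp add: mult.commute)
    also have "\<dots> = (A * (w - w')) / (A * (\<mu> * cj \<mu>))" unfolding N[symmetric] rf(3) ..
    finally show ?thesis using A by simp
  qed
  also have "of_real ((w - w') / (\<mu> * cj \<mu>)) * (p * q / (q\<^sup>2 - p\<^sup>2)) =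
      (W - W') * (z - W) * (z - W') / (q\<^sup>2 - p\<^sup>2)"
  proof -
    have "of_real ((w - w') / (\<mu> * cj \<mu>)) * (p * q) = (W - W') * (z - W) * (z - W')"
      using M0 by (simp add: p_def q_def M_def M'_def W_def W'_def)
    thus ?thesis by (simp only: times_divide_eq_right)
  qed
  finally show ?thesis unfolding lhs by (simp add: A_def)
qed

section \<open>The cycle integral as a lattice sum\<close>

lemma prim_lat: "prim Q \<subseteq> lat Q"
proof
  fix x assume "x \<in> prim Q"
  then obtain c d where "x = of_int d * 1 + of_int c * root1 Q" unfolding prim_def by auto
  thus "x \<in> lat Q" unfolding lat_def by (rule zspanI')
qed

lemma lat_coords: "x \<in> lat Q \<longleftrightarrow> (\<exists>m n. x = of_int m + of_int n * root1 Q)"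
  unfolding lat_def zspan_def by simp

lemma prim_nonzero:
  assumes disc: "bqf_disc Q = D" and "x \<in> prim Q" shows "x \<noteq> 0"
proof
  assume x: "x = 0"
  obtain c d where cd: "x = of_int d + of_int c * root1 Q" "coprime c d" using assms(2)
    unfolding prim_def by blast
  have "d = 0 \<and> c = 0" using lat_coords_unique[OF disc, of d c 0 0] cd(1) x by simp
  thus False using cd(2) by simp
qed

text \<open>
  This description of the primitive points is visibly invariant under multiplication by units.
\<close>

lemma prim_iff:
  assumes disc: "bqf_disc Q = D"
  shows "x \<in> prim Q \<longleftrightarrow> x \<in> lat Q \<and> (\<forall>k::int. k \<noteq> 0 \<longrightarrow> x / of_int k \<in> lat Q \<longrightarrow> \<bar>k\<bar> = 1)"
proof (cases "x \<in> lat Q")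
  case True
  then obtain d c where x: "x = of_int d + of_int c * root1 Q" unfolding lat_coords by blast
  have prim: "x \<in> prim Q \<longleftrightarrow> coprime c d"
    unfolding prim_def mem_Collect_eq x lat_coords_unique[OF disc] by blast
  have div: "x / of_int k \<in> lat Q \<longleftrightarrow> k dvd d \<and> k dvd c" if k: "k \<noteq> 0" for k
  proof
    assume "x / of_int k \<in> lat Q"
    then obtain m n where "x / of_int k = of_int m + of_int n * root1 Q" unfolding lat_coords
      by blast
    hence "x = of_int (k * m) + of_int (k * n) * root1 Q" using k by (simp add: field_simps)
    hence "d = k * m \<and> c = k * n" using lat_coords_unique[OF disc] x by metis
    thus "k dvd d \<and> k dvd c" by simp
  next
    assume "k dvd d \<and> k dvd c"
    then obtain m n where "d = k * m" "c = k * n" by (auto simp: dvd_def)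
    hence "x / of_int k = of_int m + of_int n * root1 Q" using k by (simp add: x field_simps)
    thus "x / of_int k \<in> lat Q" unfolding lat_coords by blast
  qed
  have "coprime c d \<longleftrightarrow> (\<forall>k. k \<noteq> 0 \<longrightarrow> k dvd d \<and> k dvd c \<longrightarrow> \<bar>k\<bar> = 1)"
  proof
    assume "coprime c d"
    thus "\<forall>k. k \<noteq> 0 \<longrightarrow> k dvd d \<and> k dvd c \<longrightarrow> \<bar>k\<bar> = 1"
      by (meson coprime_common_divisor_int)
  next
    assume *: "\<forall>k. k \<noteq> 0 \<longrightarrow> k dvd d \<and> k dvd c \<longrightarrow> \<bar>k\<bar> = 1"
    \<comment> \<open>If \<open>c\<close> and \<open>d\<close> vanish, then 2 is a common divisor.\<close>
    have "gcd c d \<noteq> 0"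
    proof
      assume "gcd c d = 0"
      hence "2 dvd d \<and> 2 dvd c" by simp
      thus False using *[rule_format, of 2] by simp
    qed
    hence "\<bar>gcd c d\<bar> = 1" using *[rule_format, of "gcd c d"] by simp
    thus "coprime c d" unfolding coprime_iff_gcd_eq_1 by (metis abs_gcd_int)
  qed
  thus ?thesis using True prim div by simp
next
  case False
  thus ?thesis using prim_lat by blast
qed

lemma prim_eps_mult:
  assumes disc: "bqf_disc Q = D" and x: "x \<in> prim Q"
  shows "x * eps powi n \<in> prim Q"
proof -
  have mult: "y * eps powi m \<in> lat Q" if "y \<in> lat Q" for y m
    using frac_idealD(3)[OF lat_frac_ideal[OF disc] eps_powi_O that, of m]
      by (simp add: mult.commute)
  have "\<bar>k\<bar> = 1" if k: "k \<noteq> 0" "x * eps powi n / of_int k \<in> lat Q" for k :: int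
  proof -
    have inv: "eps powi n * eps powi (- n) = 1" using eps_gt_1 by (simp add: power_int_minus)
    have "(x * eps powi n / of_int k) * eps powi (- n) = x / of_int k * (eps powi n * eps powi (- n))" by simp
    hence "x / of_int k \<in> lat Q" using mult[OF k(2), of "- n"] unfolding inv
      by (simp only: mult_1_right)
    thus ?thesis using x k(1) prim_iff[OF disc] by blast
  qed
  moreover have "x * eps powi n \<in> lat Q" using mult x prim_lat by blast
  ultimately show ?thesis using prim_iff[OF disc] by blast
qed

definition weight :: "int bqf \<Rightarrow> complex \<Rightarrow> real \<Rightarrow> complex" where
  "weight Q s x = of_real (rD / form_value Q x) powr s"

lemma weight_arg_pos:
  assumes disc: "bqf_disc Q = D" and x: "x \<in> K" "x \<noteq> 0"
  shows "form_value Q x > 0" "rD / form_value Q x > 0"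
proof -
  show "form_value Q x > 0" using disc_A_nonzero[OF disc] x by (simp add: cj_eq_0_iff)
  thus "rD / form_value Q x > 0" using rD_pos by simp
qed

lemma F_as_lattice_sum:
  assumes disc: "bqf_disc Q = D" and z: "z \<in> upper_half_plane"
  shows "F (map_bqf of_int Q) s z =
    (\<Sum>\<^sub>\<infinity>x\<in>prim Q. weight Q s x * strip_kernel s (strip_coord Q z + of_real (ratio_log x)))"
proof -
  define row where "row = (\<lambda>X. (let g = (SOME g :: int ^ 2 ^ 2. g \<in> X) in of_int (g $ 2 $ 2) + of_int (g $ 2 $ 1) * root1 Q))"
  define C where "C = rcosets\<^bsub>SL2Z\<^esub> (generate SL2Z {T_mat})"
  have bij: "bij_betw row C (prim Q)" unfolding row_def C_def by (rule bij_prim_cosets[OF disc])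
  have "F (map_bqf of_int Q) s z = (\<Sum>\<^sub>\<infinity>X\<in>C. weight Q s (row X) * strip_kernel s (strip_coord Q z + of_real (ratio_log (row X))))"
    unfolding F_def C_def[symmetric]
  proof (rule infsum_cong)
    fix X assume X: "X \<in> C"
    define g where "g = (SOME g. g \<in> X)"
    obtain a where a: "det a = 1" "X = generate SL2Z {T_mat} #>\<^bsub>SL2Z\<^esub> a"
      using X by (auto simp: C_def RCOSETS_def SL2Z_def)
    have "mat 1 ** a \<in> X" unfolding a(2) r_coset_def
      using generate.one[of SL2Z "{T_mat}"] by (force simp: SL2Z_def)
    hence gX: "g \<in> X" unfolding g_def by (rule someI)
    have det: "det g = 1" using coset_same_row(1)[OF X[unfolded C_def] gX gX] .
    have row: "row X = of_int (g $ 2 $ 2) + of_int (g $ 2 $ 1) * root1 Q"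
      by (simp add: row_def g_def Let_def)
    have xp: "row X \<in> prim Q" using bij X by (auto simp: bij_betw_def)
    hence x: "row X \<in> K" "row X \<noteq> 0" using prim_lat lat_K prim_nonzero[OF disc] by blast+
    define t where "t = strip_coord Q z + of_real (ratio_log (row X))"
    have ts: "t \<in> strip" using strip_coord_strip[OF disc z] by (simp add: t_def strip_add_real)
    have "the_elem ((\<lambda>g. phi (moebius g z) (bqf_act g (map_bqf of_int Q)) powr s) ` X) =
        phi (moebius g z) (bqf_act g (map_bqf of_int Q)) powr s"
      by (rule coset_term_unique[OF X[unfolded C_def] gX z])
    also have "\<dots> = (of_real (rD / form_value Q (row X)) * (1 / (exp (- t) - exp t))) powr s"
      unfolding phi_eq_kernel_base[OF disc det z row] t_def ..
    also have "\<dots> = weight Q s (row X) * strip_kernel s t"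
      unfolding weight_def strip_kernel_def
      by (rule powr_of_real_mult[OF weight_arg_pos(2)[OF disc x]]) (use kernel_base_upper[OF ts] in auto)
    finally show "the_elem ((\<lambda>g. phi (moebius g z) (bqf_act g (map_bqf of_int Q)) powr s) ` X) =
       weight Q s (row X) * strip_kernel s (strip_coord Q z + of_real (ratio_log (row X)))" unfolding t_def .
  qed
  also have "\<dots> = (\<Sum>\<^sub>\<infinity>x\<in>prim Q. weight Q s x * strip_kernel s (strip_coord Q z + of_real (ratio_log x)))"
    by (rule infsum_reindex_bij_betw[OF bij])
  finally show ?thesis .
qed

lemma exp_ratio_log: 
  assumes "x \<in> K" "x \<noteq> 0" shows "exp (ratio_log x) = \<bar>cj x\<bar> / \<bar>x\<bar>" "exp (- ratio_log x) = \<bar>x\<bar> / \<bar>cj x\<bar>"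
  using assms by (simp_all add: ratio_log_def exp_minus cj_eq_0_iff)

text \<open>
  The sum is that of \<open>(\<bar>A\<bar> (x\<^sup>2 + x'\<^sup>2) / \<surd>D)\<close> to the power \<open>- Re s\<close>, because
  \<open>\<bar>x x'\<bar> (\<bar>x'/x\<bar> + \<bar>x/x'\<bar>) = x\<^sup>2 + x'\<^sup>2\<close>.
\<close>

lemma weight_summable:
  assumes disc: "bqf_disc Q = D" and s: "Re s > 1"
  shows "(\<lambda>x. norm (weight Q s x) * (exp (ratio_log x) + exp (- ratio_log x)) powr (- Re s)) summable_on prim Q"
proof -
  define A where "A = \<bar>of_int (qA Q) :: real\<bar>"
  have A: "A > 0" using disc_A_nonzero[OF disc] by (simp add: A_def)
  have "(\<lambda>x. (rD / A) powr Re s * (x\<^sup>2 + (cj x)\<^sup>2) powr (- Re s)) summable_on prim Q"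
    using prim_lat prim_nonzero[OF disc]
    by (intro summable_on_cmult_right summable_on_subset[OF lat_sum_converges[OF disc s]]) auto
  thus ?thesis
  proof (rule summable_on_cong[THEN iffD1, rotated])
    fix x assume "x \<in> prim Q"
    hence x: "x \<in> K" "x \<noteq> 0" using prim_lat lat_K prim_nonzero[OF disc] by blast+
    define N where "N = \<bar>x * cj x\<bar>"
    define S where "S = x\<^sup>2 + (cj x)\<^sup>2"
    have N: "N > 0" using x by (simp add: N_def cj_eq_0_iff)
    have S: "S > 0" using x by (simp add: S_def sum_power2_gt_zero_iff)
    have "exp (ratio_log x) + exp (- ratio_log x) = (\<bar>cj x\<bar> * \<bar>cj x\<bar> + \<bar>x\<bar> * \<bar>x\<bar>) / (\<bar>x\<bar> * \<bar>cj x\<bar>)"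
      unfolding exp_ratio_log[OF x] using x by (simp add: field_simps cj_eq_0_iff)
    also have "\<dots> = S / N" by (simp add: S_def N_def abs_mult power2_eq_square add.commute)
    finally have e: "exp (ratio_log x) + exp (- ratio_log x) = S / N" .
    have "norm (weight Q s x) = (rD / (A * N)) powr Re s"
      unfolding weight_def using weight_arg_pos(2)[OF disc x]
      by (subst norm_powr_real_powr) (simp_all add: A_def N_def abs_mult)
    also have "\<dots> = (rD / A) powr Re s * N powr (- Re s)"
      using A N rD_pos by (simp add: powr_divide powr_mult powr_minus_divide)
    finally have w: "norm (weight Q s x) = (rD / A) powr Re s * N powr (- Re s)" .
    have "(S / N) powr (- Re s) = S powr (- Re s) * N powr (Re s)"
      using S N by (simp add: powr_divide powr_minus_divide)
    moreover have "N powr (- Re s) * N powr (Re s) = 1" using N by (simp add: powr_minus_divide)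
    ultimately show "(rD / A) powr Re s * (x\<^sup>2 + (cj x)\<^sup>2) powr (- Re s) =
        norm (weight Q s x) * (exp (ratio_log x) + exp (- ratio_log x)) powr (- Re s)"
      unfolding e w S_def[symmetric] by (simp add: mult_ac)
  qed
qed

lemma weight_eps_mult:
  assumes "x \<in> K" shows "weight Q s (x * eps powi n) = weight Q s x"
proof -
  have "(x * eps powi n) * cj (x * eps powi n) = (x * cj x) * (eps powi n * cj (eps powi n))"
    using assms by (simp add: cj_mult eps_powi_K)
  hence norm: "(x * eps powi n) * cj (x * eps powi n) = x * cj x" unfolding eps_powi_norm by simp
  show ?thesis unfolding weight_def norm ..
qed

lemma period_sum_form:
  assumes disc: "bqf_disc Q = D" and s: "Re s > 1"
  shows "period_sum (prim Q) (weight Q s) ratio_log (\<lambda>n x. x * eps powi (- n)) period s"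
proof
  have e: "eps \<noteq> 0" using eps_gt_1 by simp
  have x: "x \<in> K" "x \<noteq> 0" if "x \<in> prim Q" for x
    using that prim_lat lat_K prim_nonzero[OF disc] by blast+
  show "period > 0" by (rule period_pos)
  show "Re s > 0" using s by simp
  show "(\<lambda>x. norm (weight Q s x) * (exp (ratio_log x) + exp (- ratio_log x)) powr (- Re s)) summable_on prim Q"
    by (rule weight_summable[OF disc s])
  show "x * eps powi (- n) \<in> prim Q" if "x \<in> prim Q" for n x
    by (rule prim_eps_mult[OF disc that])
  show "x * eps powi (- n) * eps powi (- m) = x * eps powi (- (m + n))" for m n x
  proof -
    have "eps powi (- n + - m) = eps powi (- n) * eps powi (- m)" using e
      by (intro power_int_add) auto
    moreover have "- n + - m = - (m + n)" by simp
    ultimately show ?thesis by (simp only: mult.assoc)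
  qed
  show "x * eps powi (- 0) = x" for x by simp
  show "weight Q s (x * eps powi (- n)) = weight Q s x" if "x \<in> prim Q" for n x
    by (rule weight_eps_mult[OF x(1)[OF that]])
  show "ratio_log (x * eps powi (- n)) = ratio_log x + period * of_int n" if "x \<in> prim Q"
    for n x
    using x[OF that] e by (simp add: ratio_log_mult eps_powi_K ratio_log_eps_powi)
qed

lemma gamma_mat_entries:
  assumes disc: "bqf_disc Q = D"
  shows "of_int (gamma_mat Q $ 1 $ 1) = (of_int pell_v - of_int pell_u * of_int (qB Q)) / (2::real)"
    "gamma_mat Q $ 1 $ 2 = - pell_u * qC Q" "gamma_mat Q $ 2 $ 1 = pell_u * qA Q"
    "of_int (gamma_mat Q $ 2 $ 2) = (of_int pell_v + of_int pell_u * of_int (qB Q)) / (2::real)"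
proof -
  have mp: "min_pell D = (pell_v, pell_u)" by (simp add: pell_v_def pell_u_def)
  have g: "gamma_mat Q = mat2 ((pell_v - pell_u * qB Q) div 2) (- pell_u * qC Q) (pell_u * qA Q) ((pell_v + pell_u * qB Q) div 2)"
    unfolding gamma_mat_def disc mp by simp
  have ev: "even (pell_v - pell_u * qB Q)" "even (pell_v + pell_u * qB Q)"
    using pell_parity[of pell_v Q pell_u] min_pell_props(3) disc by simp_all
  have h: "of_int (n div 2) = (of_int n / 2 :: real)" if "even n" for n :: int
    using that by (auto elim: evenE)
  show "of_int (gamma_mat Q $ 1 $ 1) = (of_int pell_v - of_int pell_u * of_int (qB Q)) / (2::real)"
    "of_int (gamma_mat Q $ 2 $ 2) = (of_int pell_v + of_int pell_u * of_int (qB Q)) / (2::real)"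
    unfolding g mat2_nth h[OF ev(1)] h[OF ev(2)] by simp_all
  show "gamma_mat Q $ 1 $ 2 = - pell_u * qC Q" "gamma_mat Q $ 2 $ 1 = pell_u * qA Q"
    unfolding g mat2_nth by simp_all
qed

text \<open>
  The root \<open>r\<close> is a fixed point of \<open>\<gamma>\<^sub>Q\<close>, and \<open>e\<close> is the eigenvalue for the left eigenvector \<open>(1, -r)\<close>.
\<close>

lemma gamma_mat_fixes_root:
  fixes r e :: real
  assumes disc: "bqf_disc Q = D"
    and r: "of_int (qA Q) * (r * r) = - of_int (qB Q) * r - of_int (qC Q)"
    and e: "e = of_int (gamma_mat Q $ 1 $ 1) - r * of_int (gamma_mat Q $ 2 $ 1)"
    and z: "of_int (gamma_mat Q $ 2 $ 1) * z + of_int (gamma_mat Q $ 2 $ 2) \<noteq> (0::complex)"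
  shows "moebius (gamma_mat Q) z - of_real r =
    of_real e * (z - of_real r) / (of_int (gamma_mat Q $ 2 $ 1) * z + of_int (gamma_mat Q $ 2 $ 2))"
proof -
  define a b c d where "a = gamma_mat Q $ 1 $ 1" "b = gamma_mat Q $ 1 $ 2" "c = gamma_mat Q $ 2 $ 1" "d = gamma_mat Q $ 2 $ 2"
  note defs = this
  have "of_int b - r * of_int d + e * r = (of_int a - of_int d) * r + of_int b - of_int c * (r * r)"
    unfolding e defs by (simp add: algebra_simps)
  also have "of_int a - of_int d = - of_int pell_u * (of_int (qB Q) :: real)"
    unfolding defs gamma_mat_entries[OF disc] by (simp add: field_simps)
  also have "of_int c * (r * r) = of_int pell_u * (of_int (qA Q) * (r * r))"
    unfolding defs gamma_mat_entries[OF disc] by simp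
  also have "- of_int pell_u * of_int (qB Q) * r + of_int b - of_int pell_u * (of_int (qA Q) * (r * r)) = 0"
    unfolding r defs gamma_mat_entries[OF disc] by (simp add: algebra_simps)
  finally have "of_int b - r * of_int d = - (e * r)" by simp
  hence bd: "complex_of_real (of_int b - r * of_int d) = - (of_real e * of_real r)" by simp
  have e': "complex_of_real e = of_int a - of_real r * of_int c" unfolding e defs by simp
  have "moebius (gamma_mat Q) z - of_real r =
      ((of_int a * z + of_int b) - of_real r * (of_int c * z + of_int d)) / (of_int c * z + of_int d)"
    using z unfolding moebius_def defs[symmetric] by (simp add: divide_simps)
  also have "(of_int a * z + of_int b) - of_real r * (of_int c * z + of_int d) =
      (of_int a - of_real r * of_int c) * z + of_real (of_int b - r * of_int d)"
    by (simp add: algebra_simps)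
  also have "\<dots> = of_real e * (z - of_real r)" unfolding bd e'[symmetric]
    by (simp add: algebra_simps)
  finally show ?thesis unfolding defs .
qed

lemma gamma_mat_denominator_nonzero:
  assumes disc: "bqf_disc Q = D" and z: "z \<in> upper_half_plane"
  shows "of_int (gamma_mat Q $ 2 $ 1) * z + of_int (gamma_mat Q $ 2 $ 2) \<noteq> (0::complex)"
proof
  assume "of_int (gamma_mat Q $ 2 $ 1) * z + of_int (gamma_mat Q $ 2 $ 2) = (0::complex)"
  hence "Im (of_int (gamma_mat Q $ 2 $ 1) * z + of_int (gamma_mat Q $ 2 $ 2)) = 0" by simp
  hence "gamma_mat Q $ 2 $ 1 = 0" using z by (simp add: upper_half_plane_def)
  thus False using disc_A_nonzero[OF disc] min_pell_props(2)
    by (simp add: gamma_mat_entries[OF disc])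
qed

lemma det_gamma_mat:
  assumes disc: "bqf_disc Q = D" shows "det (gamma_mat Q) = 1"
proof -
  have D: "of_int D = ((of_int (qB Q))\<^sup>2 - 4 * of_int (qA Q) * of_int (qC Q) :: real)"
    using arg_cong[OF disc, of "of_int :: int \<Rightarrow> real"] by (simp add: bqf_disc_def)
  have P: "(of_int pell_v)\<^sup>2 - of_int D * (of_int pell_u)\<^sup>2 = (4::real)"
    using arg_cong[OF min_pell_props(3), of "of_int :: int \<Rightarrow> real"] by simp
  have "of_int (det (gamma_mat Q)) = ((of_int pell_v)\<^sup>2 - ((of_int (qB Q))\<^sup>2 - 4 * of_int (qA Q) * of_int (qC Q)) * (of_int pell_u)\<^sup>2) / (4::real)"
    unfolding det_2 of_int_diff of_int_mult gamma_mat_entries[OF disc]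
      by (simp add: field_simps power2_eq_square)
  hence "of_int (det (gamma_mat Q)) = (1::real)" unfolding D[symmetric] P by simp
  thus ?thesis by (metis of_int_1 of_int_eq_iff)
qed

lemma moebius_upper:
  fixes g :: "int ^ 2 ^ 2"
  assumes g: "det g = 1" and z: "z \<in> upper_half_plane"
  shows "moebius g z \<in> upper_half_plane"
proof -
  define a b c d where "a = real_of_int (g $ 1 $ 1)" "b = real_of_int (g $ 1 $ 2)" "c = real_of_int (g $ 2 $ 1)" "d = real_of_int (g $ 2 $ 2)"
  note defs = this
  have y: "Im z > 0" using z by (simp add: upper_half_plane_def)
  have "real_of_int (g $ 1 $ 1 * g $ 2 $ 2 - g $ 1 $ 2 * g $ 2 $ 1) = 1" using g
    by (simp only: det_2 of_int_1)
  hence det: "a * d - b * c = 1" by (simp add: defs)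
  have j: "of_int (g $ 2 $ 1) * z + of_int (g $ 2 $ 2) \<noteq> 0"
    by (rule moebius_denominator_nonzero[OF z row_coprime[OF g]])
  define w where "w = of_int (g $ 2 $ 1) * z + of_int (g $ 2 $ 2)"
  have "Im (moebius g z) = (a * d - b * c) * Im z / ((Re w)\<^sup>2 + (Im w)\<^sup>2)"
    unfolding moebius_def w_def[symmetric] Im_divide
    by (simp add: w_def defs algebra_simps)
  moreover have "(Re w)\<^sup>2 + (Im w)\<^sup>2 > 0" using j unfolding w_def[symmetric]
    by (simp add: sum_power2_gt_zero_iff complex_eq_iff)
  ultimately show ?thesis using y by (simp add: det upper_half_plane_def)
qed

text \<open>
  The eigenvalues at the two fixed points are the conjugate of \<open>\<epsilon>\<close> and \<open>\<epsilon>\<close>, so \<open>\<gamma>\<^sub>Q\<close> multiplies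
  \<open>(z - w)/(z - w')\<close> by \<open>1/\<epsilon>\<^sup>2\<close>.
\<close>

lemma strip_coord_gamma:
  assumes disc: "bqf_disc Q = D" and z: "z \<in> upper_half_plane"
  shows "strip_coord Q (moebius (gamma_mat Q) z) = strip_coord Q z - of_real period"
proof -
  define w w' where "w = root1 Q" and "w' = root2 Q"
  define j where "j = of_int (gamma_mat Q $ 2 $ 1) * z + (of_int (gamma_mat Q $ 2 $ 2) :: complex)"
  have j: "j \<noteq> 0" unfolding j_def by (rule gamma_mat_denominator_nonzero[OF disc z])
  have e0: "eps > 0" using eps_gt_1 by simp
  have 1: "moebius (gamma_mat Q) z - of_real w = of_real (cj eps) * (z - of_real w) / j"
    unfolding j_def
  proof (rule gamma_mat_fixes_root[OF disc _ _ j[unfolded j_def]])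
    show "of_int (qA Q) * (w * w) = - of_int (qB Q) * w - of_int (qC Q)"
      unfolding w_def by (rule root1_quadratic[OF disc])
    have "of_int (gamma_mat Q $ 1 $ 1) - w * of_int (gamma_mat Q $ 2 $ 1) =
        (of_int pell_v - of_int pell_u * of_int (qB Q)) / 2 - of_int pell_u * (of_int (qA Q) * w)"
      unfolding gamma_mat_entries[OF disc] by simp
    also have "of_int (qA Q) * w = (- of_int (qB Q) + rD) / 2"
      using disc_A_nonzero[OF disc] by (simp add: w_def root1_def)
    finally show "cj eps = of_int (gamma_mat Q $ 1 $ 1) - w * of_int (gamma_mat Q $ 2 $ 1)"
      unfolding cj_eps by (simp add: field_simps)
  qed
  have 2: "moebius (gamma_mat Q) z - of_real w' = of_real eps * (z - of_real w') / j"
    unfolding j_def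
  proof (rule gamma_mat_fixes_root[OF disc _ _ j[unfolded j_def]])
    have "of_int (qA Q) * (w' * w') = of_int (qA Q) * (root1 Q + root2 Q) * w' - of_int (qA Q) * (root1 Q * root2 Q)"
      by (simp add: w'_def algebra_simps)
    thus "of_int (qA Q) * (w' * w') = - of_int (qB Q) * w' - of_int (qC Q)"
      by (simp only: root_facts[OF disc])
    have "of_int (gamma_mat Q $ 1 $ 1) - w' * of_int (gamma_mat Q $ 2 $ 1) =
        (of_int pell_v - of_int pell_u * of_int (qB Q)) / 2 - of_int pell_u * (of_int (qA Q) * w')"
      unfolding gamma_mat_entries[OF disc] by simp
    also have "of_int (qA Q) * w' = (- of_int (qB Q) - rD) / 2"
      using disc_A_nonzero[OF disc] by (simp add: w'_def root2_def)
    finally show "eps = of_int (gamma_mat Q $ 1 $ 1) - w' * of_int (gamma_mat Q $ 2 $ 1)"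
      unfolding eps_def by (simp add: field_simps)
  qed
  define \<zeta> where "\<zeta> = of_real (sgn (of_int (qA Q))) * ((z - of_real w) / (z - of_real w'))"
  have \<zeta>: "\<zeta> \<noteq> 0" using strip_coord_arg[OF disc z]
    by (auto simp: \<zeta>_def w_def w'_def)
  have nz: "z - of_real w' \<noteq> 0" by (rule upper_minus_real_nonzero[OF z])
  have "of_real (sgn (of_int (qA Q))) * ((moebius (gamma_mat Q) z - of_real w) / (moebius (gamma_mat Q) z - of_real w')) =
      of_real (cj eps / eps) * \<zeta>"
    unfolding 1 2 \<zeta>_def using j e0 nz by simp
  hence "strip_coord Q (moebius (gamma_mat Q) z) = Ln (of_real (cj eps / eps) * \<zeta>)"
    by (simp add: strip_coord_def w_def w'_def)
  also have "\<dots> = of_real (ln (cj eps / eps)) + Ln \<zeta>"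
  proof -
    have r: "cj eps / eps > 0" using e0 by (simp add: cj_eps_eq)
    show ?thesis using Ln_times_of_real[OF r \<zeta>] Ln_of_real[OF r] by metis
  qed
  also have "ln (cj eps / eps) = - period"
    unfolding cj_eps_eq period_def using e0 by (simp add: ln_div ln_inverse)
  finally show ?thesis by (simp add: strip_coord_def \<zeta>_def w_def w'_def)
qed

text \<open>
  The integrand is the derivative of a primitive of \<open>G\<close> composed with the strip coordinate. Hence the
  integral depends on the end points of the path only, and their strip coordinates differ by a period.
\<close>

lemma cycle_integral:
  assumes disc: "bqf_disc Q = D" and s: "Re s > 1" and z: "z \<in> upper_half_plane"
    and p: "valid_path p" "path_image p \<subseteq> upper_half_plane" "pathstart p = z"
      "pathfinish p = moebius (gamma_mat Q) z"
  shows "- contour_integral p (\<lambda>z. F (map_bqf of_int Q) s z * of_real rD / bqf_at (map_bqf of_int Q) z) =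
     (\<Sum>\<^sub>\<infinity>x\<in>unit_domain (prim Q). weight Q s x) * (\<i> powr s * c_fun s)"
proof -
  interpret ps: period_sum "prim Q" "weight Q s" ratio_log "\<lambda>n x. x * eps powi (- n)" period s
    by (rule period_sum_form[OF disc s])
  obtain P where P: "\<And>t. t \<in> strip \<Longrightarrow> (P has_field_derivative ps.G t) (at t)"
    using holomorphic_convex_primitive'[OF convex_strip open_strip ps.G_holomorphic] at_within_open[OF _ open_strip]
    by metis
  have der: "((\<lambda>z. P (strip_coord Q z)) has_field_derivative
      F (map_bqf of_int Q) s u * of_real rD / bqf_at (map_bqf of_int Q) u) (at u within upper_half_plane)"
    if u: "u \<in> upper_half_plane" for u
  proof -
    have "F (map_bqf of_int Q) s u = ps.G (strip_coord Q u)"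
      unfolding F_as_lattice_sum[OF disc u] ps.G_def ..
    moreover have "((\<lambda>z. P (strip_coord Q z)) has_field_derivative
        ps.G (strip_coord Q u) * (of_real rD / bqf_at (map_bqf of_int Q) u)) (at u)"
      by (rule DERIV_chain2[OF P[OF strip_coord_strip[OF disc u]] strip_coord_deriv[OF disc u]])
    ultimately show ?thesis by (simp add: has_field_derivative_at_within)
  qed
  from contour_integral_primitive[OF der p(1,2)]
  have "contour_integral p (\<lambda>z. F (map_bqf of_int Q) s z * of_real rD / bqf_at (map_bqf of_int Q) z) =
      P (strip_coord Q z - of_real period) - P (strip_coord Q z)"
    unfolding p(3,4) strip_coord_gamma[OF disc z] by (rule contour_integral_unique)
  moreover have "ps.Y = unit_domain (prim Q)"
    using prim_nonzero[OF disc] by (auto simp: ps.Y_def unit_domain_def)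
  ultimately show ?thesis
    using ps.primitive_over_period[OF P strip_coord_strip[OF disc z]] by simp
qed

section \<open>From primitive points to the zeta function of the class\<close>

text \<open>
  In the fundamental domain \<open>x\<close> and its conjugate are of comparable size.
\<close>

lemma unit_domain_norm_bound:
  assumes x: "x \<in> K" "x \<noteq> 0" "0 \<le> ratio_log x" "ratio_log x < period"
  shows "x\<^sup>2 + (cj x)\<^sup>2 \<le> (1 + (exp period)\<^sup>2) * \<bar>x * cj x\<bar>"
proof -
  define r where "r = exp (ratio_log x)"
  have r: "1 \<le> r" "r \<le> exp period" using x(3,4) by (simp_all add: r_def)
  have cjx: "\<bar>cj x\<bar> = r * \<bar>x\<bar>" unfolding r_def exp_ratio_log[OF x(1,2)]
    using x(2) by simp
  have "x\<^sup>2 + (cj x)\<^sup>2 = (1 + r\<^sup>2) * x\<^sup>2"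
  proof -
    have "(cj x)\<^sup>2 = (r * \<bar>x\<bar>)\<^sup>2" using cjx by (metis power2_abs)
    thus ?thesis by (simp add: power_mult_distrib distrib_right)
  qed
  also have "\<dots> \<le> (1 + (exp period)\<^sup>2) * x\<^sup>2"
    using r by (intro mult_right_mono add_left_mono power_mono) auto
  also have "\<dots> \<le> (1 + (exp period)\<^sup>2) * \<bar>x * cj x\<bar>"
  proof (rule mult_left_mono)
    have "x\<^sup>2 = 1 * (\<bar>x\<bar> * \<bar>x\<bar>)" by (simp add: power2_eq_square)
    also have "\<dots> \<le> r * (\<bar>x\<bar> * \<bar>x\<bar>)" using r
      by (intro mult_right_mono) auto
    also have "\<dots> = \<bar>x * cj x\<bar>" by (simp add: abs_mult cjx)
    finally show "x\<^sup>2 \<le> \<bar>x * cj x\<bar>" .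
  qed (simp add: add_nonneg_nonneg)
  finally show ?thesis .
qed

lemma lattice_zeta_summable:
  assumes disc: "bqf_disc Q = D" and s: "Re s > 1"
  shows "(\<lambda>x. of_real (form_value Q x) powr (- s) :: complex) summable_on unit_domain (lat Q)"
proof (rule abs_summable_summable[OF summable_on_comparison_test])
  define A where "A = \<bar>of_int (qA Q) :: real\<bar>"
  have A: "A > 0" using disc_A_nonzero[OF disc] by (simp add: A_def)
  define E where "E = 1 + (exp period)\<^sup>2"
  have E: "E > 0" by (simp add: E_def add_pos_nonneg)
  show "(\<lambda>x. (A / E) powr (- Re s) * (x\<^sup>2 + (cj x)\<^sup>2) powr (- Re s)) summable_on unit_domain (lat Q)"
    by (intro summable_on_cmult_right summable_on_subset[OF lat_sum_converges[OF disc s]])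
       (auto simp: unit_domain_def)
  fix x assume "x \<in> unit_domain (lat Q)"
  hence x: "x \<in> lat Q" "x \<noteq> 0" "0 \<le> ratio_log x" "ratio_log x < period"
    by (auto simp: unit_domain_def)
  have xK: "x \<in> K" using x(1) lat_K by blast
  have S: "x\<^sup>2 + (cj x)\<^sup>2 > 0" using x by (simp add: sum_power2_gt_zero_iff)
  have N: "form_value Q x > 0" by (rule weight_arg_pos(1)[OF disc xK x(2)])
  have "norm (of_real (form_value Q x) powr (- s) :: complex) = form_value Q x powr (- Re s)"
    by (subst norm_powr_real_powr) simp_all
  also have "\<dots> \<le> (A / E * (x\<^sup>2 + (cj x)\<^sup>2)) powr (- Re s)"
  proof (rule powr_mono2')
    have "x\<^sup>2 + (cj x)\<^sup>2 \<le> E * \<bar>x * cj x\<bar>" unfolding E_def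
      by (rule unit_domain_norm_bound[OF xK x(2-4)])
    hence "A / E * (x\<^sup>2 + (cj x)\<^sup>2) \<le> A / E * (E * \<bar>x * cj x\<bar>)"
      using A E by (intro mult_left_mono) auto
    also have "\<dots> = form_value Q x" using E by (simp add: A_def abs_mult)
    finally show "A / E * (x\<^sup>2 + (cj x)\<^sup>2) \<le> form_value Q x" .
  qed (use A E S s in auto)
  also have "\<dots> = (A / E) powr (- Re s) * (x\<^sup>2 + (cj x)\<^sup>2) powr (- Re s)"
    using A E S by (intro powr_mult)
  finally show "norm (of_real (form_value Q x) powr (- s) :: complex) \<le>
     (A / E) powr (- Re s) * (x\<^sup>2 + (cj x)\<^sup>2) powr (- Re s)" .
qed auto

text \<open>
  The factor is the greatest common divisor of the coordinates. Integral multiples of a point have the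
  same position, so they lie in the fundamental domain together.
\<close>

lemma bij_multiples_of_primitive:
  assumes disc: "bqf_disc Q = D"
  shows "bij_betw (\<lambda>(n, x). real (Suc n) * x) (UNIV \<times> unit_domain (prim Q)) (unit_domain (lat Q))"
  unfolding bij_betw_def
proof
  have ratio: "ratio_log (real (Suc n) * x) = ratio_log x" if "x \<in> K" for n x
  proof -
    have "cj (real (Suc n)) = real (Suc n)" using cj_of_int[of "int (Suc n)"]
      by (simp del: of_nat_Suc)
    moreover have "real (Suc n) \<in> K" using K_of_int[of "int (Suc n)"] by (simp del: of_nat_Suc)
    ultimately have "cj (real (Suc n) * x) / (real (Suc n) * x) = cj x / x"
      using that by (simp add: cj_mult del: of_nat_Suc)
    thus ?thesis by (simp only: ratio_log_def)
  qed
  show "inj_on (\<lambda>(n, x). real (Suc n) * x) (UNIV \<times> unit_domain (prim Q))"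
  proof (rule inj_onI)
    fix P P' assume PP: "P \<in> UNIV \<times> unit_domain (prim Q)" "P' \<in> UNIV \<times> unit_domain (prim Q)"
      "(\<lambda>(n, x). real (Suc n) * x) P = (\<lambda>(n, x). real (Suc n) * x) P'"
    obtain n x n' x' where P: "P = (n, x)" "P' = (n', x')" by (cases P; cases P')
    have xx: "x \<in> prim Q" "x' \<in> prim Q" "real (Suc n) * x = real (Suc n') * x'"
      using PP by (auto simp: P unit_domain_def simp del: of_nat_Suc)
    obtain c d where cd: "x = of_int d + of_int c * root1 Q" "coprime c d" using xx(1)
      unfolding prim_def by blast
    obtain c' d' where cd': "x' = of_int d' + of_int c' * root1 Q" "coprime c' d'" using xx(2)
      unfolding prim_def by blast
    define k k' where "k = int (Suc n)" and "k' = int (Suc n')"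
    have k: "k > 0" "k' > 0" by (simp_all add: k_def k'_def)
    have rk: "real (Suc n) = of_int k" "real (Suc n') = of_int k'"
      by (simp_all add: k_def k'_def del: of_nat_Suc)
    have "of_int (k * d) + of_int (k * c) * root1 Q = of_int (k' * d') + of_int (k' * c') * root1 Q"
      using xx(3) unfolding rk cd(1) cd'(1) by (simp add: algebra_simps)
    hence eq: "k * d = k' * d'" "k * c = k' * c'" using lat_coords_unique[OF disc] by blast+
    have "gcd (k * c) (k * d) = k" using cd(2) k by (simp add: gcd_mult_left)
    moreover have "gcd (k' * c') (k' * d') = k'" using cd'(2) k by (simp add: gcd_mult_left)
    ultimately have "k = k'" using eq by simp
    hence "n = n'" by (simp add: k_def k'_def)
    thus "P = P'" using xx(3) by (simp add: P del: of_nat_Suc)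
  qed
  show "(\<lambda>(n, x). real (Suc n) * x) ` (UNIV \<times> unit_domain (prim Q)) = unit_domain (lat Q)"
  proof (intro equalityI subsetI)
    fix y assume "y \<in> (\<lambda>(n, x). real (Suc n) * x) ` (UNIV \<times> unit_domain (prim Q))"
    then obtain n x where nx: "y = real (Suc n) * x" "x \<in> unit_domain (prim Q)" by auto
    have x: "x \<in> lat Q" "x \<in> K" using nx(2) prim_lat lat_K by (auto simp: unit_domain_def)
    have "of_int (int (Suc n)) * x \<in> lat Q" using x(1) unfolding lat_def
      by (rule zspan_of_int_mult)
    hence "y \<in> lat Q" by (simp add: nx(1))
    thus "y \<in> unit_domain (lat Q)" using nx ratio[OF x(2)]
      by (simp add: unit_domain_def del: of_nat_Suc)
  next
    fix y assume y: "y \<in> unit_domain (lat Q)"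
    then obtain d c where dc: "y = of_int d + of_int c * root1 Q"
      unfolding unit_domain_def lat_coords by blast
    define k where "k = gcd c d"
    have "k \<noteq> 0" using y by (auto simp: unit_domain_def dc k_def)
    hence k: "k > 0" by (simp add: k_def order.not_eq_order_implies_strict)
    obtain c' d' where cd': "c = c' * k" "d = d' * k" "coprime c' d'"
      using gcd_coprime_exists[of c d] \<open>k \<noteq> 0\<close> unfolding k_def by blast
    define x where "x = of_int d' + of_int c' * root1 Q"
    have xp: "x \<in> prim Q" using cd'(3) unfolding prim_def x_def by blast
    hence xK: "x \<in> K" using prim_lat lat_K by blast
    define n where "n = nat k - 1"
    have n: "real (Suc n) = of_int k" using k by (simp add: n_def)
    have yx: "y = real (Suc n) * x" unfolding n by (simp add: dc cd' x_def algebra_simps)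
    have "x \<in> unit_domain (prim Q)"
      using y xp ratio[OF xK, of n] unfolding yx unit_domain_def by (simp del: of_nat_Suc)
    thus "y \<in> (\<lambda>(n, x). real (Suc n) * x) ` (UNIV \<times> unit_domain (prim Q))"
      unfolding yx by (intro image_eqI[of _ _ "(n, x)"]) auto
  qed
qed

lemma lattice_zeta_factor:
  assumes disc: "bqf_disc Q = D" and s: "Re s > 1"
  shows "(\<Sum>\<^sub>\<infinity>x\<in>unit_domain (lat Q). of_real (form_value Q x) powr (- s)) =
     riemann_zeta (2 * s) * (\<Sum>\<^sub>\<infinity>x\<in>unit_domain (prim Q). of_real (form_value Q x) powr (- s))"
proof -
  define h :: "real \<Rightarrow> complex" where "h x = of_real (form_value Q x) powr (- s)" for x
  define \<zeta> :: "nat \<Rightarrow> complex" where "\<zeta> n = 1 / of_nat (Suc n) powr (2 * s)" for n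
  define f where "f = (\<lambda>(n, x). real (Suc n) * x)"
  define Y where "Y = unit_domain (prim Q)"
  note bij = bij_multiples_of_primitive[OF disc, folded f_def Y_def]
  have hf: "h (f (n, x)) = \<zeta> n * h x" if "x \<in> Y" for n x
  proof -
    have x: "x \<in> K" "x \<noteq> 0" using that prim_lat lat_K
      by (auto simp: Y_def unit_domain_def)
    define k where "k = real (Suc n)"
    have k: "k > 0" by (simp add: k_def)
    have kK: "k \<in> K" "cj k = k" using K_of_int[of "int (Suc n)"] cj_of_int[of "int (Suc n)"]
      by (simp_all add: k_def del: of_nat_Suc)
    define N where "N = form_value Q x"
    have N: "N > 0" unfolding N_def by (rule weight_arg_pos(1)[OF disc x])
    have "\<bar>of_int (qA Q) * ((k * x) * cj (k * x))\<bar> = k * (k * N)"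
      using x k kK by (simp add: cj_mult N_def abs_mult)
    hence "h (f (n, x)) = (of_real k * (of_real k * of_real N)) powr (- s)"
      by (simp add: h_def f_def k_def)
    also have "\<dots> = of_real k powr (- s) * (of_real k * of_real N) powr (- s)"
      using k N by (intro powr_of_real_mult) auto
    also have "(of_real k * of_real N) powr (- s) = of_real k powr (- s) * of_real N powr (- s)"
      using k N by (intro powr_of_real_mult) auto
    also have "of_real k powr (- s) * (of_real k powr (- s) * of_real N powr (- s)) =
        (of_real k powr (- s) * of_real k powr (- s)) * of_real N powr (- s)" by simp
    also have "of_real k powr (- s) * of_real k powr (- s) = 1 / of_real k powr (2 * s)"
      by (simp add: powr_minus powr_add[symmetric] field_simps flip: mult_2)
    finally show ?thesis by (simp add: \<zeta>_def h_def N_def k_def)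
  qed
  have "(\<lambda>z. h (f z)) summable_on (UNIV \<times> Y)"
    unfolding summable_on_reindex_bij_betw[OF bij] using lattice_zeta_summable[OF disc s]
      by (simp add: h_def[abs_def])
  hence sm: "(\<lambda>(n, x). \<zeta> n * h x) summable_on (UNIV \<times> Y)"
    by (rule summable_on_cong[THEN iffD1, rotated]) (auto simp: hf)
  have "(\<Sum>\<^sub>\<infinity>x\<in>unit_domain (lat Q). h x) = (\<Sum>\<^sub>\<infinity>z\<in>UNIV \<times> Y. h (f z))"
    by (rule infsum_reindex_bij_betw[OF bij, symmetric])
  also have "\<dots> = (\<Sum>\<^sub>\<infinity>(n, x)\<in>UNIV \<times> Y. \<zeta> n * h x)"
    by (rule infsum_cong) (auto simp: hf)
  also have "\<dots> = (\<Sum>\<^sub>\<infinity>n. \<Sum>\<^sub>\<infinity>x\<in>Y. \<zeta> n * h x)"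
    by (rule infsum_Sigma'_banach[OF sm, symmetric])
  also have "\<dots> = (\<Sum>\<^sub>\<infinity>n. \<zeta> n) * (\<Sum>\<^sub>\<infinity>x\<in>Y. h x)"
    by (simp add: infsum_cmult_right' infsum_cmult_left')
  also have "(\<Sum>\<^sub>\<infinity>n. \<zeta> n) = riemann_zeta (2 * s)"
    unfolding \<zeta>_def by (rule infsumI, rule zeta_has_sum) (use s in simp)
  finally show ?thesis by (simp add: h_def Y_def)
qed

text \<open>
  The power of \<open>\<surd>D\<close> in the weights and the power of \<open>i\<close> in the kernel combine, and division by \<open>\<zeta>(2s)\<close>
  replaces the primitive points by all points.
\<close>

lemma cycle_integral_class_zeta:
  assumes disc: "bqf_disc Q = D" and s: "Re s > 1" and z: "z \<in> upper_half_plane"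
    and p: "valid_path p" "path_image p \<subseteq> upper_half_plane" "pathstart p = z"
      "pathfinish p = moebius (gamma_mat Q) z"
  shows "- contour_integral p (\<lambda>z. F (map_bqf of_int Q) s z * of_real rD / bqf_at (map_bqf of_int Q) z) =
     of_nat unit_index * (c_fun s * (\<i> * of_real rD) powr s *
       (class_zeta D (wide_class (cj ` lat Q)) s / riemann_zeta (2 * s)))"
proof -
  define S where "S = (\<Sum>\<^sub>\<infinity>x\<in>unit_domain (prim Q). of_real (form_value Q x) powr (- s) :: complex)"
  have "weight Q s x = of_real rD powr s * of_real (form_value Q x) powr (- s)"
    if "x \<in> unit_domain (prim Q)" for x
  proof -
    have x: "x \<in> K" "x \<noteq> 0" using that prim_lat lat_K by (auto simp: unit_domain_def)
    define N where "N = form_value Q x"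
    have N: "N > 0" unfolding N_def by (rule weight_arg_pos(1)[OF disc x])
    have "weight Q s x = (of_real rD * of_real (1 / N)) powr s" by (simp add: weight_def N_def)
    also have "\<dots> = of_real rD powr s * of_real (1 / N) powr s"
      using N rD_pos by (intro powr_of_real_mult) auto
    also have "of_real (1 / N) powr s = of_real N powr (- s)"
      unfolding powr_of_real_inverse[OF N] by (simp add: powr_minus_divide)
    finally show ?thesis by (simp add: N_def)
  qed
  hence W: "(\<Sum>\<^sub>\<infinity>x\<in>unit_domain (prim Q). weight Q s x) = of_real rD powr s * S"
    unfolding S_def by (simp add: infsum_cmult_right' cong: infsum_cong)
  have "riemann_zeta (2 * s) * S = of_nat unit_index * class_zeta D (wide_class (cj ` lat Q)) s"
    unfolding S_def lattice_zeta_factor[OF disc s, symmetric]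
    by (rule lattice_sum_eq_class_zeta[OF disc lattice_zeta_summable[OF disc s]])
  moreover have "riemann_zeta (2 * s) \<noteq> 0" by (rule riemann_zeta_nonzero) (use s in simp)
  ultimately have S: "S = of_nat unit_index * class_zeta D (wide_class (cj ` lat Q)) s / riemann_zeta (2 * s)"
    by (simp add: field_simps)
  have "(\<i> * of_real rD) powr s = of_real rD powr s * \<i> powr s"
    using powr_of_real_mult[OF rD_pos, of \<i> s] by (simp add: mult.commute)
  thus ?thesis unfolding cycle_integral[OF assms] W S by simp
qed

text \<open>
  All forms in the class \<open>\<beta>\<close> have lattices in the class inverse to \<open>\<alpha>\<close>, so that they all yield the same
  value; and there is such a form and a path for it, so that the value is determined.
\<close>

lemma Phi_eq:
  assumes \<alpha>: "\<alpha> \<in> carrier (wide_class_group D)" and s: "Re s > 1"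
    and \<beta>: "\<beta> \<in> carrier (narrow_class_group D)" "\<beta> \<subseteq> inv\<^bsub>wide_class_group D\<^esub> \<alpha>"
  shows "Phi D \<beta> s = of_nat unit_index * (c_fun s * (\<i> * of_real rD) powr s *
       (class_zeta D \<alpha> s / riemann_zeta (2 * s)))" (is "_ = ?V")
proof -
  interpret W: group "wide_class_group D" by (rule group_wide)
  obtain Q0 where Q0: "bqf_disc Q0 = D" "inv\<^bsub>wide_class_group D\<^esub> \<alpha> = wide_class (lat Q0)"
    using form_of_class[OF W.inv_closed[OF \<alpha>]] by blast
  have \<alpha>_eq: "wide_class (cj ` lat Q) = \<alpha>" if Q: "bqf_disc Q = D" "form_ideal D Q y \<in> \<beta>" "y \<in> K" "y \<noteq> 0" for Q y
  proof -
    have c: "2 * of_int (qA Q) * y \<in> K" "2 * of_int (qA Q) * y \<noteq> 0"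
      using disc_A_nonzero[OF Q(1)] Q K_mult[OF K_of_int[of "2 * qA Q"] Q(3)] by auto
    have "form_ideal D Q y \<in> wide_class (lat Q0)" using Q(2) \<beta>(2) Q0(2) by auto
    from wide_class_eq[OF this] have "wide_class (lat Q) = wide_class (lat Q0)"
      unfolding form_ideal_eq[OF Q(1)] wide_class_smul[OF c] .
    hence "inv\<^bsub>wide_class_group D\<^esub> \<alpha> = wide_class (lat Q)" using Q0(2) by simp
    hence "inv\<^bsub>wide_class_group D\<^esub> (inv\<^bsub>wide_class_group D\<^esub> \<alpha>) = wide_class (cj ` lat Q)"
      using wide_class_inv(1)[OF Q(1)] by simp
    thus ?thesis using W.inv_inv[OF \<alpha>] by simp
  qed
  have val: "- contour_integral p (\<lambda>z. F (map_bqf of_int Q) s z * of_real (sqrt (of_int D)) / bqf_at (map_bqf of_int Q) z) = ?V"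
    if that': "form_in_class D Q \<beta>" "z\<^sub>0 \<in> upper_half_plane" "valid_path p" "path_image p \<subseteq> upper_half_plane"
      "pathstart p = z\<^sub>0" "pathfinish p = moebius (gamma_mat Q) z\<^sub>0" for Q z\<^sub>0 p
  proof -
    obtain y where y: "bqf_disc Q = D" "y \<in> K" "y \<noteq> 0" "form_ideal D Q y \<in> \<beta>"
      using that'(1) unfolding form_in_class_def by blast
    show ?thesis
      using cycle_integral_class_zeta[OF y(1) s that'(2-6)] unfolding \<alpha>_eq[OF y(1,4,2,3)] .
  qed
  obtain I where I: "I \<in> frac_ideals D" "\<beta> = narrow_class I" using \<beta>(1)
    unfolding carrier_narrow by blast
  obtain Q y where Q: "bqf_disc Q = D" "y \<in> K" "y \<noteq> 0" "sgn (quad_norm D y) = of_int (sgn (qA Q))"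
    "form_ideal D Q y = I" using frac_ideal_eq_form_ideal[OF I(1)] by blast
  have fc: "form_in_class D Q \<beta>"
    unfolding form_in_class_def using Q narrow_class_self[of I] I(2) by blast
  define p where "p = linepath \<i> (moebius (gamma_mat Q) \<i>)"
  have i: "\<i> \<in> upper_half_plane" by (simp add: upper_half_plane_def)
  have gi: "moebius (gamma_mat Q) \<i> \<in> upper_half_plane"
    by (rule moebius_upper[OF det_gamma_mat[OF Q(1)] i])
  have "convex upper_half_plane" unfolding upper_half_plane_def by (rule convex_halfspace_Im_gt)
  hence p: "valid_path p" "path_image p \<subseteq> upper_half_plane" "pathstart p = \<i>" "pathfinish p = moebius (gamma_mat Q) \<i>"
    using i gi by (simp_all add: p_def closed_segment_subset)
  show ?thesis
    unfolding Phi_def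
  proof (rule the_equality)
    fix w assume w: "\<forall>Q z\<^sub>0 p. form_in_class D Q \<beta> \<and> z\<^sub>0 \<in> upper_half_plane \<and>
     valid_path p \<and> path_image p \<subseteq> upper_half_plane \<and>
     pathstart p = z\<^sub>0 \<and> pathfinish p = moebius (gamma_mat Q) z\<^sub>0 \<longrightarrow>
     w = - contour_integral p (\<lambda>z. F (map_bqf of_int Q) s z * of_real (sqrt (of_int D)) / bqf_at (map_bqf of_int Q) z)"
    show "w = ?V" using w[rule_format, of Q \<i> p] fc i p val[OF fc i p] by simp
  qed (use val in auto)
qed

text \<open>
  The two narrow classes coincide exactly if there are four units modulo powers of \<open>\<epsilon>\<close> instead of two.
\<close>

theorem sum_Phi:
  assumes \<alpha>: "\<alpha> \<in> carrier (wide_class_group D)" and s: "Re s > 1"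
  shows "(\<Sum>\<beta> \<in> {\<beta> \<in> carrier (narrow_class_group D). \<beta> \<subseteq> inv\<^bsub>wide_class_group D\<^esub> \<alpha>}. Phi D \<beta> s)
    = 4 * c_fun s * (\<i> * of_real rD) powr s * (class_zeta D \<alpha> s / riemann_zeta (2 * s))"
proof -
  interpret W: group "wide_class_group D" by (rule group_wide)
  define B where "B = {\<beta> \<in> carrier (narrow_class_group D). \<beta> \<subseteq> inv\<^bsub>wide_class_group D\<^esub> \<alpha>}"
  obtain Q where Q: "bqf_disc Q = D" "inv\<^bsub>wide_class_group D\<^esub> \<alpha> = wide_class (lat Q)"
    using form_of_class[OF W.inv_closed[OF \<alpha>]] by blast
  note L = lat_frac_ideal[OF Q(1)]
  have B: "B = {narrow_class (lat Q), narrow_class (smul rD (lat Q))}"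
    unfolding B_def Q(2) by (rule narrow_classes_in_wide[OF L])
  have card: "card B * unit_index = 4"
    unfolding B unit_index_def using narrow_class_eq_iff[OF L] by auto
  define V where "V = c_fun s * (\<i> * of_real rD) powr s * (class_zeta D \<alpha> s / riemann_zeta (2 * s))"
  have "(\<Sum>\<beta>\<in>B. Phi D \<beta> s) = (\<Sum>\<beta>\<in>B. of_nat unit_index * V)"
  proof (rule sum.cong)
    fix \<beta> assume "\<beta> \<in> B"
    thus "Phi D \<beta> s = of_nat unit_index * V"
      unfolding V_def B_def by (intro Phi_eq[OF \<alpha> s]) simp_all
  qed simp
  also have "\<dots> = of_nat (card B * unit_index) * V" by simp
  finally show ?thesis unfolding card by (simp add: B_def V_def)
qed

end

theorem theorem1:
  fixes D :: int and \<alpha> :: "real set set" and s :: complex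
  assumes "D > 1" and "squarefree D"
    and "\<exists>Q :: int bqf. bqf_disc Q = D"
    and "\<alpha> \<in> carrier (wide_class_group D)"
    and "Re s > 1"
  shows "(\<Sum>\<beta> \<in> {\<beta> \<in> carrier (narrow_class_group D). \<beta> \<subseteq> inv\<^bsub>wide_class_group D\<^esub> \<alpha>}. Phi D \<beta> s)
    = 4 * c_fun s * (\<i> * of_real (sqrt (of_int D))) powr s * (class_zeta D \<alpha> s / riemann_zeta (2 * s))"
proof -
  obtain Q :: "int bqf" where Q: "bqf_disc Q = D" using assms(3) by blast
  have "D mod 4 = 1"
  proof (cases "even (qB Q)")
    case True
    then obtain b where "qB Q = 2 * b" by (auto elim: evenE)
    hence "D = 2\<^sup>2 * (b\<^sup>2 - qA Q * qC Q)" using Q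
      by (simp add: bqf_disc_def power2_eq_square algebra_simps)
    hence "2\<^sup>2 dvd D" by (metis dvd_triv_left)
    hence "is_unit (2::int)" using assms(2) unfolding squarefree_def by blast
    thus ?thesis by simp
  next
    case False
    then obtain b where "qB Q = 2 * b + 1" by (auto elim: oddE)
    hence "D = 1 + 4 * (b\<^sup>2 + b - qA Q * qC Q)" using Q
      by (simp add: bqf_disc_def power2_eq_square algebra_simps)
    then obtain m where "D = 1 + 4 * m" by blast
    thus ?thesis by simp
  qed
  then interpret real_quadratic D by unfold_locales (use assms in auto)
  show ?thesis by (rule sum_Phi[OF assms(4,5)])
qed

end
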